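(* Let $A$ be a finite alphabet, let $L \subseteq A^*$ and let $m \geq 2$ be an integer. Then $L$ is definable in $\mathrm{ITL}_m$ if and only if $L$ is recognized by a monoid in $\mathbf{R}_m \vee \mathbf{L}_m$. In particular, it is decidable whether a given regular language is definable in $\mathrm{ITL}_m$.
   Context: For a word $u$, $\alpha(u)$ is the set of letters occurring in $u$. A monoid $M$ recognizes $L \subseteq A^*$ if there is a homomorphism $\varphi : A^* \to M$ with $\varphi^{-1}(\varphi(L)) = L$. Unambiguous interval temporal logic. Formulae are built from atoms $\top$ and $\bot$ by $\neg\varphi$, $\varphi \vee \psi$, $\varphi \wedge \psi$, $\varphi\,\mathsf{F}_a\,\psi$ and $\varphi\,\mathsf{L}_a\,\psi$ for $a \in A$. Semantics over words $u \in A^*$: $u \models \top$ always, $u\models\bot$ never, Boolean connectives as usual; $u \models \varphi\,\mathsf{F}_a\,\psi$ iff $a \in \alpha(u)$ and for the factorization $u = u_0 a u_1$ with $a \notin \alpha(u_0)$ we have $u_0 \models \varphi$ and $u_1 \models \psi$; $u \models \varphi\,\mathsf{L}_a\,\psi$ iff $a \in \alpha(u)$ and for the factorization $u = u_0 a u_1$ with $a \notin \alpha(u_1)$ we have $u_0 \models \varphi$ and $u_1 \models \psi$. The number of turns $t$ is: $t(\top)=t(\bot)=0$, $t(\neg\varphi)=t(\varphi)$, $t(\varphi\vee\psi)=t(\varphi\wedge\psi)=\max\{t(\varphi),t(\psi)\}$, $t(\varphi\,\mathsf{F}_a\,\psi)=\max\{t(\varphi)+1,t(\psi)\}$, $t(\varphi\,\mathsf{L}_a\,\psi)=\max\{t(\varphi),t(\psi)+1\}$.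 $\mathrm{ITL}_m$ is the set of all formulae $\varphi$ with $t(\varphi) \leq m$. $L$ is definable in $\mathrm{ITL}_m$ if $L = \{u \in A^* \mid u \models \varphi\}$ for some $\varphi \in \mathrm{ITL}_m$. Trotter-Weil hierarchy. A variety is a class of finite monoids closed under submonoids, homomorphic images and finite direct products. The join $\mathbf{V} \vee \mathbf{W}$ of two varieties is the smallest variety containing both. For a finite monoid $M$ and $x,y\in M$: $x \mathrel{\mathcal{R}} y$ iff $xM = yM$, and $x \mathrel{\mathcal{L}} y$ iff $Mx = My$. Define congruences on $M$: $x \sim_K y$ iff for all idempotents $e$ of $M$, if $ex \mathrel{\mathcal{R}} e$ or $ey \mathrel{\mathcal{R}} e$, then $ex = ey$; and $x \sim_D y$ iff for all idempotents $e$ of $M$, if $xe \mathrel{\mathcal{L}} e$ or $ye \mathrel{\mathcal{L}} e$, then $xe = ye$. For a variety $\mathbf{V}$, let $\mathbf{K} ⓜ \mathbf{V}$ be the class of all finite monoids $M$ with $M/{\sim_K} \in \mathbf{V}$, and $\mathbf{D} ⓜ \mathbf{V}$ the class of all finite monoids $M$ with $M/{\sim_D} \in \mathbf{V}$. $\mathbf{R}_2$ is the variety of $\mathcal{R}$-trivial finite monoids (those in which $\mathcal{R}$ is equality), $\mathbf{L}_2$ is the variety of $\mathcal{L}$-trivial finite monoids, and for $m \geq 2$, $\mathbf{R}_{m+1} = \mathbf{K} ⓜ \mathbf{L}_m$ and $\mathbf{L}_{m+1} = \mathbf{D} ⓜ \mathbf{R}_m$. Each of these is a variety. *)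

theory Defs
  imports
    "HOL-Algebra.Coset"
    "HOL-Algebra.Product_Groups"
    "HOL-Library.Nat_Bijection"
begin

section \<open>Unambiguous interval temporal logic\<close>

datatype (letters: 'a) itl =
    Top
  | Bot
  | Neg "'a itl"
  | Or "'a itl" "'a itl"
  | And "'a itl" "'a itl"
  | First "'a itl" 'a "'a itl"
  | Last "'a itl" 'a "'a itl"

fun models :: "'a list \<Rightarrow> 'a itl \<Rightarrow> bool" where
  "models u Top \<longleftrightarrow> True"
| "models u Bot \<longleftrightarrow> False"
| "models u (Neg \<phi>) \<longleftrightarrow> \<not> models u \<phi>"
| "models u (Or \<phi> \<psi>) \<longleftrightarrow> models u \<phi> \<or> models u \<psi>"
| "models u (And \<phi> \<psi>) \<longleftrightarrow> models u \<phi> \<and> models u \<psi>"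
| "models u (First \<phi> a \<psi>) \<longleftrightarrow>
     (\<exists>u0 u1. u = u0 @ a # u1 \<and> a \<notin> set u0 \<and> models u0 \<phi> \<and> models u1 \<psi>)"
| "models u (Last \<phi> a \<psi>) \<longleftrightarrow>
     (\<exists>u0 u1. u = u0 @ a # u1 \<and> a \<notin> set u1 \<and> models u0 \<phi> \<and> models u1 \<psi>)"

fun turns :: "'a itl \<Rightarrow> nat" where
  "turns Top = 0"
| "turns Bot = 0"
| "turns (Neg \<phi>) = turns \<phi>"
| "turns (Or \<phi> \<psi>) = max (turns \<phi>) (turns \<psi>)"
| "turns (And \<phi> \<psi>) = max (turns \<phi>) (turns \<psi>)"
| "turns (First \<phi> a \<psi>) = max (turns \<phi> + 1) (turns \<psi>)"
| "turns (Last \<phi> a \<psi>) = max (turns \<phi>) (turns \<psi> + 1)"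

definition ITL :: "'a set \<Rightarrow> nat \<Rightarrow> 'a itl set" where
  "ITL A m = {\<phi>. letters \<phi> \<subseteq> A \<and> turns \<phi> \<le> m}"

definition itl_definable :: "'a set \<Rightarrow> nat \<Rightarrow> 'a list set \<Rightarrow> bool" where
  "itl_definable A m L \<longleftrightarrow> (\<exists>\<phi>\<in>ITL A m. L = {u \<in> lists A. models u \<phi>})"


section \<open>Finite monoids and varieties\<close>

text \<open>
  Library homomorphisms (\<^const>\<open>hom\<close>) need not preserve the unit.
\<close>

definition monoid_hom :: "('a, 'c) monoid_scheme \<Rightarrow> ('b, 'd) monoid_scheme \<Rightarrow> ('a \<Rightarrow> 'b) set" where
  "monoid_hom M N = {h \<in> hom M N. h \<one>\<^bsub>M\<^esub> = \<one>\<^bsub>N\<^esub>}"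

definition free_monoid :: "'a set \<Rightarrow> 'a list monoid" where
  "free_monoid A = \<lparr>carrier = lists A, mult = (@), one = []\<rparr>"

definition recognizes :: "('b, 'c) monoid_scheme \<Rightarrow> 'a set \<Rightarrow> 'a list set \<Rightarrow> bool" where
  "recognizes M A L \<longleftrightarrow>
     (\<exists>h \<in> monoid_hom (free_monoid A) M. {u \<in> lists A. h u \<in> h ` L} = L)"

definition finite_monoid :: "('a, 'c) monoid_scheme \<Rightarrow> bool" where
  "finite_monoid M \<longleftrightarrow> monoid M \<and> finite (carrier M)"

text \<open>
  Every finite monoid is isomorphic to one whose elements are natural numbers, so a class of
  finite monoids (closed under isomorphism) is rendered as a set of type \<open>nat monoid set\<close>.
  Direct products have a different element type and are therefore taken up to isomorphism.
  The empty index set gives the trivial monoid.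
\<close>

definition variety :: "nat monoid set \<Rightarrow> bool" where
  "variety V \<longleftrightarrow>
     (\<forall>M\<in>V. finite_monoid M) \<and>
     (\<forall>M\<in>V. \<forall>H. submonoid H M \<longrightarrow> M\<lparr>carrier := H\<rparr> \<in> V) \<and>
     (\<forall>M\<in>V. \<forall>N. \<forall>h\<in>monoid_hom M N.
        finite_monoid N \<and> h ` carrier M = carrier N \<longrightarrow> N \<in> V) \<and>
     (\<forall>(I :: nat set) M N. finite I \<and> (\<forall>i\<in>I. M i \<in> V) \<and>
        finite_monoid N \<and> N \<cong> product_group I M \<longrightarrow> N \<in> V)"

definition variety_join :: "nat monoid set \<Rightarrow> nat monoid set \<Rightarrow> nat monoid set" where
  "variety_join V W = \<Inter>{U. variety U \<and> V \<subseteq> U \<and> W \<subseteq> U}"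


section \<open>The Trotter-Weil hierarchy\<close>

definition green_R :: "('a, 'c) monoid_scheme \<Rightarrow> 'a \<Rightarrow> 'a \<Rightarrow> bool" where
  "green_R M x y \<longleftrightarrow> x <#\<^bsub>M\<^esub> carrier M = y <#\<^bsub>M\<^esub> carrier M"

definition green_L :: "('a, 'c) monoid_scheme \<Rightarrow> 'a \<Rightarrow> 'a \<Rightarrow> bool" where
  "green_L M x y \<longleftrightarrow> carrier M #>\<^bsub>M\<^esub> x = carrier M #>\<^bsub>M\<^esub> y"

definition idempotents :: "('a, 'c) monoid_scheme \<Rightarrow> 'a set" where
  "idempotents M = {e \<in> carrier M. e \<otimes>\<^bsub>M\<^esub> e = e}"

definition sim_K :: "('a, 'c) monoid_scheme \<Rightarrow> ('a \<times> 'a) set" where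
  "sim_K M = {(x, y) \<in> carrier M \<times> carrier M. \<forall>e \<in> idempotents M.
     green_R M (e \<otimes>\<^bsub>M\<^esub> x) e \<or> green_R M (e \<otimes>\<^bsub>M\<^esub> y) e \<longrightarrow> e \<otimes>\<^bsub>M\<^esub> x = e \<otimes>\<^bsub>M\<^esub> y}"

definition sim_D :: "('a, 'c) monoid_scheme \<Rightarrow> ('a \<times> 'a) set" where
  "sim_D M = {(x, y) \<in> carrier M \<times> carrier M. \<forall>e \<in> idempotents M.
     green_L M (x \<otimes>\<^bsub>M\<^esub> e) e \<or> green_L M (y \<otimes>\<^bsub>M\<^esub> e) e \<longrightarrow> x \<otimes>\<^bsub>M\<^esub> e = y \<otimes>\<^bsub>M\<^esub> e}"

definition quotient_monoid :: "('a, 'c) monoid_scheme \<Rightarrow> ('a \<times> 'a) set \<Rightarrow> 'a set monoid" where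
  "quotient_monoid M r =
     \<lparr>carrier = carrier M // r,
      mult = (\<lambda>X Y. \<Union>x\<in>X. \<Union>y\<in>Y. r `` {x \<otimes>\<^bsub>M\<^esub> y}),
      one = r `` {\<one>\<^bsub>M\<^esub>}\<rparr>"

definition K_malcev :: "nat monoid set \<Rightarrow> nat monoid set" where
  "K_malcev V = {M. finite_monoid M \<and> (\<exists>N\<in>V. quotient_monoid M (sim_K M) \<cong> N)}"

definition D_malcev :: "nat monoid set \<Rightarrow> nat monoid set" where
  "D_malcev V = {M. finite_monoid M \<and> (\<exists>N\<in>V. quotient_monoid M (sim_D M) \<cong> N)}"

definition R_trivial :: "nat monoid set" where
  "R_trivial = {M. finite_monoid M \<and>
     (\<forall>x\<in>carrier M. \<forall>y\<in>carrier M. green_R M x y \<longrightarrow> x = y)}"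

definition L_trivial :: "nat monoid set" where
  "L_trivial = {M. finite_monoid M \<and>
     (\<forall>x\<in>carrier M. \<forall>y\<in>carrier M. green_L M x y \<longrightarrow> x = y)}"

text \<open>The hierarchy starts at level 2; the values at levels 0 and 1 are irrelevant.\<close>

fun TW_R :: "nat \<Rightarrow> nat monoid set" and TW_L :: "nat \<Rightarrow> nat monoid set" where
  "TW_R m = (if m \<le> 2 then R_trivial else K_malcev (TW_L (m - 1)))"
| "TW_L m = (if m \<le> 2 then L_trivial else D_malcev (TW_R (m - 1)))"

declare TW_R.simps [simp del] TW_L.simps [simp del]


section \<open>Decidability\<close>

text \<open>
  Partial recursive functions. \<open>rec_computes f xs y\<close> means that \<open>f\<close> is defined on the argument
  list \<open>xs\<close> with value \<open>y\<close>. The recursion variable and the search variable come first.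
\<close>

datatype recf =
    Zero
  | Succ
  | Proj nat
  | Comp recf "recf list"
  | PrimRec recf recf
  | Mu recf

inductive rec_computes :: "recf \<Rightarrow> nat list \<Rightarrow> nat \<Rightarrow> bool" where
  zero: "rec_computes Zero xs 0"
| succ: "rec_computes Succ [x] (Suc x)"
| proj: "i < length xs \<Longrightarrow> rec_computes (Proj i) xs (xs ! i)"
| comp: "list_all2 (\<lambda>g y. rec_computes g xs y) gs ys \<Longrightarrow> rec_computes f ys z
    \<Longrightarrow> rec_computes (Comp f gs) xs z"
| prim_0: "rec_computes f xs y \<Longrightarrow> rec_computes (PrimRec f g) (0 # xs) y"
| prim_Suc: "rec_computes (PrimRec f g) (n # xs) y \<Longrightarrow> rec_computes g (n # y # xs) z
    \<Longrightarrow> rec_computes (PrimRec f g) (Suc n # xs) z"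
| mu: "rec_computes f (n # xs) 0 \<Longrightarrow> (\<And>k. k < n \<Longrightarrow> \<exists>y. rec_computes f (k # xs) (Suc y))
    \<Longrightarrow> rec_computes (Mu f) xs n"

definition decidable :: "nat set \<Rightarrow> bool" where
  "decidable S \<longleftrightarrow> (\<exists>f. \<forall>n. rec_computes f [n] (if n \<in> S then 1 else 0))"

text \<open>
  Regular languages are given as input by complete deterministic finite automata over the letter
  indices \<open>{..<k}\<close>. The states are \<open>{..<length (trans D)}\<close> and the \<open>i\<close>-th letter takes state
  \<open>q\<close> to \<open>trans D ! q ! i\<close>.
\<close>

datatype dfa = DFA (start: nat) (final: "nat list") (trans: "nat list list")

definition wf_dfa :: "nat \<Rightarrow> dfa \<Rightarrow> bool" where
  "wf_dfa k D \<longleftrightarrow>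
     start D < length (trans D) \<and>
     set (final D) \<subseteq> {..<length (trans D)} \<and>
     (\<forall>row \<in> set (trans D). length row = k \<and> set row \<subseteq> {..<length (trans D)})"

text \<open>The list \<open>as\<close> enumerates the alphabet.\<close>

definition dfa_lang :: "'a list \<Rightarrow> dfa \<Rightarrow> 'a list set" where
  "dfa_lang as D = {map ((!) as) w | w. w \<in> lists {..<length as} \<and>
     foldl (\<lambda>q i. trans D ! q ! i) (start D) w \<in> set (final D)}"

definition dfa_code :: "dfa \<Rightarrow> nat" where
  "dfa_code D =
     list_encode [start D, list_encode (final D), list_encode (map list_encode (trans D))]"

end

theory Submission imports Defs begin

text \<open>
  Let \<open>rsim m n\<close> compare two words by jumps to first occurrences, nested alternately with jumps to
  last occurrences; it is a congruence of finite index. A pumping argument shows that its quotient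
  lies in \<open>\<^bold>R\<^sub>m\<close>, and its mirror image gives \<open>\<^bold>L\<^sub>m\<close>. The intersection \<open>lrsim m n\<close> of both is refined
  enough to determine the truth of \<open>ITL\<^sub>m\<close> formulae, and its classes are \<open>ITL\<^sub>m\<close> definable.

  Conversely, for \<open>m \<ge> 2\<close> all monoids in \<open>\<^bold>R\<^sub>m \<or> \<^bold>L\<^sub>m\<close> lie in DA and satisfy the identity \<open>U\<^sub>m = V\<^sub>m\<close>, where
  \<open>U\<^sub>1 = s\<close>, \<open>V\<^sub>1 = 1\<close> and \<open>U\<^sub>m\<^sub>+\<^sub>1 = z (U\<^sub>m p)\<^sup>\<omega> U\<^sub>m (q U\<^sub>m)\<^sup>\<omega> z'\<close>, \<open>V\<^sub>m\<^sub>+\<^sub>1 = z (U\<^sub>m p)\<^sup>\<omega> V\<^sub>m (q U\<^sub>m)\<^sup>\<omega> z'\<close>.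
  In a finite quotient satisfying these identities, cutting \<open>u\<close> where its \<open>\<R>\<close>-class drops and \<open>v\<close> where
  its \<open>\<L>\<close>-class drops turns \<open>u\<close> into \<open>v\<close> segment by segment, so \<open>lrsim m n\<close> is contained in the
  congruence for large \<open>n\<close>. Since the identities can be tested on the finitely many transformations
  of an automaton, definability is decidable.
\<close>

section \<open>Congruences defined by first and last occurrences\<close>

text \<open>Level \<open>k + 2\<close> goes with index \<open>Suc k\<close> of
  \<open>tw_pairs\<close>, because index 0 stands for \<open>U\<^sub>1 = V\<^sub>1\<close>. Two
  facts drive the inclusion of \<open>lrsim\<close> in a congruence. In DA, whether an idempotent
  \<open>e\<close> absorbs a word \<open>w\<close> (that is, \<open>e w e = e\<close>) depends only
  on the letters of \<open>w\<close>; hence a class can drop only at a letter not read since the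
  previous drop, and drops are found by first or last occurrences. Moreover, idempotents
  \<open>e\<close> and \<open>f\<close> absorbing \<open>U\<close> can be put for \<open>p\<close>
  and \<open>q\<close>, so that the identity says: \<open>U\<close> may be exchanged for
  \<open>V\<close> between such idempotents. The obstacle is the order of the markers. If the
  last-occurrence marker precedes the first-occurrence marker, the segment between them is enclosed
  by two jumps facing each other, and counting naively loses two levels.
  \<open>lrsim_between\<close> loses one, but only from level 2 on; below that,
  \<open>U\<^sub>2 = V\<^sub>2\<close> allows segments to be exchanged without comparing them. The
  induction over levels adds the pairs of the next lower index to the congruence. For an automaton
  with \<open>n\<close> states, \<omega> becomes \<open>n!\<close>, and words of length at most
  \<open>n ^ n\<close> suffice.\<close>

definition before_first :: "'a \<Rightarrow> 'a list \<Rightarrow> 'a list" where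
  "before_first a u = takeWhile (\<lambda>x. x \<noteq> a) u"

definition after_first :: "'a \<Rightarrow> 'a list \<Rightarrow> 'a list" where
  "after_first a u = tl (dropWhile (\<lambda>x. x \<noteq> a) u)"

lemma first_split [simp]:
  assumes "a \<notin> set u0"
  shows "before_first a (u0 @ a # u1) = u0" "after_first a (u0 @ a # u1) = u1"
proof -
  have "takeWhile (\<lambda>x. x \<noteq> a) (u0 @ a # u1) = u0 \<and> dropWhile (\<lambda>x. x \<noteq> a) (u0 @ a # u1) = a # u1"
    using assms by (induction u0) auto
  then show "before_first a (u0 @ a # u1) = u0" "after_first a (u0 @ a # u1) = u1"
    by (simp_all add: before_first_def after_first_def)
qed

lemma notin_before_first [simp]: "a \<notin> set (before_first a u)"
  by (auto simp: before_first_def dest: set_takeWhileD)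

lemma first_decomp: "a \<in> set u \<Longrightarrow> u = before_first a u @ a # after_first a u"
  by (metis first_split split_list_first)

text \<open>The first argument counts turns, the second jumps. Passing to the part before a first
  occurrence is a turn: it costs a level, and that part is then read from its other end, hence the
  reversals. Going on to the right costs only a jump. At level 1 this is Simon's congruence: the
  same scattered subwords of length at most \<open>n\<close>.\<close>

fun rsim :: "nat \<Rightarrow> nat \<Rightarrow> 'a list \<Rightarrow> 'a list \<Rightarrow> bool" where
  "rsim 0 n u v \<longleftrightarrow> True"
| "rsim (Suc m) 0 u v \<longleftrightarrow> True"
| "rsim (Suc m) (Suc n) u v \<longleftrightarrow> rsim m (Suc n) (rev u) (rev v) \<and> set u = set v \<and>
     (\<forall>a\<in>set u. rsim m n (rev (before_first a u)) (rev (before_first a v)) \<and>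
                rsim (Suc m) n (after_first a u) (after_first a v))"

definition lrsim :: "nat \<Rightarrow> nat \<Rightarrow> 'a list \<Rightarrow> 'a list \<Rightarrow> bool" where
  "lrsim m n u v \<longleftrightarrow> rsim m n u v \<and> rsim m n (rev u) (rev v)"

lemma rsim_zero [simp]: "rsim m 0 u v"
  by (cases m) auto

lemma rsim_refl [simp]: "rsim m n u u"
proof -
  have "u = v \<Longrightarrow> rsim m n u v" for v
    by (induction m n u v rule: rsim.induct) auto
  then show ?thesis by simp
qed

lemma rsim_sym: "rsim m n u v \<Longrightarrow> rsim m n v u"
  by (induction m n u v rule: rsim.induct) auto

lemma rsim_trans: "rsim m n u v \<Longrightarrow> rsim m n v w \<Longrightarrow> rsim m n u w"
proof (induction m n u v arbitrary: w rule: rsim.induct)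
  case (3 m n u v)
  from "3.prems" show ?case
    by (auto intro: "3.IH")
qed auto

declare rsim.simps(3) [simp del]

lemma rsim_set: "rsim (Suc m) (Suc n) u v \<Longrightarrow> set u = set v"
  by (simp add: rsim.simps(3))

lemma rsim_rev: "rsim (Suc m) n u v \<Longrightarrow> rsim m n (rev u) (rev v)"
  by (cases n) (auto simp: rsim.simps(3))

lemma rsim_first:
  assumes "rsim (Suc m) (Suc n) (u0 @ a # u1) (v0 @ a # v1)" "a \<notin> set u0" "a \<notin> set v0"
  shows "rsim m n (rev u0) (rev v0)" "rsim (Suc m) n u1 v1"
proof -
  have "rsim m n (rev (before_first a (u0 @ a # u1))) (rev (before_first a (v0 @ a # v1)))"
       "rsim (Suc m) n (after_first a (u0 @ a # u1)) (after_first a (v0 @ a # v1))"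
    using assms(1) by (simp_all add: rsim.simps(3) del: first_split)
  with assms(2,3) show "rsim m n (rev u0) (rev v0)" "rsim (Suc m) n u1 v1"
    by simp_all
qed

lemma rsim_SucI:
  assumes "rsim m (Suc n) (rev u) (rev v)" "set u = set v"
    and "\<And>a u0 u1 v0 v1. u = u0 @ a # u1 \<Longrightarrow> v = v0 @ a # v1 \<Longrightarrow> a \<notin> set u0 \<Longrightarrow> a \<notin> set v0 \<Longrightarrow>
      rsim m n (rev u0) (rev v0) \<and> rsim (Suc m) n u1 v1"
  shows "rsim (Suc m) (Suc n) u v"
proof -
  have "rsim m n (rev (before_first a u)) (rev (before_first a v)) \<and>
        rsim (Suc m) n (after_first a u) (after_first a v)" if "a \<in> set u" for a
    using that assms(2) by (intro assms(3)[of _ a]) (auto intro: first_decomp)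
  then show ?thesis using assms(1,2) by (simp add: rsim.simps(3))
qed

lemma rsim_Suc_depth: "rsim m (Suc n) u v \<Longrightarrow> rsim m n u v"
proof (induction m n u v rule: rsim.induct)
  case (3 m n u v)
  then show ?case by (simp add: rsim.simps(3)[of m n] rsim.simps(3)[of m "Suc n"])
qed auto

lemma rsim_depth_mono: "n' \<le> n \<Longrightarrow> rsim m n u v \<Longrightarrow> rsim m n' u v"
  by (induction rule: inc_induct) (auto intro: rsim_Suc_depth)

lemma rsim_level: "rsim (Suc m) n u v \<Longrightarrow> rsim m n u v"
proof (induction m n u v rule: rsim.induct)
  case (3 m n u v)
  then show ?case by (simp add: rsim.simps(3)[of m n] rsim.simps(3)[of "Suc m" n])
qed auto

text \<open>Both ends share one induction because the recursive clauses reverse words, which moves a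
  letter added on one end to the other.\<close>

lemma rsim_letter: "rsim m n u v \<Longrightarrow> rsim m n (b # u) (b # v) \<and> rsim m n (u @ [b]) (v @ [b])"
proof (induction m n u v rule: rsim.induct)
  case (3 m n u v)
  note IH = "3.IH"
  from "3.prems" have lo: "rsim m (Suc n) (rev u) (rev v)" and s: "set u = set v"
    by (auto simp: rsim.simps(3))
  have dec: "rsim m n (rev u0) (rev v0)" "rsim (Suc m) n u1 v1"
       "rsim m n (rev u0 @ [b]) (rev v0 @ [b])" "rsim (Suc m) n (u1 @ [b]) (v1 @ [b])"
    if "u = u0 @ a # u1" "v = v0 @ a # v1" "a \<notin> set u0" "a \<notin> set v0" for a u0 u1 v0 v1
  proof -
    note r = rsim_first[OF "3.prems"[unfolded that(1,2)] that(3,4)]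
    show "rsim m n (rev u0) (rev v0)" "rsim (Suc m) n u1 v1" by (fact r)+
    have "a \<in> set u" using that by simp
    then show "rsim m n (rev u0 @ [b]) (rev v0 @ [b])" "rsim (Suc m) n (u1 @ [b]) (v1 @ [b])"
      using IH(2,3)[of a] r that by simp_all
  qed
  have "rsim (Suc m) (Suc n) (b # u) (b # v)"
  proof (rule rsim_SucI)
    show "rsim m (Suc n) (rev (b # u)) (rev (b # v))" using IH(1)[OF lo] by simp
  next
    fix a u0 u1 v0 v1
    assume a: "b # u = u0 @ a # u1" "b # v = v0 @ a # v1" "a \<notin> set u0" "a \<notin> set v0"
    show "rsim m n (rev u0) (rev v0) \<and> rsim (Suc m) n u1 v1"
    proof (cases "a = b")
      case True
      have "u0 = []" using a(1,3) True by (cases u0) auto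
      moreover have "v0 = []" using a(2,4) True by (cases v0) auto
      ultimately show ?thesis using a "3.prems" by (auto intro: rsim_Suc_depth)
    next
      case False
      obtain u0' where "u0 = b # u0'" using a(1) False by (cases u0) auto
      moreover obtain v0' where "v0 = b # v0'" using a(2) False by (cases v0) auto
      ultimately show ?thesis using a dec[of u0' a u1 v0' v1] by auto
    qed
  qed (use s in simp)
  moreover have "rsim (Suc m) (Suc n) (u @ [b]) (v @ [b])"
  proof (rule rsim_SucI)
    show "rsim m (Suc n) (rev (u @ [b])) (rev (v @ [b]))" using IH(1)[OF lo] by simp
  next
    fix a u0 u1 v0 v1
    assume a: "u @ [b] = u0 @ a # u1" "v @ [b] = v0 @ a # v1" "a \<notin> set u0" "a \<notin> set v0"
    show "rsim m n (rev u0) (rev v0) \<and> rsim (Suc m) n u1 v1"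
    proof (cases "a \<in> set u")
      case True
      then obtain x y x' y' where xy: "u = x @ a # y" "v = x' @ a # y'" "a \<notin> set x" "a \<notin> set x'"
        using s by (metis split_list_first)
      have "u0 = x" "u1 = y @ [b]" "v0 = x'" "v1 = y' @ [b]"
        using a xy first_split[of a u0 u1] first_split[of a x "y @ [b]"]
          first_split[of a v0 v1] first_split[of a x' "y' @ [b]"] by auto
      then show ?thesis using dec[OF xy] by simp
    next
      case False
      have "a \<in> set (u @ [b])" unfolding a(1) by simp
      then have ab: "a = b" using False by simp
      have "u0 = u" "u1 = []" "v0 = v" "v1 = []"
        using a False s ab first_split[of a u0 u1] first_split[of a u "[]"]
          first_split[of a v0 v1] first_split[of a v "[]"] by auto
      then show ?thesis using rsim_Suc_depth[OF lo] by simp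
    qed
  qed (use s in simp)
  ultimately show ?case by blast
qed auto

lemma rsim_append: "rsim m n u v \<Longrightarrow> rsim m n (x @ u @ y) (x @ v @ y)"
proof -
  assume a: "rsim m n u v"
  have "rsim m n (u @ y) (v @ y)"
  proof (induction y rule: rev_induct)
    case (snoc b y) then show ?case using rsim_letter[of m n "u @ y" "v @ y" b] by simp
  qed (simp add: a)
  then show ?thesis by (induction x) (auto dest: rsim_letter)
qed

lemma rsim_mult:
  assumes "rsim m n u v" "rsim m n u' v'"
  shows "rsim m n (u @ u') (v @ v')"
  using rsim_append[OF assms(1), of "[]" u'] rsim_append[OF assms(2), of v "[]"]
  by (auto intro: rsim_trans)

text \<open>\<open>rsim_first\<close> compares the parts before \<open>a\<close> only reversed and
  one level lower. The full level comes back since a jump to a first \<open>b\<close> inside these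
  parts is also a jump in the whole words, and what follows \<open>b\<close> is again bounded by the
  first \<open>a\<close>, so induction on the depth applies. With \<open>2 \<le> m\<close> the
  reversed parts are compared at a positive level, which makes their letters agree.\<close>

lemma rsim_before_first:
  assumes "2 \<le> m" "rsim m (Suc n) (u0 @ a # u1) (v0 @ a # v1)" "a \<notin> set u0" "a \<notin> set v0"
  shows "rsim m n u0 v0"
proof -
  obtain k where k: "m = Suc (Suc k)" using assms(1) by (metis add_2_eq_Suc le_Suc_ex)
  show ?thesis using assms(2-4) unfolding k
  proof (induction n arbitrary: u0 u1 v0 v1)
    case (Suc n)
    note r = rsim_first[OF Suc.prems]
    show ?case
    proof (rule rsim_SucI)
      show "rsim (Suc k) (Suc n) (rev u0) (rev v0)" by (fact r)
      then show "set u0 = set v0" using rsim_set by fastforce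
    next
      fix b w0 w1 x0 x1
      assume b: "u0 = w0 @ b # w1" "v0 = x0 @ b # x1" "b \<notin> set w0" "b \<notin> set x0"
      have ab: "a \<notin> set w1" "a \<notin> set x1" using b Suc.prems by auto
      have "rsim (Suc (Suc k)) (Suc (Suc n)) (w0 @ b # (w1 @ a # u1)) (x0 @ b # (x1 @ a # v1))"
        using Suc.prems(1) b by simp
      from rsim_first[OF this b(3,4)]
      have 1: "rsim (Suc k) (Suc n) (rev w0) (rev x0)"
        and 2: "rsim (Suc (Suc k)) (Suc n) (w1 @ a # u1) (x1 @ a # v1)" .
      show "rsim (Suc k) n (rev w0) (rev x0) \<and> rsim (Suc (Suc k)) n w1 x1"
        using rsim_Suc_depth[OF 1] Suc.IH[OF 2 ab] by simp
    qed
  qed simp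
qed

text \<open>Both sides express that the first \<open>a\<close> stands strictly to the left of the
  last \<open>b\<close>; so this can be tested from either end.\<close>

lemma letter_order_conv:
  assumes "u0 @ a # u1 = x @ b # y" "a \<notin> set u0" "b \<notin> set y"
  shows "b \<in> set u1 \<longleftrightarrow> a \<in> set x"
proof -
  from assms(1) consider us where "u0 = x @ us" "us @ a # u1 = b # y"
    | us where "x = u0 @ us" "a # u1 = us @ b # y"
    by (auto simp: append_eq_append_conv2)
  then show ?thesis
  proof cases
    case 1 then show ?thesis using assms(2,3) by (cases us) auto
  next
    case 2 then show ?thesis using assms(2,3) by (cases us) auto
  qed
qed

text \<open>The words are read from the right, whereas the cut is at a first occurrence from the
  left. Whether \<open>b\<close> occurs after the cut is decided by jumping to the last
  \<open>b\<close> and asking if \<open>a\<close> is among the letters left of it. Jumps inside the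
  part after the cut are jumps of the whole words, and the cut remains in the unread rest.\<close>

lemma rsim_rev_after_first:
  assumes "rsim m (Suc n) (rev (u0 @ a # u1)) (rev (v0 @ a # v1))" "a \<notin> set u0" "a \<notin> set v0"
  shows "rsim m n (rev u1) (rev v1)"
  using assms
proof (induction n arbitrary: m u0 u1 v0 v1)
  case (Suc n)
  show ?case
  proof (cases m)
    case (Suc k)
    note prem = Suc.prems(1)[unfolded Suc]
    have low: "rsim k (Suc n) u1 v1"
    proof (cases k)
      case (Suc j)
      have "rsim (Suc j) (Suc (Suc n)) (u0 @ a # u1) (v0 @ a # v1)"
        using rsim_rev[OF prem] unfolding Suc by simp
      from rsim_first(2)[OF this Suc.prems(2,3)] show ?thesis using Suc by simp
    qed simp
    have mem: "b \<in> set u1 \<longleftrightarrow> b \<in> set v1" for b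
    proof (cases "b \<in> set (u0 @ a # u1)")
      case True
      then have "b \<in> set (v0 @ a # v1)" using rsim_set[OF prem] by auto
      with True obtain x y x' y' where xy: "u0 @ a # u1 = x @ b # y" "b \<notin> set y"
        "v0 @ a # v1 = x' @ b # y'" "b \<notin> set y'" by (meson split_list_last)
      have "rsim (Suc k) (Suc n) (rev x) (rev x')"
        using rsim_first(2)[of k "Suc n" "rev y" b "rev x" "rev y'" "rev x'"] prem xy
        by simp
      then have "set x = set x'" using rsim_set by fastforce
      moreover have "b \<in> set u1 \<longleftrightarrow> a \<in> set x"
        using letter_order_conv[OF xy(1) Suc.prems(2) xy(2)] .
      moreover have "b \<in> set v1 \<longleftrightarrow> a \<in> set x'"
        using letter_order_conv[OF xy(3) Suc.prems(3) xy(4)] .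
      ultimately show ?thesis by simp
    next
      case False then show ?thesis using rsim_set[OF prem] by auto
    qed
    show ?thesis unfolding Suc
    proof (rule rsim_SucI)
      show "rsim k (Suc n) (rev (rev u1)) (rev (rev v1))" using low by simp
      show "set (rev u1) = set (rev v1)" using mem by auto
    next
      fix b w0 w1 x0 x1
      assume b: "rev u1 = w0 @ b # w1" "rev v1 = x0 @ b # x1" "b \<notin> set w0" "b \<notin> set x0"
      have "rsim (Suc k) (Suc (Suc n)) (w0 @ b # (w1 @ a # rev u0)) (x0 @ b # (x1 @ a # rev v0))"
        using prem b by simp
      from rsim_first[OF this b(3,4)]
      have 1: "rsim k (Suc n) (rev w0) (rev x0)"
        and 2: "rsim (Suc k) (Suc n) (w1 @ a # rev u0) (x1 @ a # rev v0)" .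
      have "rsim (Suc k) (Suc n) (rev (u0 @ a # rev w1)) (rev (v0 @ a # rev x1))" using 2 by simp
      from Suc.IH[OF this Suc.prems(2,3)] rsim_Suc_depth[OF 1]
      show "rsim k n (rev w0) (rev x0) \<and> rsim (Suc k) n w1 x1" by simp
    qed
  qed simp
qed simp

section \<open>The two-sided congruence under jumps from either end\<close>

lemma lrsim_sym: "lrsim m n u v \<Longrightarrow> lrsim m n v u"
  by (auto simp: lrsim_def intro: rsim_sym)

lemma lrsim_rev [simp]: "lrsim m n (rev u) (rev v) \<longleftrightarrow> lrsim m n u v"
  by (auto simp: lrsim_def)

lemma lrsim_depth_mono: "lrsim m n u v \<Longrightarrow> n' \<le> n \<Longrightarrow> lrsim m n' u v"
  by (auto simp: lrsim_def intro: rsim_depth_mono)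

lemma lrsim_level: "lrsim (Suc m) n u v \<Longrightarrow> lrsim m n u v"
  by (auto simp: lrsim_def intro: rsim_level)

lemma lrsim_set: "lrsim m n u v \<Longrightarrow> 0 < m \<Longrightarrow> 0 < n \<Longrightarrow> set u = set v"
  by (metis gr0_implies_Suc lrsim_def rsim_set)

text \<open>No level is lost: forwards this is a plain jump, backwards it is
  \<open>rsim_rev_after_first\<close>.\<close>

lemma lrsim_after_first:
  assumes "lrsim (Suc m) (Suc n) (u0 @ a # u1) (v0 @ a # v1)" "a \<notin> set u0" "a \<notin> set v0"
  shows "lrsim (Suc m) n u1 v1"
  using assms rsim_first(2)[of m n u0 a u1 v0 v1] rsim_rev_after_first[of "Suc m" n u0 a u1 v0 v1]
  unfolding lrsim_def by blast

text \<open>One level is lost, in accordance with the turn charged to the left argument of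
  \<open>First\<close>.\<close>

lemma lrsim_before_first:
  assumes "lrsim (Suc m) (Suc n) (u0 @ a # u1) (v0 @ a # v1)" "a \<notin> set u0" "a \<notin> set v0"
  shows "lrsim m n u0 v0"
proof (cases m)
  case (Suc k)
  then have "rsim (Suc m) n u0 v0"
    using assms rsim_before_first[of "Suc m" n u0 a u1 v0 v1] by (simp add: lrsim_def)
  then show ?thesis using assms rsim_first(1)[of m n u0 a u1 v0 v1] rsim_level[of m n u0 v0]
    unfolding lrsim_def by blast
qed (simp add: lrsim_def)

lemma lrsim_before_last:
  assumes "lrsim (Suc m) (Suc n) (u0 @ a # u1) (v0 @ a # v1)" "a \<notin> set u1" "a \<notin> set v1"
  shows "lrsim (Suc m) n u0 v0"
  using lrsim_after_first[of m n "rev u1" a "rev u0" "rev v1" "rev v0"] assms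
    lrsim_rev[of "Suc m" "Suc n" "u0 @ a # u1" "v0 @ a # v1"] by simp

lemma lrsim_after_last:
  assumes "lrsim (Suc m) (Suc n) (u0 @ a # u1) (v0 @ a # v1)" "a \<notin> set u1" "a \<notin> set v1"
  shows "lrsim m n u1 v1"
  using lrsim_before_first[of m n "rev u1" a "rev u0" "rev v1" "rev v0"] assms
    lrsim_rev[of "Suc m" "Suc n" "u0 @ a # u1" "v0 @ a # v1"] by simp

text \<open>The segment lies between a last \<open>b\<close> and a first \<open>a\<close>. Turning
  at one marker costs a level; after that, the other marker is a first occurrence in the reading
  direction, and by \<open>rsim_before_first\<close> the part before it is reached without a second
  loss. This is done once from each side, giving the two halves of \<open>lrsim\<close>.\<close>

lemma lrsim_between:
  assumes m: "2 \<le> m"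
    and sim: "lrsim (Suc m) (Suc (Suc n)) (u0 @ b # s @ a # u1) (v0 @ b # t @ a # v1)"
    and a: "a \<notin> set u0" "a \<notin> set s" "a \<notin> set v0" "a \<notin> set t" "a \<noteq> b"
    and b: "b \<notin> set u1" "b \<notin> set s" "b \<notin> set v1" "b \<notin> set t"
  shows "lrsim m n s t"
proof -
  have "rsim (Suc m) (Suc (Suc n)) ((u0 @ b # s) @ a # u1) ((v0 @ b # t) @ a # v1)"
    using sim by (simp add: lrsim_def)
  from rsim_first(1)[OF this] a
  have "rsim m (Suc n) (rev s @ b # rev u0) (rev t @ b # rev v0)" by simp
  from rsim_before_first[OF m this] b have 1: "rsim m n (rev s) (rev t)" by simp
  have "rsim (Suc m) (Suc (Suc n)) ((rev u1 @ a # rev s) @ b # rev u0) ((rev v1 @ a # rev t) @ b # rev v0)"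
    using sim by (simp add: lrsim_def)
  from rsim_first(1)[OF this] a b
  have "rsim m (Suc n) (s @ a # u1) (t @ a # v1)" by simp
  from rsim_before_first[OF m this] a have 2: "rsim m n s t" by simp
  show ?thesis using 1 2 by (simp add: lrsim_def)
qed

section \<open>Pairs of words and congruences in DA\<close>

definition wpow :: "'a list \<Rightarrow> nat \<Rightarrow> 'a list" where
  "wpow w k = concat (replicate k w)"

lemma wpow_simps [simp]: "wpow w 0 = []" "wpow w (Suc k) = w @ wpow w k"
  by (simp_all add: wpow_def)

lemma wpow_add: "wpow w (i + j) = wpow w i @ wpow w j"
  by (simp add: wpow_def replicate_add)

lemma wpow_Suc_right: "wpow w (Suc k) = wpow w k @ w"
  using wpow_add[of w k 1] by simp

lemma rev_wpow: "rev (wpow w k) = wpow (rev w) k"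
  by (induction k) (simp_all flip: wpow_Suc_right)

lemma set_wpow: "set (wpow w k) = (if k = 0 then {} else set w)"
  by (induction k) auto

text \<open>
  The instances of the identity \<open>U\<^sub>k\<^sub>+\<^sub>1 = V\<^sub>k\<^sub>+\<^sub>1\<close>, with an exponent \<open>K\<close> in place of \<open>\<omega>\<close>.
\<close>

fun tw_pairs :: "nat \<Rightarrow> nat \<Rightarrow> ('a list \<times> 'a list) set" where
  "tw_pairs K 0 = {(s, []) | s. True}"
| "tw_pairs K (Suc k) =
    {(z @ wpow (s @ p) K @ s @ wpow (q @ s) K @ z', z @ wpow (s @ p) K @ t @ wpow (q @ s) K @ z') |
      z z' p q s t. (s, t) \<in> tw_pairs K k}"

lemma tw_pairs_SucI:
  "(s, t) \<in> tw_pairs K k \<Longrightarrow>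
    (z @ wpow (s @ p) K @ s @ wpow (q @ s) K @ z', z @ wpow (s @ p) K @ t @ wpow (q @ s) K @ z')
      \<in> tw_pairs K (Suc k)"
  unfolding tw_pairs.simps mem_Collect_eq by blast

declare tw_pairs.simps(2) [simp del]

lemma tw_pairs_SucE:
  assumes "(u, v) \<in> tw_pairs K (Suc k)"
  obtains z z' p q s t where "(s, t) \<in> tw_pairs K k"
    "u = z @ wpow (s @ p) K @ s @ wpow (q @ s) K @ z'"
    "v = z @ wpow (s @ p) K @ t @ wpow (q @ s) K @ z'"
  using assms unfolding tw_pairs.simps by blast

text \<open>The outer words \<open>z\<close> and \<open>z'\<close> of the recursion are there for
  this: the pairs generate a congruence by chains alone, without closing them under
  contexts.\<close>

lemma tw_pairs_append:
  assumes "(u, v) \<in> tw_pairs K (Suc k)"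
  shows "(x @ u @ y, x @ v @ y) \<in> tw_pairs K (Suc k)"
proof -
  obtain z z' p q s t where st: "(s, t) \<in> tw_pairs K k"
    "u = z @ wpow (s @ p) K @ s @ wpow (q @ s) K @ z'"
    "v = z @ wpow (s @ p) K @ t @ wpow (q @ s) K @ z'"
    using assms by (rule tw_pairs_SucE)
  then show ?thesis using tw_pairs_SucI[OF st(1), of "x @ z" p q "z' @ y"] by simp
qed

text \<open>For positive \<open>K\<close> the power of \<open>s @ p\<close> already contains all
  letters of \<open>s\<close>, so even erasing the middle \<open>s\<close> loses none. Consequently
  both components are absorbed by the same idempotents.\<close>

lemma tw_pairs_set:
  assumes "0 < K"
  shows "(u, v) \<in> tw_pairs K (Suc k) \<Longrightarrow> set u = set v"
proof (induction k arbitrary: u v)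
  case 0
  then show ?case using assms by (auto simp: tw_pairs.simps(2) set_wpow)
next
  case (Suc k)
  obtain z z' p q s t where st: "(s, t) \<in> tw_pairs K (Suc k)"
    "u = z @ wpow (s @ p) K @ s @ wpow (q @ s) K @ z'"
    "v = z @ wpow (s @ p) K @ t @ wpow (q @ s) K @ z'"
    using Suc.prems by (rule tw_pairs_SucE)
  then show ?case using Suc.IH[OF st(1)] by simp
qed

lemma tw_pairs_hom:
  assumes app: "\<And>u v. g (u @ v) = g u @ g v" and nil: "g [] = []"
  shows "(u, v) \<in> tw_pairs K k \<Longrightarrow> (g u, g v) \<in> tw_pairs K k"
proof (induction k arbitrary: u v)
  case 0 then show ?case using nil by auto
next
  case (Suc k)
  have pow: "g (wpow w j) = wpow (g w) j" for w j by (induction j) (simp_all add: app nil)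
  obtain z z' p q s t where st: "(s, t) \<in> tw_pairs K k"
    "u = z @ wpow (s @ p) K @ s @ wpow (q @ s) K @ z'"
    "v = z @ wpow (s @ p) K @ t @ wpow (q @ s) K @ z'"
    using Suc.prems by (rule tw_pairs_SucE)
  then show ?case using tw_pairs_SucI[OF Suc.IH[OF st(1)], of "g z" "g p" "g q" "g z'"]
    by (simp only: app pow)
qed

lemma tw_pairs_rev: "(u, v) \<in> tw_pairs K k \<Longrightarrow> (rev u, rev v) \<in> tw_pairs K k"
proof (induction k arbitrary: u v)
  case (Suc k)
  obtain z z' p q s t where st: "(s, t) \<in> tw_pairs K k"
    "u = z @ wpow (s @ p) K @ s @ wpow (q @ s) K @ z'"
    "v = z @ wpow (s @ p) K @ t @ wpow (q @ s) K @ z'"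
    using Suc.prems by (rule tw_pairs_SucE)
  then show ?case
    using tw_pairs_SucI[OF Suc.IH[OF st(1)], of "rev z'" "rev q" "rev p" "rev z"]
    by (simp add: rev_wpow)
qed auto

text \<open>The axiom \<open>da\<close> is the identity \<open>(xyz)\<^sup>\<omega> y
  (xyz)\<^sup>\<omega> = (xyz)\<^sup>\<omega>\<close> defining DA, with \<open>K\<close> for
  \<omega>; \<open>exponent\<close> says that \<open>K\<close>-th powers are idempotent in the
  quotient.\<close>

locale da_congruence =
  fixes \<theta> :: "'a list \<Rightarrow> 'a list \<Rightarrow> bool" and K :: nat
  assumes refl [simp, intro]: "\<theta> u u"
    and sym: "\<theta> u v \<Longrightarrow> \<theta> v u"
    and trans [trans]: "\<theta> u v \<Longrightarrow> \<theta> v w \<Longrightarrow> \<theta> u w"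
    and cong: "\<theta> u v \<Longrightarrow> \<theta> (x @ u @ y) (x @ v @ y)"
    and exponent_pos: "0 < K"
    and exponent: "\<theta> (wpow w K @ wpow w K) (wpow w K)"
    and da: "\<theta> (wpow (x @ y @ z) K @ y @ wpow (x @ y @ z) K) (wpow (x @ y @ z) K)"
begin

lemma da_congruence_rev: "da_congruence (\<lambda>u v. \<theta> (rev u) (rev v)) K"
proof
  fix u v x y :: "'a list" assume "\<theta> (rev u) (rev v)"
  then show "\<theta> (rev (x @ u @ y)) (rev (x @ v @ y))"
    using cong[of "rev u" "rev v" "rev y" "rev x"] by simp
next
  fix w :: "'a list"
  show "\<theta> (rev (wpow w K @ wpow w K)) (rev (wpow w K))"
    using exponent[of "rev w"] by (simp add: rev_wpow)
next
  fix x y z :: "'a list"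
  show "\<theta> (rev (wpow (x @ y @ z) K @ y @ wpow (x @ y @ z) K)) (rev (wpow (x @ y @ z) K))"
    using da[of "rev z" "rev y" "rev x"] by (simp add: rev_wpow)
qed (auto intro: sym trans exponent_pos)

lemma append_cong: "\<theta> u v \<Longrightarrow> \<theta> u' v' \<Longrightarrow> \<theta> (u @ u') (v @ v')"
  using cong[of u v "[]" u'] cong[of u' v' v "[]"] by (auto intro: trans)

lemma wpow_cong: "\<theta> u v \<Longrightarrow> \<theta> (wpow u k) (wpow v k)"
  by (induction k) (auto intro: append_cong)

lemma wpow_idem: "\<theta> (e @ e) e \<Longrightarrow> 0 < k \<Longrightarrow> \<theta> (wpow e k) e"
proof (induction k)
  case (Suc k)
  show ?case
  proof (cases k)
    case (Suc j)
    then have "\<theta> (wpow e k) e" using Suc.IH Suc.prems by simp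
    then have "\<theta> (e @ wpow e k) (e @ e)" by (intro append_cong) auto
    then show ?thesis using Suc.prems by (auto intro: trans)
  qed simp
qed simp

text \<open>For an idempotent \<open>e\<close> of a quotient in DA this means that \<open>e\<close>
  lies in the two-sided ideal generated by \<open>c\<close>; \<open>absorbsI\<close> is the
  direction that uses DA.\<close>

definition absorbs :: "'a list \<Rightarrow> 'a list \<Rightarrow> bool" where
  "absorbs e c \<longleftrightarrow> \<theta> (e @ c @ e) e"

text \<open>Since \<open>e\<close> is idempotent, \<open>(p c q)\<^sup>K\<close> is again
  \<open>e\<close>, and the DA identity with middle factor \<open>c\<close> is the claim.\<close>

lemma absorbsI:
  assumes "\<theta> (e @ e) e" "\<theta> (p @ c @ q) e"
  shows "absorbs e c"
proof -
  let ?X = "wpow (p @ c @ q) K"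
  have X: "\<theta> ?X e"
    using wpow_cong[OF assms(2), of K] wpow_idem[OF assms(1) exponent_pos] by (rule trans)
  then have "\<theta> (?X @ c @ ?X) (e @ c @ e)" by (intro append_cong) auto
  then show ?thesis unfolding absorbs_def using da[of p c q] X by (blast intro: trans sym)
qed

lemma absorbs_append:
  assumes e: "\<theta> (e @ e) e"
  shows "absorbs e (c @ d) \<longleftrightarrow> absorbs e c \<and> absorbs e d"
proof
  assume "absorbs e (c @ d)"
  then have "\<theta> (e @ c @ d @ e) e" by (simp add: absorbs_def)
  then show "absorbs e c \<and> absorbs e d"
    using absorbsI[OF e, of e c "d @ e"] absorbsI[OF e, of "e @ c" d e] by simp
next
  assume "absorbs e c \<and> absorbs e d"
  then have c: "\<theta> (e @ c @ e) e" and d: "\<theta> (e @ d @ e) e" by (simp_all add: absorbs_def)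
  have k: "\<theta> ((e @ c) @ (e @ c)) (e @ c)"
    using cong[OF c, of "[]" c] by simp
  have kd: "\<theta> ((e @ d) @ e @ c) (e @ c)" using cong[OF d, of "[]" c] by simp
  \<comment> \<open>The product of \<open>e\<close>, \<open>d\<close> and \<open>e @ c\<close>
    equals the idempotent \<open>e @ c\<close>, so \<open>absorbsI\<close> applies to
    \<open>e @ c\<close> instead of \<open>e\<close>. Multiplying by \<open>e\<close> on the right
    then leads back to \<open>e\<close>.\<close>
  have "absorbs (e @ c) d" by (rule absorbsI[OF k, of e d "e @ c"]) (use kd in simp)
  then have "\<theta> (e @ c @ d @ e @ c) (e @ c)" by (simp add: absorbs_def)
  from cong[OF this, of "[]" e]
  have "\<theta> (e @ c @ d @ e @ c @ e) (e @ c @ e)" by simp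
  moreover have "\<theta> (e @ c @ d @ e @ c @ e) (e @ c @ d @ e)"
    using cong[OF c, of "e @ c @ d" "[]"] by simp
  ultimately show "absorbs e (c @ d)" unfolding absorbs_def using c
    by (auto intro: trans sym)
qed

text \<open>Absorption is thus a property of the alphabet of a word. The link between Green's
  relations and first or last occurrences rests on this.\<close>

lemma absorbs_iff_letters:
  assumes "\<theta> (e @ e) e"
  shows "absorbs e w \<longleftrightarrow> (\<forall>a\<in>set w. absorbs e [a])"
proof (induction w)
  case Nil then show ?case using assms by (simp add: absorbs_def)
next
  case (Cons a w) then show ?case using absorbs_append[OF assms, of "[a]" w] by simp
qed

lemma absorbs_subset:
  "\<theta> (e @ e) e \<Longrightarrow> absorbs e u \<Longrightarrow> set w \<subseteq> set u \<Longrightarrow> absorbs e w"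
  using absorbs_iff_letters[of e u] absorbs_iff_letters[of e w] by auto

text \<open>In the quotient: the R-class of \<open>x\<close> is not left when \<open>u\<close> is
  appended. \<open>costable\<close> is the dual for L-classes.\<close>

definition stable :: "'a list \<Rightarrow> 'a list \<Rightarrow> bool" where
  "stable x u \<longleftrightarrow> (\<exists>p. \<theta> (x @ u @ p) x)"

definition costable :: "'a list \<Rightarrow> 'a list \<Rightarrow> bool" where
  "costable y u \<longleftrightarrow> (\<exists>q. \<theta> (q @ u @ y) y)"

text \<open>If \<open>u p\<close> returns to \<open>x\<close>, then its \<open>K\<close>-th power is
  an idempotent fixing \<open>x\<close> on the right, and it has \<open>u\<close> as a factor, hence
  absorbs it.\<close>

lemma stable_idempotent:
  assumes "stable x u"
  obtains e where "\<theta> (e @ e) e" "\<theta> (x @ e) x" "absorbs e u"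
proof -
  from assms obtain p where p: "\<theta> (x @ u @ p) x" by (auto simp: stable_def)
  have 1: "\<theta> (x @ wpow (u @ p) j) x" for j
  proof (induction j)
    case (Suc j)
    have "\<theta> ((x @ u @ p) @ wpow (u @ p) j) (x @ wpow (u @ p) j)"
      using p by (intro append_cong) auto
    then show ?case using Suc by (auto intro: trans)
  qed simp
  obtain K' where "K = Suc K'" using exponent_pos gr0_implies_Suc by blast
  then have "absorbs (wpow (u @ p) K) u"
    using absorbsI[OF exponent[of "u @ p"], of "[]" u "p @ wpow (u @ p) K'"] by simp
  with 1[of K] exponent that show ?thesis by blast
qed

text \<open>Staying in an R-class depends only on the letters read: insert the absorbing idempotent
  after \<open>x\<close> and let it swallow \<open>w\<close>.\<close>

lemma stable_subset:
  assumes "stable x u" "set w \<subseteq> set u"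
  shows "stable x w"
proof -
  obtain e where e: "\<theta> (e @ e) e" "\<theta> (x @ e) x" "absorbs e u" using stable_idempotent[OF assms(1)] .
  from absorbs_subset[OF e(1,3) assms(2)] have "\<theta> (e @ w @ e) e" by (simp add: absorbs_def)
  then have "\<theta> (x @ e @ w @ e) (x @ e)" by (intro append_cong) auto
  moreover have "\<theta> ((x @ e) @ w @ e) (x @ w @ e)" using e(2) by (intro append_cong) auto
  ultimately have "\<theta> (x @ w @ e) x" using e(2) by (auto intro: trans sym)
  then show ?thesis by (auto simp: stable_def)
qed

lemma stable_extend:
  assumes "stable x u" "set w \<subseteq> set u"
  shows "stable (x @ w) u"
proof -
  have "stable x (w @ u)" using assms by (intro stable_subset[OF assms(1)]) auto
  then obtain p where "\<theta> (x @ w @ u @ p) x" by (auto simp: stable_def)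
  from cong[OF this, of "[]" w] have "\<theta> ((x @ w) @ u @ (p @ w)) (x @ w)" by simp
  then show ?thesis unfolding stable_def by blast
qed

lemma costable_rev: "costable y u \<longleftrightarrow> da_congruence.stable (\<lambda>u v. \<theta> (rev u) (rev v)) (rev y) (rev u)"
proof -
  interpret R: da_congruence "\<lambda>u v. \<theta> (rev u) (rev v)" K by (rule da_congruence_rev)
  show ?thesis unfolding costable_def R.stable_def
    by (auto simp: rev_append intro: exI[of _ "rev q" for q])
qed

lemma costable_idempotent:
  assumes "costable y u"
  obtains f where "\<theta> (f @ f) f" "\<theta> (f @ y) y" "absorbs f u"
proof -
  interpret R: da_congruence "\<lambda>u v. \<theta> (rev u) (rev v)" K by (rule da_congruence_rev)
  obtain e where "\<theta> (rev (e @ e)) (rev e)" "\<theta> (rev (rev y @ e)) (rev (rev y))" "R.absorbs e (rev u)"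
    using R.stable_idempotent assms costable_rev by blast
  then show ?thesis by (intro that[of "rev e"]) (auto simp: R.absorbs_def absorbs_def)
qed

lemma costable_subset: "costable y u \<Longrightarrow> set w \<subseteq> set u \<Longrightarrow> costable y w"
proof -
  interpret R: da_congruence "\<lambda>u v. \<theta> (rev u) (rev v)" K by (rule da_congruence_rev)
  show "costable y u \<Longrightarrow> set w \<subseteq> set u \<Longrightarrow> costable y w"
    unfolding costable_rev using R.stable_subset[of "rev y" "rev u" "rev w"] by simp
qed

lemma costable_extend: "costable y u \<Longrightarrow> set w \<subseteq> set u \<Longrightarrow> costable (w @ y) u"
proof -
  interpret R: da_congruence "\<lambda>u v. \<theta> (rev u) (rev v)" K by (rule da_congruence_rev)
  show "costable y u \<Longrightarrow> set w \<subseteq> set u \<Longrightarrow> costable (w @ y) u"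
    unfolding costable_rev using R.stable_extend[of "rev y" "rev u" "rev w"] by simp
qed

text \<open>The size of the right ideal generated by the class of \<open>x\<close>. It shrinks at
  every drop of the R-class and serves, together with its dual, as induction measure.\<close>

definition right_rank :: "'a list \<Rightarrow> nat" where
  "right_rank x = card (range (\<lambda>w. Collect (\<theta> (x @ w))))"

definition left_rank :: "'a list \<Rightarrow> nat" where
  "left_rank y = card (range (\<lambda>w. Collect (\<theta> (w @ y))))"

lemma class_eq: "Collect (\<theta> u) = Collect (\<theta> v) \<longleftrightarrow> \<theta> u v"
  by (auto intro: sym trans)

text \<open>The class of \<open>x\<close> itself can no longer be reached from
  \<open>x @ u\<close>.\<close>

lemma right_rank_less:
  assumes fin: "finite (range (\<lambda>w. Collect (\<theta> w)))" and "\<not> stable x u"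
  shows "right_rank (x @ u) < right_rank x"
  unfolding right_rank_def
proof (rule psubset_card_mono)
  show "finite (range (\<lambda>w. Collect (\<theta> (x @ w))))"
    by (rule finite_subset[OF _ fin]) auto
  have "Collect (\<theta> x) \<notin> range (\<lambda>w. Collect (\<theta> ((x @ u) @ w)))"
    using assms(2) by (auto simp only: class_eq stable_def append_assoc image_iff intro: sym)
  moreover have "Collect (\<theta> x) \<in> range (\<lambda>w. Collect (\<theta> (x @ w)))"
    by (rule image_eqI[of _ _ "[]"]) auto
  moreover have "range (\<lambda>w. Collect (\<theta> ((x @ u) @ w))) \<subseteq> range (\<lambda>w. Collect (\<theta> (x @ w)))" by auto
  ultimately show "range (\<lambda>w. Collect (\<theta> ((x @ u) @ w))) \<subset> range (\<lambda>w. Collect (\<theta> (x @ w)))" by blast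
qed

lemma left_rank_less:
  assumes fin: "finite (range (\<lambda>w. Collect (\<theta> w)))" and "\<not> costable y u"
  shows "left_rank (u @ y) < left_rank y"
  unfolding left_rank_def
proof (rule psubset_card_mono)
  show "finite (range (\<lambda>w. Collect (\<theta> (w @ y))))"
    by (rule finite_subset[OF _ fin]) auto
  have "Collect (\<theta> y) \<notin> range (\<lambda>w. Collect (\<theta> (w @ u @ y)))"
    using assms(2) by (auto simp only: class_eq costable_def image_iff intro: sym)
  moreover have "Collect (\<theta> y) \<in> range (\<lambda>w. Collect (\<theta> (w @ y)))"
    by (rule image_eqI[of _ _ "[]"]) auto
  moreover have "range (\<lambda>w. Collect (\<theta> (w @ u @ y))) \<subseteq> range (\<lambda>w. Collect (\<theta> (w @ y)))"
    by (auto simp flip: append_assoc)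
  ultimately show "range (\<lambda>w. Collect (\<theta> (w @ u @ y))) \<subset> range (\<lambda>w. Collect (\<theta> (w @ y)))" by blast
qed

text \<open>The dropping letter is new: if it occurred in \<open>u0\<close>,
  \<open>stable_subset\<close> would keep the class from dropping. A drop is therefore found by a
  jump to a first occurrence.\<close>

lemma first_descent:
  assumes "\<not> stable x u"
  obtains u0 a u1 where "u = u0 @ a # u1" "stable x u0" "\<not> stable x (u0 @ [a])" "a \<notin> set u0"
proof -
  have "\<exists>u0 a u1. u = u0 @ a # u1 \<and> stable x u0 \<and> \<not> stable x (u0 @ [a])"
    using assms
  proof (induction u rule: rev_induct)
    case Nil
    have "stable x []" unfolding stable_def by (rule exI[of _ "[]"]) simp
    then show ?case using Nil by simp
  next
    case (snoc b u)
    then show ?case by (cases "stable x u") force+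
  qed
  then obtain u0 a u1 where u: "u = u0 @ a # u1" "stable x u0" "\<not> stable x (u0 @ [a])" by blast
  then have "a \<notin> set u0" using stable_subset[of x u0 "u0 @ [a]"] by auto
  with u that show ?thesis by blast
qed

lemma last_descent:
  assumes "\<not> costable y v"
  obtains v0 b v1 where "v = v0 @ b # v1" "costable y v1" "\<not> costable y (b # v1)" "b \<notin> set v1"
proof -
  have "\<exists>v0 b v1. v = v0 @ b # v1 \<and> costable y v1 \<and> \<not> costable y (b # v1)"
    using assms
  proof (induction v)
    case Nil
    have "costable y []" unfolding costable_def by (rule exI[of _ "[]"]) simp
    then show ?case using Nil by simp
  next
    case (Cons b v)
    then show ?case by (cases "costable y v") (metis append_Nil, metis append_Cons)
  qed
  then obtain v0 b v1 where v: "v = v0 @ b # v1" "costable y v1" "\<not> costable y (b # v1)" by blast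
  then have "b \<notin> set v1" using costable_subset[of y v1 "b # v1"] by auto
  with v that show ?thesis by blast
qed

end

lemma two_splits_cases:
  assumes "v0 @ a # v1 = w0 @ b # w1"
  obtains (same) "w0 = v0" "b = a" "w1 = v1"
    | (after) c where "w0 = v0 @ a # c" "v1 = c @ b # w1"
    | (before) t where "v0 = w0 @ b # t" "w1 = t @ a # v1"
proof -
  from assms consider us where "v0 = w0 @ us" "us @ a # v1 = b # w1"
    | us where "w0 = v0 @ us" "a # v1 = us @ b # w1"
    by (auto simp: append_eq_append_conv2)
  then show ?thesis
  proof cases
    case 1 then show ?thesis using same before by (cases us) auto
  next
    case 2 then show ?thesis using same after by (cases us) auto
  qed
qed

context da_congruence
begin

text \<open>
  Reading \<open>u\<close> from the left, a letter is marked whenever the \<open>\<R>\<close>-class of the prefix drops; reading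
  \<open>v\<close> from the right, whenever the \<open>\<L>\<close>-class of the suffix drops. Marked letters are
  reached by first-occurrence and last-occurrence jumps, so \<open>lrsim\<close> transfers them between the
  words; the segments between markers are exchanged one at a time from right to left.
\<close>

lemma markers:
  assumes m: "0 < m" and fin: "finite (range (\<lambda>w. Collect (\<theta> w)))"
    and exchange: "\<And>s t e f. \<theta> (e @ e) e \<Longrightarrow> \<theta> (f @ f) f \<Longrightarrow> absorbs e s \<Longrightarrow> absorbs e t \<Longrightarrow>
      absorbs f s \<Longrightarrow> absorbs f t \<Longrightarrow> (2 \<le> m \<Longrightarrow> lrsim m n0 s t) \<Longrightarrow> \<theta> (e @ s @ f) (e @ t @ f)"
  shows "\<exists>n. \<forall>u v. lrsim (Suc m) n u v \<longrightarrow> \<theta> u v"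
proof -
  \<comment> \<open>An idempotent absorbing the segments can be inserted on either side: after
    \<open>x\<close> because the R-class does not drop along \<open>s'\<close>, before
    \<open>y\<close> because the L-class does not drop along \<open>t'\<close>.\<close>
  have segment: "\<theta> (x @ s @ y) (x @ t @ y)"
    if st: "stable x s'" and co: "costable y t'"
      and sets: "set s \<union> set t \<subseteq> set s'" "set s \<union> set t \<subseteq> set t'"
      and sim: "2 \<le> m \<Longrightarrow> lrsim m n0 s t" for x y s t s' t'
  proof -
    obtain e where e: "\<theta> (e @ e) e" "\<theta> (x @ e) x" "absorbs e s'"
      using stable_idempotent[OF st] .
    obtain f where f: "\<theta> (f @ f) f" "\<theta> (f @ y) y" "absorbs f t'"
      using costable_idempotent[OF co] .
    have "\<theta> (e @ s @ f) (e @ t @ f)"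
      using sets sim e(1) f(1)
      by (intro exchange) (auto intro: absorbs_subset[OF e(1,3)] absorbs_subset[OF f(1,3)])
    from cong[OF this, of x y] have 1: "\<theta> (x @ e @ s @ f @ y) (x @ e @ t @ f @ y)" by simp
    have 2: "\<theta> (x @ e @ w @ f @ y) (x @ w @ y)" for w
      using append_cong[OF e(2) append_cong[OF refl[of w] f(2)]] by simp
    show ?thesis using 1 2[of s] 2[of t] by (blast intro: trans sym)
  qed
  \<comment> \<open>In the second statement everything right of the marker \<open>a\<close> has
    already been rewritten to \<open>v1\<close>, and \<open>u1\<close> serves only to justify jumps.
    Each drop lowers the sum of the ranks and costs one jump; the additional 2 covers the two jumps
    of \<open>lrsim_between\<close>.\<close>
  have "(\<forall>x y u v. right_rank x + left_rank y \<le> d \<longrightarrow> lrsim (Suc m) (n0 + 2 + d) u v \<longrightarrow>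
           \<theta> (x @ u @ y) (x @ v @ y)) \<and>
        (\<forall>x y u0 a u1 v0 v1. right_rank x + left_rank y \<le> d \<longrightarrow>
           lrsim (Suc m) (n0 + 2 + d) (u0 @ a # u1) (v0 @ a # v1) \<longrightarrow> a \<notin> set u0 \<longrightarrow> a \<notin> set v0 \<longrightarrow>
           stable x u0 \<longrightarrow> \<theta> (x @ u0 @ a # v1 @ y) (x @ v0 @ a # v1 @ y))" for d
  proof (induction d)
    case 0
    \<comment> \<open>Ranks are positive, so the case \<open>d = 0\<close> is vacuous.\<close>
    have "0 < right_rank x" for x
      unfolding right_rank_def card_gt_0_iff by (auto intro: finite_subset[OF _ fin])
    then show ?case by (metis add_is_0 le_zero_eq less_numeral_extra(3))
  next
    case (Suc d)
    define N where "N = n0 + 2 + d"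
    have N: "Suc N = n0 + 2 + Suc d" "0 < N" "n0 \<le> N" "Suc n0 \<le> N" by (simp_all add: N_def)
    have IH1: "\<theta> (x @ u @ y) (x @ v @ y)"
      if "right_rank x + left_rank y \<le> d" "lrsim (Suc m) N u v" for x y u v
      using Suc.IH that unfolding N_def by blast
    have IH2: "\<theta> (x @ u0 @ a # v1 @ y) (x @ v0 @ a # v1 @ y)"
      if "right_rank x + left_rank y \<le> d" "lrsim (Suc m) N (u0 @ a # u1) (v0 @ a # v1)"
        "a \<notin> set u0" "a \<notin> set v0" "stable x u0" for x y u0 a u1 v0 v1
      using Suc.IH that unfolding N_def by blast
    have II: "\<theta> (x @ u0 @ a # v1 @ y) (x @ v0 @ a # v1 @ y)"
      if d: "right_rank x + left_rank y \<le> Suc d"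
        and sim: "lrsim (Suc m) (Suc N) (u0 @ a # u1) (v0 @ a # v1)"
        and a: "a \<notin> set u0" "a \<notin> set v0" and st: "stable x u0" for x y u0 a u1 v0 v1
    proof -
      have sim0: "lrsim m N u0 v0" by (rule lrsim_before_first[OF sim a])
      have set0: "set u0 = set v0" by (rule lrsim_set[OF sim0 m N(2)])
      have set1: "set u1 = set v1"
        by (rule lrsim_set[OF lrsim_after_first[OF sim a] zero_less_Suc N(2)])
      show ?thesis
      proof (cases "costable y (v0 @ a # v1)")
        case True
        then obtain q where "\<theta> (q @ (v0 @ a # v1) @ y) y" by (auto simp: costable_def)
        from cong[OF this, of "a # v1" "[]"]
        have "\<theta> ((a # v1 @ q) @ v0 @ (a # v1 @ y)) (a # v1 @ y)" by simp
        then have "costable (a # v1 @ y) v0" unfolding costable_def by blast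
        from segment[OF st this, of u0 v0] set0 lrsim_depth_mono[OF sim0 N(3)]
        show ?thesis by simp
      next
        case False
        then obtain w0 b w1 where w: "v0 @ a # v1 = w0 @ b # w1" "costable y w1"
          "\<not> costable y (b # w1)" "b \<notin> set w1" using last_descent by metis
        have rank: "right_rank x + left_rank (b # w1 @ y) \<le> d"
          using left_rank_less[OF fin w(3)] d by simp
        from w(1) show ?thesis
        proof (cases rule: two_splits_cases)
          \<comment> \<open>Both markers are the same letter, which is then the first and the last
            \<open>a\<close>; the jump to the last occurrence keeps the level for the part before
            it.\<close>
          case same
          then have "a \<notin> set v1" "a \<notin> set u1" using w(4) set1 by auto
          then have "lrsim (Suc m) N u0 v0" using lrsim_before_last[OF sim] by simp
          then show ?thesis using IH1[of x "a # v1 @ y" u0 v0] rank same by simp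
        next
          \<comment> \<open>The last-occurrence marker lies to the right of \<open>a\<close>, in the
            common part \<open>v1\<close>. Cutting there keeps \<open>a\<close> as the pending
            marker and lowers the left rank.\<close>
          case (after c)
          then have "b \<in> set u1" using set1 by simp
          then obtain c' d' where u1: "u1 = c' @ b # d'" "b \<notin> set d'" by (meson split_list_last)
          have "lrsim (Suc m) (Suc N) ((u0 @ a # c') @ b # d') ((v0 @ a # c) @ b # w1)"
            using sim u1 after by simp
          from lrsim_before_last[OF this u1(2) w(4)]
          have "lrsim (Suc m) N (u0 @ a # c') (v0 @ a # c)" .
          from IH2[OF rank this a st] show ?thesis using after by simp
        next
          \<comment> \<open>The markers cross: \<open>b\<close> precedes \<open>a\<close> in both
            words. The segment between them is exchanged first, then the part before
            \<open>b\<close> by induction.\<close>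
          case (before t)
          then have "b \<in> set u0" using set0 by simp
          then obtain w0' s where u0: "u0 = w0' @ b # s" "b \<notin> set s" by (meson split_list_last)
          have b: "b \<notin> set v1" "b \<notin> set t" "a \<noteq> b" "b \<notin> set u1"
            using before w(4) a set1 by auto
          have sim': "lrsim (Suc m) (Suc N) (w0' @ b # (s @ a # u1)) (w0 @ b # (t @ a # v1))"
            using sim u0 before by simp
          have "lrsim m N (s @ a # u1) (t @ a # v1)"
            by (rule lrsim_after_last[OF sim']) (use u0 b in auto)
          then have sets: "set (s @ a # u1) = set w1" using lrsim_set m N(2) before by blast
          have left: "stable (x @ w0' @ [b]) u0" by (rule stable_extend[OF st]) (use u0 in auto)
          have right: "costable ((a # v1) @ y) w1"
            by (rule costable_extend[OF w(2)]) (use before in auto)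
          \<comment> \<open>For \<open>m = 1\<close> the two facing jumps leave no information about
            the segment, but then \<open>exchange\<close> requires none.\<close>
          have between: "lrsim m n0 s t" if "2 \<le> m"
          proof (rule lrsim_between[OF that])
            show "lrsim (Suc m) (Suc (Suc n0)) (w0' @ b # s @ a # u1) (w0 @ b # t @ a # v1)"
              using lrsim_depth_mono[OF sim', of "Suc (Suc n0)"] N(4) by simp
          qed (use u0 before a b in auto)
          have "\<theta> ((x @ w0' @ [b]) @ s @ (a # v1) @ y) ((x @ w0' @ [b]) @ t @ (a # v1) @ y)"
            by (rule segment[OF left right _ _ between]) (use u0 before set0 sets in auto)
          moreover have "lrsim (Suc m) N w0' w0"
            by (rule lrsim_before_last[OF sim']) (use u0 b in auto)
          then have "\<theta> (x @ w0' @ b # w1 @ y) (x @ w0 @ b # w1 @ y)"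
            by (rule IH1[OF rank])
          ultimately show ?thesis using u0 before by (auto intro: trans)
        qed
      qed
    qed
    have I: "\<theta> (x @ u @ y) (x @ v @ y)"
      if d: "right_rank x + left_rank y \<le> Suc d" and sim: "lrsim (Suc m) (Suc N) u v" for x y u v
    proof (cases "stable x u")
      case st: True
      have sets: "set u = set v" by (rule lrsim_set[OF sim]) auto
      show ?thesis
      proof (cases "costable y v")
        case True
        have "lrsim m n0 u v"
          using lrsim_depth_mono[OF lrsim_level[OF sim], of n0] N(3) by simp
        then show ?thesis using segment[OF st True, of u v] sets by simp
      next
        case False
        then obtain w0 b w1 where w: "v = w0 @ b # w1" "costable y w1"
          "\<not> costable y (b # w1)" "b \<notin> set w1" using last_descent by metis
        then have "b \<in> set u" using sets by simp
        then obtain u0 u1 where u: "u = u0 @ b # u1" "b \<notin> set u1" by (meson split_list_last)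
        have sim0: "lrsim (Suc m) N u0 w0" and sim1: "lrsim m N u1 w1"
          using lrsim_before_last[of m N u0 b u1 w0 w1] lrsim_after_last[of m N u0 b u1 w0 w1]
            sim u w by auto
        have sets1: "set u1 = set w1" by (rule lrsim_set[OF sim1 m N(2)])
        have "stable (x @ u0 @ [b]) u" by (rule stable_extend[OF st]) (use u in auto)
        then have "\<theta> ((x @ u0 @ [b]) @ u1 @ y) ((x @ u0 @ [b]) @ w1 @ y)"
          by (rule segment[OF _ w(2)]) (use u sets1 lrsim_depth_mono[OF sim1 N(3)] in auto)
        moreover have "right_rank x + left_rank (b # w1 @ y) \<le> d"
          using left_rank_less[OF fin w(3)] d by simp
        from IH1[OF this sim0] have "\<theta> (x @ u0 @ b # w1 @ y) (x @ w0 @ b # w1 @ y)" .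
        ultimately show ?thesis using u w by (auto intro: trans)
      qed
    next
      case False
      then obtain u0 a u1 where u: "u = u0 @ a # u1" "stable x u0" "\<not> stable x (u0 @ [a])" "a \<notin> set u0"
        using first_descent by metis
      have "a \<in> set v" using lrsim_set[OF sim] u by auto
      then obtain v0 v1 where v: "v = v0 @ a # v1" "a \<notin> set v0" by (meson split_list_first)
      note sim' = sim[unfolded u(1) v(1)]
      have "right_rank (x @ u0 @ [a]) + left_rank y \<le> d"
        using right_rank_less[OF fin u(3)] d by simp
      from IH1[OF this lrsim_after_first[OF sim' u(4) v(2)]]
      have "\<theta> (x @ u0 @ a # u1 @ y) (x @ u0 @ a # v1 @ y)" by simp
      moreover have "\<theta> (x @ u0 @ a # v1 @ y) (x @ v0 @ a # v1 @ y)"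
        by (rule II[OF d sim' u(4) v(2) u(2)])
      ultimately show ?thesis using u v by (auto intro: trans)
    qed
    show ?case using I II unfolding N(1) by blast
  qed
  from this[of "right_rank [] + left_rank []"]
  have "\<theta> u v" if "lrsim (Suc m) (n0 + 2 + (right_rank [] + left_rank [])) u v" for u v
    using that by (metis append_Nil append_Nil2 order_refl)
  then show ?thesis by blast
qed

text \<open>Take \<open>p = e\<close> and \<open>q = f\<close> in the identity. Since
  \<open>e\<close> and \<open>f\<close> absorb \<open>s\<close>, the powers collapse:
  \<open>e (s e)\<^sup>K\<close> is \<open>e\<close> and \<open>(f s)\<^sup>K f\<close> is
  \<open>f\<close>.\<close>

lemma pair_exchange:
  assumes pairs: "\<And>u v. (u, v) \<in> tw_pairs K (Suc k) \<Longrightarrow> \<theta> u v" and st: "(s, t) \<in> tw_pairs K k"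
    and e: "\<theta> (e @ e) e" "absorbs e s" and f: "\<theta> (f @ f) f" "absorbs f s"
  shows "\<theta> (e @ s @ f) (e @ t @ f)"
proof -
  have 1: "\<theta> (e @ wpow (s @ e) j) e" for j
  proof (induction j)
    case (Suc j)
    have "\<theta> ((e @ s @ e) @ wpow (s @ e) j) (e @ wpow (s @ e) j)"
      using e(2) by (intro append_cong) (auto simp: absorbs_def)
    then show ?case using Suc by (auto intro: trans)
  qed simp
  have 2: "\<theta> (wpow (f @ s) j @ f) f" for j
  proof (induction j)
    case (Suc j)
    have "\<theta> ((f @ s) @ (wpow (f @ s) j @ f)) ((f @ s) @ f)" using Suc by (intro append_cong) auto
    then show ?case using f(2) by (auto simp: absorbs_def intro: trans)
  qed simp
  have 3: "\<theta> ((e @ wpow (s @ e) K) @ w @ (wpow (f @ s) K @ f)) (e @ w @ f)" for w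
    by (intro append_cong 1 2) auto
  have "\<theta> (e @ wpow (s @ e) K @ s @ wpow (f @ s) K @ f) (e @ wpow (s @ e) K @ t @ wpow (f @ s) K @ f)"
    by (intro pairs tw_pairs_SucI st)
  then show ?thesis using 3[of s] 3[of t] by (auto intro: trans sym)
qed

end

text \<open>Enlarging the congruence by the pairs of the next lower index makes the induction
  hypothesis applicable. It yields a depth for segments that are only equal in the enlarged
  congruence, and \<open>pair_exchange\<close> turns such an equality into an exchange between
  idempotents, as \<open>markers\<close> demands.\<close>

theorem lrsim_refines:
  assumes "da_congruence \<theta> K" "finite (range (\<lambda>w. Collect (\<theta> w)))"
    and "\<And>u v. (u, v) \<in> tw_pairs K (Suc k) \<Longrightarrow> \<theta> u v"
  shows "\<exists>n. \<forall>u v. lrsim (Suc (Suc k)) n u v \<longrightarrow> \<theta> u v"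
  using assms
proof (induction k arbitrary: \<theta>)
  case 0
  interpret da_congruence \<theta> K by fact
  \<comment> \<open>At index 0 the second component is empty, so any two absorbed words are
    exchanged by way of the empty word.\<close>
  have "\<theta> (e @ s @ f) (e @ f)" if "\<theta> (e @ e) e" "\<theta> (f @ f) f" "absorbs e s" "absorbs f s" for e f s
    using pair_exchange[of 0 s "[]" e f] 0(3) that by auto
  then have "\<theta> (e @ s @ f) (e @ t @ f)" if "\<theta> (e @ e) e" "\<theta> (f @ f) f" "absorbs e s" "absorbs e t"
    "absorbs f s" "absorbs f t" for e f s t
    using that by (blast intro: trans sym)
  then show ?case by (intro markers[of "Suc 0" 0] 0(2)) auto
next
  case (Suc k)
  interpret da_congruence \<theta> K by fact
  \<comment> \<open>\<open>S\<close> is symmetric and compatible with contexts, so its reflexive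
    transitive closure is the congruence generated by it. It has finite index because it contains
    \<theta>.\<close>
  define S where "S u v \<longleftrightarrow> \<theta> u v \<or> (u, v) \<in> tw_pairs K (Suc k) \<or> (v, u) \<in> tw_pairs K (Suc k)" for u v
  have S_sym: "S u v \<Longrightarrow> S v u" for u v by (auto simp: S_def intro: sym)
  have S_cong: "S u v \<Longrightarrow> S (x @ u @ y) (x @ v @ y)" for u v x y
    by (auto simp: S_def intro: cong tw_pairs_append)
  have ext: "\<theta> u v \<Longrightarrow> S\<^sup>*\<^sup>* u v" for u v by (auto simp: S_def)
  have cong': "da_congruence S\<^sup>*\<^sup>* K"
  proof
    show "S\<^sup>*\<^sup>* v u" if "S\<^sup>*\<^sup>* u v" for u v using that
      by (induction rule: rtranclp_induct) (auto intro: converse_rtranclp_into_rtranclp S_sym)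
    show "S\<^sup>*\<^sup>* (x @ u @ y) (x @ v @ y)" if "S\<^sup>*\<^sup>* u v" for u v x y using that
      by (induction rule: rtranclp_induct) (auto intro: rtranclp.rtrancl_into_rtrancl S_cong)
  qed (auto intro: ext exponent da exponent_pos)
  have cls: "Collect (S\<^sup>*\<^sup>* w) = (\<Union>x\<in>Collect (\<theta> w). Collect (S\<^sup>*\<^sup>* x))" for w
    by (auto intro: rtranclp_trans ext)
  have "range (\<lambda>w. Collect (S\<^sup>*\<^sup>* w)) \<subseteq>
      (\<lambda>C. \<Union>x\<in>C. Collect (S\<^sup>*\<^sup>* x)) ` range (\<lambda>w. Collect (\<theta> w))"
    by (rule image_subsetI, rule rev_image_eqI[OF rangeI], rule cls)
  then have fin: "finite (range (\<lambda>w. Collect (S\<^sup>*\<^sup>* w)))"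
    by (rule finite_subset) (intro finite_imageI Suc.prems(2))
  obtain n0 where n0: "lrsim (Suc (Suc k)) n0 u v \<Longrightarrow> S\<^sup>*\<^sup>* u v" for u v
    using Suc.IH[OF cong' fin] S_def by blast
  \<comment> \<open>Absorption has to be carried along the chain: a step by \<theta> preserves it
    trivially, a step by a pair because the letters stay the same.\<close>
  have chain: "absorbs e t \<and> absorbs f t \<and> \<theta> (e @ s @ f) (e @ t @ f)"
    if "S\<^sup>*\<^sup>* s t" "\<theta> (e @ e) e" "\<theta> (f @ f) f" "absorbs e s" "absorbs f s" for e f s t
    using that
  proof (induction rule: rtranclp_induct)
    case (step t t')
    then have IH: "absorbs e t" "absorbs f t" "\<theta> (e @ s @ f) (e @ t @ f)" by auto
    have "absorbs e t' \<and> absorbs f t' \<and> \<theta> (e @ t @ f) (e @ t' @ f)"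
    proof (cases "\<theta> t t'")
      case True
      then show ?thesis using IH unfolding absorbs_def by (meson cong sym trans)
    next
      case False
      then have pair: "(t, t') \<in> tw_pairs K (Suc k) \<or> (t', t) \<in> tw_pairs K (Suc k)"
        using step.hyps(2) by (simp add: S_def)
      then have "set t = set t'" using tw_pairs_set[OF exponent_pos] by blast
      then have abs: "absorbs e t'" "absorbs f t'"
        using IH absorbs_subset step.prems(1,2) by auto
      from pair have "\<theta> (e @ t @ f) (e @ t' @ f)"
        using pair_exchange[OF Suc.prems(3) _ step.prems(1) _ step.prems(2)] IH abs sym by blast
      with abs show ?thesis by simp
    qed
    then show ?case using IH(3) by (auto intro: trans)
  qed auto
  show ?case
    by (rule markers[of _ n0, OF _ Suc.prems(2)]) (use chain n0 in auto)
qed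

section \<open>Definability in interval temporal logic\<close>

lemma before_first_lists: "u \<in> lists A \<Longrightarrow> before_first a u \<in> lists A"
  by (auto simp: before_first_def dest: set_takeWhileD)

lemma after_first_lists: "u \<in> lists A \<Longrightarrow> after_first a u \<in> lists A"
  unfolding after_first_def in_lists_conv_set
  by (metis list.sel(2) list.set_sel(2) set_dropWhileD)

lemma rev_lists [simp]: "rev u \<in> lists A \<longleftrightarrow> u \<in> lists A"
  by (simp add: in_lists_conv_set)

text \<open>Finite index is expressed by an invariant with finitely many values. Its values are
  natural numbers so that the invariants of all parts can be packed into a new one.\<close>

lemma rsim_finite_index:
  fixes A :: "'a set"
  assumes A: "finite A"
  shows "\<exists>g :: 'a list \<Rightarrow> nat. finite (g ` lists A) \<and>
    (\<forall>u\<in>lists A. \<forall>v\<in>lists A. g u = g v \<longrightarrow> rsim m n u v)"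
proof (induction m arbitrary: n)
  case 0
  show ?case using finite_subset[of "(\<lambda>_. 0) ` lists A" "{0::nat}"] by (intro exI[of _ "\<lambda>_. 0"]) auto
next
  case (Suc m)
  note IHm = Suc.IH
  show ?case
  proof (induction n)
    case 0
    show ?case using finite_subset[of "(\<lambda>_. 0) ` lists A" "{0::nat}"] by (intro exI[of _ "\<lambda>_. 0"]) auto
  next
    case (Suc n)
    obtain g1 :: "'a list \<Rightarrow> nat" where g1: "finite (g1 ` lists A)"
      "\<forall>u\<in>lists A. \<forall>v\<in>lists A. g1 u = g1 v \<longrightarrow> rsim m (Suc n) u v"
      using IHm[of "Suc n"] by blast
    obtain g2 :: "'a list \<Rightarrow> nat" where g2: "finite (g2 ` lists A)"
      "\<forall>u\<in>lists A. \<forall>v\<in>lists A. g2 u = g2 v \<longrightarrow> rsim m n u v"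
      using IHm[of n] by blast
    obtain g3 :: "'a list \<Rightarrow> nat" where g3: "finite (g3 ` lists A)"
      "\<forall>u\<in>lists A. \<forall>v\<in>lists A. g3 u = g3 v \<longrightarrow> rsim (Suc m) n u v"
      using Suc.IH by blast
    obtain as where as: "set as = A" using finite_list[OF A] by blast
    \<comment> \<open>The value 0 marks a letter that does not occur; the successor keeps it apart
      from the codes of pairs.\<close>
    define k where "k a u = (if a \<in> set u then
      Suc (prod_encode (g2 (rev (before_first a u)), g3 (after_first a u))) else 0)" for a u
    define g where "g u = list_encode (g1 (rev u) # map (\<lambda>a. k a u) as)" for u
    define F where "F = g1 ` lists A \<union> {0} \<union>
      (\<lambda>p. Suc (prod_encode p)) ` (g2 ` lists A \<times> g3 ` lists A)"
    have "finite F" unfolding F_def using g1(1) g2(1) g3(1) by blast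
    then have "finite (list_encode ` {xs. set xs \<subseteq> F \<and> length xs = Suc (length as)})"
      by (intro finite_imageI finite_lists_length_eq)
    moreover have "g ` lists A \<subseteq> list_encode ` {xs. set xs \<subseteq> F \<and> length xs = Suc (length as)}"
    proof (rule image_subsetI)
      fix u assume u: "u \<in> lists A"
      have "k a u \<in> F" for a
        using before_first_lists[OF u, of a] after_first_lists[OF u, of a]
        unfolding k_def F_def by auto
      moreover have "g1 (rev u) \<in> F" using u by (auto simp: F_def)
      ultimately show "g u \<in> list_encode ` {xs. set xs \<subseteq> F \<and> length xs = Suc (length as)}"
        unfolding g_def by (intro imageI) auto
    qed
    ultimately have "finite (g ` lists A)" by (rule rev_finite_subset)
    moreover have "rsim (Suc m) (Suc n) u v"
      if u: "u \<in> lists A" and v: "v \<in> lists A" and eq: "g u = g v" for u v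
    proof -
      from eq have eq1: "g1 (rev u) = g1 (rev v)" and eqk: "\<And>a. a \<in> A \<Longrightarrow> k a u = k a v"
        unfolding g_def using as by (auto simp: list_encode_eq)
      have "a \<in> set u \<longleftrightarrow> a \<in> set v" for a
        using eqk[of a] u v by (cases "a \<in> A") (auto simp: k_def split: if_splits)
      then have sets: "set u = set v" by blast
      moreover have "rsim m n (rev (before_first a u)) (rev (before_first a v)) \<and>
        rsim (Suc m) n (after_first a u) (after_first a v)" if "a \<in> set u" for a
      proof -
        have "a \<in> A" "a \<in> set v" using that u sets by auto
        then have "g2 (rev (before_first a u)) = g2 (rev (before_first a v))"
          "g3 (after_first a u) = g3 (after_first a v)"
          using eqk[of a] that by (simp_all add: k_def prod_encode_eq)
        then show ?thesis
          using g2(2) g3(2) before_first_lists after_first_lists u v by (metis rev_lists)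
      qed
      moreover have "rsim m (Suc n) (rev u) (rev v)" using g1(2) eq1 u v by simp
      ultimately show ?thesis by (simp add: rsim.simps(3))
    qed
    ultimately show ?case by blast
  qed
qed

lemma lrsim_finite_index:
  fixes A :: "'a set"
  assumes A: "finite A"
  obtains g :: "'a list \<Rightarrow> nat" where "finite (g ` lists A)"
    "\<And>u v. u \<in> lists A \<Longrightarrow> v \<in> lists A \<Longrightarrow> g u = g v \<Longrightarrow> lrsim m n u v"
proof -
  obtain g :: "'a list \<Rightarrow> nat" where g: "finite (g ` lists A)"
    "\<And>u v. u \<in> lists A \<Longrightarrow> v \<in> lists A \<Longrightarrow> g u = g v \<Longrightarrow> rsim m n u v"
    using rsim_finite_index[OF A, of m n] by blast
  define g' where "g' u = prod_encode (g u, g (rev u))" for u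
  have "g' ` lists A \<subseteq> prod_encode ` (g ` lists A \<times> g ` lists A)"
    by (auto simp: g'_def intro!: imageI)
  then have "finite (g' ` lists A)" by (rule finite_subset) (use g(1) in blast)
  moreover have "lrsim m n u v" if "u \<in> lists A" "v \<in> lists A" "g' u = g' v" for u v
    using that g(2) by (auto simp: g'_def prod_encode_eq lrsim_def)
  ultimately show ?thesis using that by blast
qed

section \<open>Formulae for the classes, and invariance of formulae under the congruence\<close>

lemma models_First_iff:
  "models v (First \<phi> a \<psi>) \<longleftrightarrow>
    a \<in> set v \<and> models (before_first a v) \<phi> \<and> models (after_first a v) \<psi>"
proof
  assume "models v (First \<phi> a \<psi>)"
  then show "a \<in> set v \<and> models (before_first a v) \<phi> \<and> models (after_first a v) \<psi>" by auto
next
  assume "a \<in> set v \<and> models (before_first a v) \<phi> \<and> models (after_first a v) \<psi>"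
  then show "models v (First \<phi> a \<psi>)"
    unfolding models.simps(6) using first_decomp[of a v] notin_before_first[of a v] by blast
qed

text \<open>Swapping the arguments along with the modality keeps the turn on the same subformula:
  \<open>First\<close> charges its left argument, \<open>Last\<close> its right one. Hence the
  number of turns is unchanged.\<close>

fun mirror :: "'a itl \<Rightarrow> 'a itl" where
  "mirror Top = Top"
| "mirror Bot = Bot"
| "mirror (Neg \<phi>) = Neg (mirror \<phi>)"
| "mirror (Or \<phi> \<psi>) = Or (mirror \<phi>) (mirror \<psi>)"
| "mirror (And \<phi> \<psi>) = And (mirror \<phi>) (mirror \<psi>)"
| "mirror (First \<phi> a \<psi>) = Last (mirror \<psi>) a (mirror \<phi>)"
| "mirror (Last \<phi> a \<psi>) = First (mirror \<psi>) a (mirror \<phi>)"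

lemma turns_mirror [simp]: "turns (mirror \<phi>) = turns \<phi>"
  by (induction \<phi>) auto

lemma letters_mirror [simp]: "letters (mirror \<phi>) = letters \<phi>"
  by (induction \<phi>) auto

lemma rev_eq_split: "rev u = x @ a # y \<longleftrightarrow> u = rev y @ a # rev x"
  by (metis append.assoc append_Cons append_Nil rev.simps(2) rev_append rev_rev_ident)

lemma models_mirror: "models u (mirror \<phi>) \<longleftrightarrow> models (rev u) \<phi>"
proof (induction \<phi> arbitrary: u)
  case (First \<phi> a \<psi>)
  show ?case
    by (simp add: First rev_eq_split) (metis rev_rev_ident set_rev)
next
  case (Last \<phi> a \<psi>)
  show ?case
    by (simp add: Last rev_eq_split) (metis rev_rev_ident set_rev)
qed auto

definition big_and :: "'a itl list \<Rightarrow> 'a itl" where "big_and fs = foldr And fs Top"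
definition big_or :: "'a itl list \<Rightarrow> 'a itl" where "big_or fs = foldr Or fs Bot"

lemma models_big_and [simp]: "models u (big_and fs) \<longleftrightarrow> (\<forall>f\<in>set fs. models u f)"
  unfolding big_and_def by (induction fs) auto

lemma models_big_or [simp]: "models u (big_or fs) \<longleftrightarrow> (\<exists>f\<in>set fs. models u f)"
  unfolding big_or_def by (induction fs) auto

lemma ITL_big_and: "set fs \<subseteq> ITL A m \<Longrightarrow> big_and fs \<in> ITL A m"
  unfolding big_and_def by (induction fs) (auto simp: ITL_def)

lemma ITL_big_or: "set fs \<subseteq> ITL A m \<Longrightarrow> big_or fs \<in> ITL A m"
  unfolding big_or_def by (induction fs) (auto simp: ITL_def)

text \<open>The formula follows the recursion of \<open>rsim\<close>. The level lost before a first
  occurrence is the turn that \<open>First\<close> charges to its left argument, and each reversal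
  is expressed by \<open>mirror\<close> at no cost.\<close>

lemma rsim_class_definable:
  assumes A: "finite A"
  shows "u \<in> lists A \<Longrightarrow> \<exists>\<phi>\<in>ITL A m. \<forall>v\<in>lists A. models v \<phi> \<longleftrightarrow> rsim m n u v"
proof (induction m arbitrary: n u)
  case 0
  show ?case by (rule bexI[of _ Top]) (auto simp: ITL_def)
next
  case (Suc m)
  note IHm = Suc.IH
  show ?case using Suc.prems
  proof (induction n arbitrary: u)
    case 0
    show ?case by (rule bexI[of _ Top]) (auto simp: ITL_def)
  next
    case (Suc n)
    note u = Suc.prems
    obtain as where as: "set as = A" using finite_list[OF A] by blast
    obtain \<gamma> where \<gamma>: "\<gamma> \<in> ITL A m" "\<And>v. v \<in> lists A \<Longrightarrow> models v \<gamma> \<longleftrightarrow> rsim m (Suc n) (rev u) v"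
      using IHm[of "rev u" "Suc n"] u by auto
    have "\<forall>a. \<exists>\<phi>. \<phi> \<in> ITL A m \<and>
        (\<forall>v\<in>lists A. models v \<phi> \<longleftrightarrow> rsim m n (rev (before_first a u)) v)"
      using IHm[of "rev (before_first a u)" n for a] before_first_lists[OF u]
      by (simp add: Bex_def)
    then obtain \<alpha> where \<alpha>: "\<And>a. \<alpha> a \<in> ITL A m"
      "\<And>a v. v \<in> lists A \<Longrightarrow> models v (\<alpha> a) \<longleftrightarrow> rsim m n (rev (before_first a u)) v"
      by metis
    have "\<forall>a. \<exists>\<phi>. \<phi> \<in> ITL A (Suc m) \<and>
        (\<forall>v\<in>lists A. models v \<phi> \<longleftrightarrow> rsim (Suc m) n (after_first a u) v)"
      using Suc.IH[of "after_first a u" for a] after_first_lists[OF u]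
      by (simp add: Bex_def)
    then obtain \<beta> where \<beta>: "\<And>a. \<beta> a \<in> ITL A (Suc m)"
      "\<And>a v. v \<in> lists A \<Longrightarrow> models v (\<beta> a) \<longleftrightarrow> rsim (Suc m) n (after_first a u) v"
      by metis
    \<comment> \<open>Letters missing from \<open>u\<close> must be excluded explicitly, so that the
      conjunction over the whole alphabet also fixes the set of letters.\<close>
    define \<delta> where "\<delta> a = (if a \<in> set u then First (mirror (\<alpha> a)) a (\<beta> a)
      else Neg (First Top a Top))" for a
    define \<phi> where "\<phi> = big_and (mirror \<gamma> # map \<delta> as)"
    have "\<delta> a \<in> ITL A (Suc m)" if "a \<in> A" for a
      using that \<alpha>(1)[of a] \<beta>(1)[of a] by (auto simp: \<delta>_def ITL_def)
    moreover have "mirror \<gamma> \<in> ITL A (Suc m)" using \<gamma>(1) by (auto simp: ITL_def)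
    ultimately have "\<phi> \<in> ITL A (Suc m)" unfolding \<phi>_def by (intro ITL_big_and) (auto simp: as)
    moreover have "models v \<phi> \<longleftrightarrow> rsim (Suc m) (Suc n) u v" if v: "v \<in> lists A" for v
    proof -
      have \<delta>: "models v (\<delta> a) \<longleftrightarrow> (if a \<in> set u then a \<in> set v \<and>
          rsim m n (rev (before_first a u)) (rev (before_first a v)) \<and>
          rsim (Suc m) n (after_first a u) (after_first a v) else a \<notin> set v)" for a
        using \<alpha>(2) \<beta>(2) before_first_lists[OF v] after_first_lists[OF v]
        by (simp add: \<delta>_def models_First_iff models_mirror del: models.simps(6))
      have "models v \<phi> \<longleftrightarrow> rsim m (Suc n) (rev u) (rev v) \<and> (\<forall>a\<in>A. models v (\<delta> a))"
        using \<gamma>(2)[of "rev v"] v by (simp add: \<phi>_def models_mirror as)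
      also have "\<dots> \<longleftrightarrow> rsim (Suc m) (Suc n) u v"
        unfolding \<delta> rsim.simps(3) using u v by (auto split: if_splits)
      finally show ?thesis .
    qed
    ultimately show ?case by blast
  qed
qed

text \<open>\<open>L\<close> is a union of classes. One representative in \<open>L\<close> for each
  of the finitely many values of \<open>g\<close> turns this into a finite disjunction.\<close>

lemma definable_if_lrsim_saturated:
  assumes A: "finite A" and L: "L \<subseteq> lists A"
    and sat: "\<And>u v. u \<in> L \<Longrightarrow> v \<in> lists A \<Longrightarrow> lrsim m n u v \<Longrightarrow> v \<in> L"
  shows "itl_definable A m L"
proof -
  obtain g :: "'a list \<Rightarrow> nat" where g: "finite (g ` lists A)"
    "\<forall>u\<in>lists A. \<forall>v\<in>lists A. g u = g v \<longrightarrow> lrsim m n u v"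
    using lrsim_finite_index[OF A] by metis
  have "finite (g ` L)" using finite_subset[OF image_mono[OF L] g(1)] .
  then obtain ws where ws: "set ws = inv_into L g ` g ` L"
    using finite_list[of "inv_into L g ` g ` L"] by auto
  have wsL: "set ws \<subseteq> L" unfolding ws by (auto intro: inv_into_into)
  have "\<forall>w. \<exists>\<phi>. w \<in> lists A \<longrightarrow> \<phi> \<in> ITL A m \<and> (\<forall>v\<in>lists A. models v \<phi> \<longleftrightarrow> rsim m n w v)"
    using rsim_class_definable[OF A] by blast
  then obtain \<phi> where \<phi>: "\<And>w. w \<in> lists A \<Longrightarrow> \<phi> w \<in> ITL A m"
    "\<And>w v. w \<in> lists A \<Longrightarrow> v \<in> lists A \<Longrightarrow> models v (\<phi> w) \<longleftrightarrow> rsim m n w v" by metis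
  define \<psi> where "\<psi> = big_or (map (\<lambda>w. And (\<phi> w) (mirror (\<phi> (rev w)))) ws)"
  have "And (\<phi> w) (mirror (\<phi> (rev w))) \<in> ITL A m" if "w \<in> set ws" for w
  proof -
    have "w \<in> lists A" using that wsL L by blast
    then show ?thesis using \<phi>(1)[of w] \<phi>(1)[of "rev w"] by (simp add: ITL_def)
  qed
  then have "\<psi> \<in> ITL A m" unfolding \<psi>_def by (intro ITL_big_or) auto
  moreover have "models v \<psi> \<longleftrightarrow> v \<in> L" if v: "v \<in> lists A" for v
  proof -
    have "models v (And (\<phi> w) (mirror (\<phi> (rev w)))) \<longleftrightarrow> lrsim m n w v" if "w \<in> set ws" for w
    proof -
      have "w \<in> lists A" using that wsL L by blast
      then show ?thesis using \<phi>(2)[of w v] \<phi>(2)[of "rev w" "rev v"] v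
        by (simp add: models_mirror lrsim_def)
    qed
    then have "models v \<psi> \<longleftrightarrow> (\<exists>w\<in>set ws. lrsim m n w v)" by (simp add: \<psi>_def)
    also have "\<dots> \<longleftrightarrow> v \<in> L"
    proof
      assume "\<exists>w\<in>set ws. lrsim m n w v"
      then show "v \<in> L" using wsL sat v by blast
    next
      assume vL: "v \<in> L"
      let ?w = "inv_into L g (g v)"
      have "?w \<in> set ws" unfolding ws using vL by blast
      moreover have "g ?w = g v" using vL by (intro f_inv_into_f) simp
      then have "lrsim m n ?w v" using g(2) v wsL L \<open>?w \<in> set ws\<close> by blast
      ultimately show "\<exists>w\<in>set ws. lrsim m n w v" by blast
    qed
    finally show ?thesis .
  qed
  then have "L = {u \<in> lists A. models u \<psi>}" using L by blast
  ultimately show ?thesis unfolding itl_definable_def by blast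
qed

text \<open>The depth grows with the nesting of modalities, the level does not: the argument charged
  with a turn is evaluated on exactly the side where a jump loses a level.\<close>

lemma models_lrsim_invariant:
  "turns \<phi> \<le> m \<Longrightarrow> \<exists>n. \<forall>u v. lrsim m n u v \<longrightarrow> (models u \<phi> \<longleftrightarrow> models v \<phi>)"
proof (induction \<phi> arbitrary: m)
  case (Or \<phi> \<psi>)
  then obtain n1 n2 where
    "\<And>u v. lrsim m n1 u v \<Longrightarrow> models u \<phi> \<longleftrightarrow> models v \<phi>"
    "\<And>u v. lrsim m n2 u v \<Longrightarrow> models u \<psi> \<longleftrightarrow> models v \<psi>" by (metis max.bounded_iff turns.simps(4))
  then have "models u \<phi> \<longleftrightarrow> models v \<phi>" "models u \<psi> \<longleftrightarrow> models v \<psi>"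
    if "lrsim m (max n1 n2) u v" for u v
    using lrsim_depth_mono[OF that, of n1] lrsim_depth_mono[OF that, of n2] by auto
  then show ?case by (intro exI[of _ "max n1 n2"]) simp
next
  case (And \<phi> \<psi>)
  then obtain n1 n2 where
    "\<And>u v. lrsim m n1 u v \<Longrightarrow> models u \<phi> \<longleftrightarrow> models v \<phi>"
    "\<And>u v. lrsim m n2 u v \<Longrightarrow> models u \<psi> \<longleftrightarrow> models v \<psi>" by (metis max.bounded_iff turns.simps(5))
  then have "models u \<phi> \<longleftrightarrow> models v \<phi>" "models u \<psi> \<longleftrightarrow> models v \<psi>"
    if "lrsim m (max n1 n2) u v" for u v
    using lrsim_depth_mono[OF that, of n1] lrsim_depth_mono[OF that, of n2] by auto
  then show ?case by (intro exI[of _ "max n1 n2"]) simp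
next
  case (First \<phi> a \<psi>)
  then obtain k where k: "m = Suc k" "turns \<phi> \<le> k" "turns \<psi> \<le> m" by (cases m) auto
  then obtain n1 n2 where
    n: "\<And>u v. lrsim k n1 u v \<Longrightarrow> models u \<phi> \<longleftrightarrow> models v \<phi>"
    "\<And>u v. lrsim m n2 u v \<Longrightarrow> models u \<psi> \<longleftrightarrow> models v \<psi>" using First.IH by metis
  let ?n = "max n1 n2"
  have step: "models v (First \<phi> a \<psi>)" if sim: "lrsim m (Suc ?n) u v" and "models u (First \<phi> a \<psi>)" for u v
  proof -
    from that obtain u0 u1 where u: "u = u0 @ a # u1" "a \<notin> set u0" "models u0 \<phi>" "models u1 \<psi>" by auto
    have "a \<in> set v" using lrsim_set[OF sim] k u by auto
    then obtain v0 v1 where v: "v = v0 @ a # v1" "a \<notin> set v0" by (meson split_list_first)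
    note sim' = sim[unfolded u(1) v(1) k(1)]
    have "lrsim k n1 u0 v0" "lrsim m n2 u1 v1"
      using lrsim_before_first[OF sim' u(2) v(2)] lrsim_after_first[OF sim' u(2) v(2)] k
      by (auto intro: lrsim_depth_mono[of _ ?n])
    then show ?thesis using n u v by auto
  qed
  show ?case using step lrsim_sym by blast
next
  case (Last \<phi> a \<psi>)
  then obtain k where k: "m = Suc k" "turns \<psi> \<le> k" "turns \<phi> \<le> m" by (cases m) auto
  then obtain n1 n2 where
    n: "\<And>u v. lrsim m n1 u v \<Longrightarrow> models u \<phi> \<longleftrightarrow> models v \<phi>"
    "\<And>u v. lrsim k n2 u v \<Longrightarrow> models u \<psi> \<longleftrightarrow> models v \<psi>" using Last.IH by metis
  let ?n = "max n1 n2"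
  have step: "models v (Last \<phi> a \<psi>)" if sim: "lrsim m (Suc ?n) u v" and "models u (Last \<phi> a \<psi>)" for u v
  proof -
    from that obtain u0 u1 where u: "u = u0 @ a # u1" "a \<notin> set u1" "models u0 \<phi>" "models u1 \<psi>" by auto
    have "a \<in> set v" using lrsim_set[OF sim] k u by auto
    then obtain v0 v1 where v: "v = v0 @ a # v1" "a \<notin> set v1" by (meson split_list_last)
    note sim' = sim[unfolded u(1) v(1) k(1)]
    have "lrsim m n1 u0 v0" "lrsim k n2 u1 v1"
      using lrsim_before_last[OF sim' u(2) v(2)] lrsim_after_last[OF sim' u(2) v(2)] k
      by (auto intro: lrsim_depth_mono[of _ ?n])
    then show ?thesis using n u v by auto
  qed
  show ?case using step lrsim_sym by blast
qed auto

section \<open>Opposite monoids and quotients\<close>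

text \<open>Reversing the multiplication exchanges R with L and \<open>sim_K\<close> with
  \<open>sim_D\<close>; facts on the L-side of the hierarchy are obtained through it from the
  R-side.\<close>

definition op_monoid :: "('a, 'c) monoid_scheme \<Rightarrow> 'a monoid" where
  "op_monoid M = \<lparr>carrier = carrier M, mult = (\<lambda>x y. y \<otimes>\<^bsub>M\<^esub> x), one = \<one>\<^bsub>M\<^esub>\<rparr>"

lemma op_monoid_simps [simp]:
  "carrier (op_monoid M) = carrier M" "x \<otimes>\<^bsub>op_monoid M\<^esub> y = y \<otimes>\<^bsub>M\<^esub> x" "\<one>\<^bsub>op_monoid M\<^esub> = \<one>\<^bsub>M\<^esub>"
  by (simp_all add: op_monoid_def)

lemma op_op_monoid [simp]: "op_monoid (op_monoid M) = M" for M :: "'a monoid"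
  by (cases M) (simp add: op_monoid_def)

lemma monoid_op: "monoid M \<Longrightarrow> monoid (op_monoid M)"
  by (rule monoidI) (simp_all add: monoid.m_closed monoid.one_closed monoid.m_assoc monoid.l_one monoid.r_one)

lemma finite_monoid_op [simp]: "finite_monoid (op_monoid M) \<longleftrightarrow> finite_monoid M" for M :: "'a monoid"
  using monoid_op[of M] monoid_op[of "op_monoid M"] by (auto simp: finite_monoid_def)

lemma green_R_op: "green_R (op_monoid M) x y \<longleftrightarrow> green_L M x y"
  by (simp add: green_R_def green_L_def l_coset_def r_coset_def)

lemma idempotents_op [simp]: "idempotents (op_monoid M) = idempotents M"
  by (simp add: idempotents_def)

lemma sim_K_op: "sim_K (op_monoid M) = sim_D M"
  by (simp add: sim_K_def sim_D_def green_R_op)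

lemma quotient_monoid_op: "quotient_monoid (op_monoid M) r = op_monoid (quotient_monoid M r)"
  by (auto simp: quotient_monoid_def op_monoid_def fun_eq_iff)

lemma is_iso_op: "M \<cong> N \<Longrightarrow> op_monoid M \<cong> op_monoid N"
  by (auto simp: is_iso_def iso_def hom_def)

lemma R_trivial_op: "op_monoid M \<in> R_trivial \<longleftrightarrow> M \<in> L_trivial"
  by (simp add: R_trivial_def L_trivial_def green_R_op)

text \<open>Only one equivalence needs induction; the other is its instance for the opposite monoid,
  as forming opposites is an involution.\<close>

lemma TW_op: "(op_monoid M \<in> TW_R m \<longleftrightarrow> M \<in> TW_L m) \<and> (op_monoid M \<in> TW_L m \<longleftrightarrow> M \<in> TW_R m)"
proof -
  have R: "op_monoid M \<in> TW_R m \<longleftrightarrow> M \<in> TW_L m" for M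
  proof (induction m arbitrary: M rule: less_induct)
    case (less m)
    show ?case
    proof (cases "m \<le> 2")
      case True
      then show ?thesis by (simp add: TW_R.simps[of m] TW_L.simps[of m] R_trivial_op)
    next
      case False
      then have IH: "op_monoid N \<in> TW_R (m - 1) \<longleftrightarrow> N \<in> TW_L (m - 1)" for N
        using less.IH[of "m - 1"] by simp
      have "op_monoid M \<in> TW_R m \<longleftrightarrow> finite_monoid M \<and>
          (\<exists>N\<in>TW_L (m - 1). op_monoid (quotient_monoid M (sim_D M)) \<cong> N)"
        using False by (simp add: TW_R.simps[of m] K_malcev_def sim_K_op quotient_monoid_op)
      also have "\<dots> \<longleftrightarrow> finite_monoid M \<and>
          (\<exists>N\<in>TW_R (m - 1). quotient_monoid M (sim_D M) \<cong> N)"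
      proof -
        have Q: "op_monoid (op_monoid (quotient_monoid M (sim_D M))) = quotient_monoid M (sim_D M)"
          by simp
        have "(\<exists>N\<in>TW_L (m - 1). op_monoid (quotient_monoid M (sim_D M)) \<cong> N) \<longleftrightarrow>
            (\<exists>N\<in>TW_R (m - 1). quotient_monoid M (sim_D M) \<cong> N)"
        proof
          assume "\<exists>N\<in>TW_L (m - 1). op_monoid (quotient_monoid M (sim_D M)) \<cong> N"
          then obtain N where "N \<in> TW_L (m - 1)" "op_monoid (quotient_monoid M (sim_D M)) \<cong> N" by blast
          then show "\<exists>N\<in>TW_R (m - 1). quotient_monoid M (sim_D M) \<cong> N"
            using is_iso_op[of "op_monoid (quotient_monoid M (sim_D M))" N] IH[of N] Q by auto
        next
          assume "\<exists>N\<in>TW_R (m - 1). quotient_monoid M (sim_D M) \<cong> N"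
          then obtain N where "N \<in> TW_R (m - 1)" "quotient_monoid M (sim_D M) \<cong> N" by blast
          then show "\<exists>N\<in>TW_L (m - 1). op_monoid (quotient_monoid M (sim_D M)) \<cong> N"
            using is_iso_op[of "quotient_monoid M (sim_D M)" N] IH[of "op_monoid N"] by auto
        qed
        then show ?thesis by simp
      qed
      also have "\<dots> \<longleftrightarrow> M \<in> TW_L m"
        using False by (simp add: TW_L.simps[of m] D_malcev_def)
      finally show ?thesis .
    qed
  qed
  from R[of M] R[of "op_monoid M"] show ?thesis by simp
qed

lemma TW_R_finite: "M \<in> TW_R m \<Longrightarrow> finite_monoid M"
  by (auto simp: TW_R.simps[of m] R_trivial_def K_malcev_def split: if_splits)

lemma TW_L_finite: "M \<in> TW_L m \<Longrightarrow> finite_monoid M"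
  by (auto simp: TW_L.simps[of m] L_trivial_def D_malcev_def split: if_splits)

section \<open>Green's relation R, idempotent powers, and the congruence
  \<open>sim_K\<close>\<close>

lemma green_R_iff:
  fixes M (structure)
  assumes "monoid M" "x \<in> carrier M" "y \<in> carrier M"
  shows "green_R M x y \<longleftrightarrow> (\<exists>p\<in>carrier M. x \<otimes> p = y) \<and> (\<exists>q\<in>carrier M. y \<otimes> q = x)"
proof -
  interpret monoid M by fact
  have sub: "a <# carrier M \<subseteq> b <# carrier M \<longleftrightarrow> (\<exists>p\<in>carrier M. b \<otimes> p = a)"
    if "a \<in> carrier M" "b \<in> carrier M" for a b
  proof
    have "a \<otimes> \<one> \<in> a <# carrier M" unfolding l_coset_def by blast
    moreover assume "a <# carrier M \<subseteq> b <# carrier M"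
    ultimately have "a \<in> b <# carrier M" using that by auto
    then show "\<exists>p\<in>carrier M. b \<otimes> p = a" by (auto simp: l_coset_def)
  next
    assume "\<exists>p\<in>carrier M. b \<otimes> p = a"
    then obtain p where p: "p \<in> carrier M" "a = b \<otimes> p" by blast
    show "a <# carrier M \<subseteq> b <# carrier M"
    proof
      fix z assume "z \<in> a <# carrier M"
      then obtain h where "h \<in> carrier M" "z = a \<otimes> h" by (auto simp: l_coset_def)
      then have "z = b \<otimes> (p \<otimes> h)" "p \<otimes> h \<in> carrier M"
        using p that by (simp_all add: m_assoc)
      then show "z \<in> b <# carrier M" by (auto simp: l_coset_def)
    qed
  qed
  show ?thesis unfolding green_R_def using sub assms(2,3) by blast
qed

lemma green_R_idempotent_iff:
  fixes M (structure)
  assumes "monoid M" "x \<in> carrier M" "e \<in> carrier M"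
  shows "green_R M (e \<otimes> x) e \<longleftrightarrow> (\<exists>p\<in>carrier M. e \<otimes> x \<otimes> p = e)"
proof -
  interpret monoid M by fact
  show ?thesis using green_R_iff[OF assms(1), of "e \<otimes> x" e] assms(2,3) by auto
qed

lemma sim_K_iff:
  fixes M (structure)
  assumes "monoid M"
  shows "(x, y) \<in> sim_K M \<longleftrightarrow> x \<in> carrier M \<and> y \<in> carrier M \<and>
    (\<forall>e\<in>idempotents M. (\<exists>p\<in>carrier M. e \<otimes> x \<otimes> p = e) \<or> (\<exists>p\<in>carrier M. e \<otimes> y \<otimes> p = e) \<longrightarrow>
      e \<otimes> x = e \<otimes> y)"
proof (cases "x \<in> carrier M \<and> y \<in> carrier M")
  case True
  then have "green_R M (e \<otimes> w) e \<longleftrightarrow> (\<exists>p\<in>carrier M. e \<otimes> w \<otimes> p = e)"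
    if "e \<in> idempotents M" "w \<in> {x, y}" for e w
    using green_R_idempotent_iff[OF assms, of w e] that by (auto simp: idempotents_def)
  then show ?thesis using True by (simp add: sim_K_def cong: ball_cong)
qed (auto simp: sim_K_def)

lemma idempotent_power:
  fixes M (structure)
  assumes "finite_monoid M"
  obtains K :: nat where "0 < K"
    "\<And>x. x \<in> carrier M \<Longrightarrow> x [^] K \<otimes> x [^] K = x [^] K"
proof -
  interpret monoid M using assms by (simp add: finite_monoid_def)
  have fin: "finite (carrier M)" using assms by (simp add: finite_monoid_def)
  have "\<exists>k>(0::nat). x [^] k \<otimes> x [^] k = x [^] k" if x: "x \<in> carrier M" for x
  proof -
    have "\<not> inj (\<lambda>k::nat. x [^] k)"
      using finite_imageD[of "\<lambda>k::nat. x [^] k" UNIV] finite_subset[OF _ fin, of "range (\<lambda>k::nat. x [^] k)"] x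
      by auto
    then obtain i j :: nat where "i < j" "x [^] i = x [^] j"
      unfolding inj_def by (metis linorder_neqE_nat)
    define d where "d = j - i"
    have d: "0 < d" "x [^] (i + d) = x [^] i"
      using \<open>i < j\<close> \<open>x [^] i = x [^] j\<close> by (simp_all add: d_def)
    have step: "x [^] (n + t * d) = x [^] n" if "i \<le> n" for n t
    proof (induction t)
      case (Suc t)
      have "n + Suc t * d = (i + d) + (n - i + t * d)" using that by simp
      then have "x [^] (n + Suc t * d) = x [^] (i + d) \<otimes> x [^] (n - i + t * d)"
        using nat_pow_mult[OF x] by metis
      also have "\<dots> = x [^] (i + (n - i + t * d))" using nat_pow_mult[OF x] d(2) by metis
      also have "i + (n - i + t * d) = n + t * d" using that by simp
      finally show ?case using Suc by simp
    qed simp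
    have "i \<le> Suc i * d" using d(1) by (cases d) auto
    from step[OF this, of "Suc i"]
    have "x [^] (Suc i * d) \<otimes> x [^] (Suc i * d) = x [^] (Suc i * d)"
      using nat_pow_mult[OF x, of "Suc i * d" "Suc i * d"] by simp
    moreover have "0 < Suc i * d" using d(1) by simp
    ultimately show ?thesis by blast
  qed
  then obtain k :: "_ \<Rightarrow> nat" where k: "\<And>x. x \<in> carrier M \<Longrightarrow> 0 < k x"
    "\<And>x. x \<in> carrier M \<Longrightarrow> x [^] k x \<otimes> x [^] k x = x [^] k x" by metis
  \<comment> \<open>A power of an idempotent is idempotent, so a common multiple of the individual
    exponents serves all elements at once.\<close>
  define K where "K = (\<Prod>x\<in>carrier M. k x)"
  have "x [^] K \<otimes> x [^] K = x [^] K" if x: "x \<in> carrier M" for x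
  proof -
    obtain l where K: "K = k x * l" unfolding K_def using dvd_prodI[OF fin x] by (metis dvdE)
    have "(x [^] k x) [^] l \<otimes> (x [^] k x) [^] l = (x [^] k x \<otimes> x [^] k x) [^] l"
      using x by (intro pow_mult_distrib[symmetric]) auto
    then show ?thesis using k(2)[OF x] x by (simp add: K nat_pow_pow)
  qed
  moreover have "0 < K" unfolding K_def using k(1) fin by (simp add: prod_pos)
  ultimately show ?thesis using that by blast
qed

text \<open>\<open>iso\<close> asks only for a multiplicative bijection; a preimage of the unit
  forces the unit to be preserved.\<close>

lemma iso_one:
  assumes "monoid M" "monoid N" "\<phi> \<in> iso M N"
  shows "\<phi> \<one>\<^bsub>M\<^esub> = \<one>\<^bsub>N\<^esub>"
proof -
  interpret M: monoid M by fact
  interpret N: monoid N by fact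
  have "\<one>\<^bsub>N\<^esub> \<in> \<phi> ` carrier M" using assms(3) by (simp add: iso_def bij_betw_def)
  then obtain x where x: "x \<in> carrier M" "\<phi> x = \<one>\<^bsub>N\<^esub>" by auto
  have "\<phi> \<one>\<^bsub>M\<^esub> \<in> carrier N" using assms(3) by (auto simp: iso_def hom_def)
  moreover have "\<phi> (\<one>\<^bsub>M\<^esub> \<otimes>\<^bsub>M\<^esub> x) = \<phi> \<one>\<^bsub>M\<^esub> \<otimes>\<^bsub>N\<^esub> \<phi> x"
    using assms(3) x(1) M.one_closed unfolding iso_def hom_def by blast
  ultimately show ?thesis using x by simp
qed

lemma nat_copy:
  assumes "finite_monoid M"
  obtains N :: "nat monoid" and \<phi> where "finite_monoid N" "\<phi> \<in> iso M N" "N \<cong> M" "\<phi> \<one>\<^bsub>M\<^esub> = \<one>\<^bsub>N\<^esub>"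
proof -
  interpret monoid M using assms by (simp add: finite_monoid_def)
  obtain \<phi> :: "'a \<Rightarrow> nat" where inj: "inj_on \<phi> (carrier M)"
    using assms finite_imp_inj_to_nat_seg[of "carrier M"] by (auto simp: finite_monoid_def)
  define \<psi> where "\<psi> = inv_into (carrier M) \<phi>"
  have \<psi>: "\<psi> (\<phi> x) = x" if "x \<in> carrier M" for x using that inj by (simp add: \<psi>_def)
  define N :: "nat monoid" where "N = \<lparr>carrier = \<phi> ` carrier M, mult = (\<lambda>x y. \<phi> (\<psi> x \<otimes>\<^bsub>M\<^esub> \<psi> y)), one = \<phi> \<one>\<^bsub>M\<^esub>\<rparr>"
  have "monoid N" by (rule monoidI) (auto simp: N_def \<psi> m_assoc)
  then have "finite_monoid N" using assms by (simp add: finite_monoid_def N_def)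
  moreover have "\<phi> \<in> iso M N" using inj by (auto simp: iso_def hom_def bij_betw_def N_def \<psi>)
  moreover have "N \<cong> M"
  proof -
    have "bij_betw \<psi> (\<phi> ` carrier M) (carrier M)"
      unfolding \<psi>_def using inj by (intro bij_betw_inv_into) (simp add: bij_betw_def)
    then have "\<psi> \<in> iso N M" by (auto simp: iso_def hom_def N_def \<psi>)
    then show ?thesis unfolding is_iso_def by blast
  qed
  moreover have "\<phi> \<one>\<^bsub>M\<^esub> = \<one>\<^bsub>N\<^esub>" by (simp add: N_def)
  ultimately show ?thesis by (rule that)
qed

definition monoid_congruence :: "('a, 'c) monoid_scheme \<Rightarrow> ('a \<times> 'a) set \<Rightarrow> bool" where
  "monoid_congruence M r \<longleftrightarrow> equiv (carrier M) r \<and>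
    (\<forall>x y x' y'. (x, y) \<in> r \<longrightarrow> (x', y') \<in> r \<longrightarrow> (x \<otimes>\<^bsub>M\<^esub> x', y \<otimes>\<^bsub>M\<^esub> y') \<in> r)"

lemma quotient_mult:
  assumes "monoid_congruence M r" "x \<in> carrier M" "y \<in> carrier M"
  shows "r `` {x} \<otimes>\<^bsub>quotient_monoid M r\<^esub> r `` {y} = r `` {x \<otimes>\<^bsub>M\<^esub> y}"
proof -
  have eq: "equiv (carrier M) r" using assms(1) by (simp add: monoid_congruence_def)
  have cls: "r `` {x' \<otimes>\<^bsub>M\<^esub> y'} = r `` {x \<otimes>\<^bsub>M\<^esub> y}" if "(x, x') \<in> r" "(y, y') \<in> r" for x' y'
    using assms(1) that equiv_class_eq[OF eq] unfolding monoid_congruence_def by metis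
  have self: "(x, x) \<in> r" "(y, y) \<in> r" using equiv_class_self[OF eq] assms(2,3) by simp_all
  have "(\<Union>x'\<in>r `` {x}. \<Union>y'\<in>r `` {y}. r `` {x' \<otimes>\<^bsub>M\<^esub> y'}) =
      (\<Union>x'\<in>r `` {x}. \<Union>y'\<in>r `` {y}. r `` {x \<otimes>\<^bsub>M\<^esub> y})"
    by (intro SUP_cong refl cls) simp_all
  also have "\<dots> = r `` {x \<otimes>\<^bsub>M\<^esub> y}" using self by blast
  finally show ?thesis by (simp add: quotient_monoid_def)
qed

lemma quotient_monoid_is_monoid:
  assumes "monoid M" "monoid_congruence M r"
  shows "monoid (quotient_monoid M r)"
proof -
  interpret monoid M by fact
  note mult = quotient_mult[OF assms(2)]
  have car: "carrier (quotient_monoid M r) = (\<lambda>x. r `` {x}) ` carrier M"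
    by (auto simp: quotient_monoid_def quotient_def)
  have one: "\<one>\<^bsub>quotient_monoid M r\<^esub> = r `` {\<one>\<^bsub>M\<^esub>}" by (simp add: quotient_monoid_def)
  show ?thesis by (rule monoidI) (auto simp: car one mult m_assoc)
qed

lemma quotient_finite_monoid:
  assumes "finite_monoid M" "monoid_congruence M r"
  shows "finite_monoid (quotient_monoid M r)"
  using assms quotient_monoid_is_monoid[of M r]
  by (auto simp: finite_monoid_def quotient_monoid_def quotient_def)

text \<open>Compatibility on the right is immediate. On the left, \<open>e \<otimes> z\<close> need
  not be idempotent, so the defining condition does not apply to it and an idempotent taking its
  place has to be found.\<close>

lemma sim_K_congruence:
  fixes M (structure)
  assumes M: "finite_monoid M"
  shows "monoid_congruence M (sim_K M)"
proof -
  interpret monoid M using M by (simp add: finite_monoid_def)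
  note iff = sim_K_iff[OF monoid_axioms]
  have tr: "(x, z) \<in> sim_K M" if "(x, y) \<in> sim_K M" "(y, z) \<in> sim_K M" for x y z
    using that unfolding iff by metis
  have sy: "(y, x) \<in> sim_K M" if "(x, y) \<in> sim_K M" for x y
    using that unfolding iff by metis
  have simI: "(x, y) \<in> sim_K M" if "x \<in> carrier M" "y \<in> carrier M"
    "\<And>e p. e \<in> idempotents M \<Longrightarrow> p \<in> carrier M \<Longrightarrow> e \<otimes> x \<otimes> p = e \<Longrightarrow> e \<otimes> x = e \<otimes> y"
    "\<And>e p. e \<in> idempotents M \<Longrightarrow> p \<in> carrier M \<Longrightarrow> e \<otimes> y \<otimes> p = e \<Longrightarrow> e \<otimes> y = e \<otimes> x"
    for x y unfolding iff using that by metis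
  have simD: "e \<otimes> x = e \<otimes> y"
    if "(x, y) \<in> sim_K M" "e \<in> idempotents M" "p \<in> carrier M" "e \<otimes> x \<otimes> p = e" for x y e p
    using that unfolding iff by metis
  have "equiv (carrier M) (sim_K M)"
  proof (rule equivI)
    show "sim_K M \<subseteq> carrier M \<times> carrier M" by (auto simp: sim_K_def)
    show "refl_on (carrier M) (sim_K M)" by (rule refl_onI) (auto simp: sim_K_def)
    show "sym (sim_K M)" by (rule symI) (rule sy)
    show "Relation.trans (sim_K M)" by (rule transI) (rule tr)
  qed
  moreover have right: "(x \<otimes> z, y \<otimes> z) \<in> sim_K M"
    if xy: "(x, y) \<in> sim_K M" and z: "z \<in> carrier M" for x y z
  proof -
    have c: "x \<in> carrier M" "y \<in> carrier M" using xy by (auto simp: sim_K_def)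
    have 1: "e \<otimes> (x \<otimes> z) = e \<otimes> (y \<otimes> z)"
      if xy: "(x, y) \<in> sim_K M" and e: "e \<in> idempotents M"
        and p: "p \<in> carrier M" "e \<otimes> (x \<otimes> z) \<otimes> p = e" for x y e p
    proof -
      have c: "x \<in> carrier M" "y \<in> carrier M" "e \<in> carrier M"
        using xy e by (auto simp: sim_K_def idempotents_def)
      have "e \<otimes> x \<otimes> (z \<otimes> p) = e" using p z c by (simp add: m_assoc)
      then have "e \<otimes> x = e \<otimes> y" by (rule simD[OF xy e m_closed[OF z p(1)]])
      then show ?thesis using c z by (simp flip: m_assoc)
    qed
    show ?thesis
    proof (rule simI)
      show "x \<otimes> z \<in> carrier M" "y \<otimes> z \<in> carrier M" using c z by simp_all
    qed (rule 1[OF xy] 1[OF sy[OF xy]]; assumption)+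
  qed
  moreover have left: "(z \<otimes> x, z \<otimes> y) \<in> sim_K M"
    if xy: "(x, y) \<in> sim_K M" and z: "z \<in> carrier M" for x y z
  proof -
    have c: "x \<in> carrier M" "y \<in> carrier M" using xy by (auto simp: sim_K_def)
    obtain K :: nat where K: "0 < K"
      "\<And>x. x \<in> carrier M \<Longrightarrow> x [^] K \<otimes> x [^] K = x [^] K" using idempotent_power[OF M] by metis
    have 1: "e \<otimes> (z \<otimes> x) = e \<otimes> (z \<otimes> y)"
      if xy: "(x, y) \<in> sim_K M" and e: "e \<in> idempotents M"
        and p: "p \<in> carrier M" "e \<otimes> (z \<otimes> x) \<otimes> p = e" for x y e p
    proof -
      have c: "x \<in> carrier M" "y \<in> carrier M" "e \<in> carrier M"
        using xy e by (auto simp: sim_K_def idempotents_def)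
      \<comment> \<open>From \<open>e z x p = e\<close> it follows that \<open>w = x p z\<close>
        fixes \<open>e z\<close> on the right. Its idempotent power \<open>f\<close> does so too and
        begins with \<open>x\<close>, so \<open>f x\<close> can be continued back to
        \<open>f\<close> and the hypothesis gives \<open>f x = f y\<close>.\<close>
      define w where "w = x \<otimes> (p \<otimes> z)"
      have w: "w \<in> carrier M" using c p z by (simp add: w_def)
      have ezw: "e \<otimes> z \<otimes> w = e \<otimes> z"
      proof -
        have "e \<otimes> z \<otimes> w = (e \<otimes> (z \<otimes> x) \<otimes> p) \<otimes> z"
          using c p(1) z by (simp add: w_def m_assoc)
        then show ?thesis using p by simp
      qed
      have pow: "e \<otimes> z \<otimes> (w [^] (j::nat)) = e \<otimes> z" for j
      proof (induction j)
        case (Suc j)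
        have "e \<otimes> z \<otimes> (w [^] Suc j) = (e \<otimes> z \<otimes> w [^] j) \<otimes> w"
          using c z w by (simp add: m_assoc)
        then show ?case using Suc ezw by simp
      qed (use c z in simp)
      define f where "f = w [^] K"
      have f: "f \<in> idempotents M" "f \<in> carrier M" using w K(2)[OF w] by (simp_all add: f_def idempotents_def)
      obtain K' where K': "K = Suc K'" using K(1) gr0_implies_Suc by blast
      have "f = w \<otimes> w [^] K'" unfolding f_def K' using nat_pow_Suc2[OF w] .
      then have "f \<otimes> x \<otimes> (p \<otimes> z \<otimes> w [^] K') = f \<otimes> f"
        using f c p z w by (simp add: w_def m_assoc)
      also have "\<dots> = f" using f by (simp add: idempotents_def)
      finally have "f \<otimes> x = f \<otimes> y"
        by (rule simD[OF xy f(1), rotated]) (use p(1) z w in simp)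
      then have "(e \<otimes> z) \<otimes> f \<otimes> x = (e \<otimes> z) \<otimes> f \<otimes> y"
        using c z f by (simp add: m_assoc)
      then show ?thesis using pow[of K] c z by (simp add: f_def m_assoc)
    qed
    show ?thesis
    proof (rule simI)
      show "z \<otimes> x \<in> carrier M" "z \<otimes> y \<in> carrier M" using c z by simp_all
    qed (rule 1[OF xy] 1[OF sy[OF xy]]; assumption)+
  qed
  moreover have "(x \<otimes> x', y \<otimes> y') \<in> sim_K M" if "(x, y) \<in> sim_K M" "(x', y') \<in> sim_K M" for x y x' y'
  proof -
    have "x' \<in> carrier M" "y \<in> carrier M" using that by (auto simp: sim_K_def)
    then show ?thesis using right[OF that(1)] left[OF that(2)] tr by blast
  qed
  ultimately show ?thesis unfolding monoid_congruence_def by blast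
qed

text \<open>
  Homomorphisms are defined on all words over the type; letters outside the alphabet of a language
  will be mapped to the unit.
\<close>

definition word_hom :: "('b, 'c) monoid_scheme \<Rightarrow> ('a list \<Rightarrow> 'b) \<Rightarrow> bool" where
  "word_hom M h \<longleftrightarrow> (\<forall>u. h u \<in> carrier M) \<and> h [] = \<one>\<^bsub>M\<^esub> \<and> (\<forall>u v. h (u @ v) = h u \<otimes>\<^bsub>M\<^esub> h v)"

lemma word_homD:
  assumes "word_hom M h"
  shows "h u \<in> carrier M" "h [] = \<one>\<^bsub>M\<^esub>" "h (u @ v) = h u \<otimes>\<^bsub>M\<^esub> h v"
  using assms by (simp_all add: word_hom_def)

lemma word_hom_wpow:
  assumes "monoid M" "word_hom M h"
  shows "h (wpow w k) = h w [^]\<^bsub>M\<^esub> k"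
proof -
  interpret monoid M by fact
  show ?thesis
    by (induction k) (simp_all add: word_homD[OF assms(2)] wpow_Suc_right del: wpow_simps(2))
qed

lemma word_hom_rev: "word_hom M h \<Longrightarrow> word_hom (op_monoid M) (h \<circ> rev)"
  by (simp add: word_hom_def)

lemma word_hom_comp:
  assumes "word_hom M h" "\<phi> \<in> monoid_hom M N"
  shows "word_hom N (\<phi> \<circ> h)"
  using assms by (auto simp: word_hom_def monoid_hom_def hom_def)

lemma quotient_hom:
  assumes "monoid M" "monoid_congruence M r"
  shows "(\<lambda>x. r `` {x}) \<in> monoid_hom M (quotient_monoid M r)"
  using quotient_mult[OF assms(2)]
  by (auto simp: monoid_hom_def hom_def) (auto simp: quotient_monoid_def quotient_def)

section \<open>Identities of the join and quotients by the word congruences\<close>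

text \<open>The identities for level \<open>k + 2\<close> of the hierarchy: the pairs of index
  \<open>Suc k\<close> are the instances of
  \<open>U\<^sub>k\<^sub>+\<^sub>2 = V\<^sub>k\<^sub>+\<^sub>2\<close>.\<close>

definition tw_sat :: "nat \<Rightarrow> nat \<Rightarrow> ('a list \<Rightarrow> 'b) \<Rightarrow> bool" where
  "tw_sat k K h \<longleftrightarrow> 0 < K \<and> (\<forall>w. h (wpow w K @ wpow w K) = h (wpow w K)) \<and>
    (\<forall>x y z. h (wpow (x @ y @ z) K @ y @ wpow (x @ y @ z) K) = h (wpow (x @ y @ z) K)) \<and>
    (\<forall>u v. (u, v) \<in> tw_pairs K (Suc k) \<longrightarrow> h u = h v)"

lemma tw_satD:
  assumes "tw_sat k K h"
  shows "0 < K" "h (wpow w K @ wpow w K) = h (wpow w K)"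
    "h (wpow (x @ y @ z) K @ y @ wpow (x @ y @ z) K) = h (wpow (x @ y @ z) K)"
    "(u, v) \<in> tw_pairs K (Suc k) \<Longrightarrow> h u = h v"
  using assms unfolding tw_sat_def by blast+

lemma tw_sat_da_congruence:
  assumes "word_hom M h" "tw_sat k K h"
  shows "da_congruence (\<lambda>u v. h u = h v) K"
proof
  show "h (x @ u @ y) = h (x @ v @ y)" if "h u = h v" for u v x y
    using that by (simp add: word_homD(3)[OF assms(1)])
qed (simp_all add: tw_satD[OF assms(2)])

lemma tw_sat_rev: "tw_sat k K h \<Longrightarrow> tw_sat k K (h \<circ> rev)"
  unfolding tw_sat_def by (simp add: rev_wpow) (blast intro: tw_pairs_rev)

lemma tw_sat_comp: "tw_sat k K h \<Longrightarrow> tw_sat k K (\<lambda>u. f (h u))"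
  unfolding tw_sat_def by metis

text \<open>The quotient by \<open>sim_K\<close> is one level lower, on the L-side, where
  \<open>s\<close> and \<open>t\<close> become equal by induction applied to the opposite monoid.
  The left power of \<open>s @ p\<close> is an idempotent \<open>e\<close> such that
  \<open>e s\<close> can be continued back to \<open>e\<close>; so \<open>sim_K\<close> lifts the
  equality to \<open>e s = e t\<close>. The right power does the same for \<open>sim_D\<close> in
  the mirrored proof.\<close>

lemma TW_R_sat:
  assumes "M \<in> TW_R (Suc (Suc k))" "word_hom M h" "0 < K"
    and "\<And>w. h (wpow w K @ wpow w K) = h (wpow w K)"
  shows "tw_sat k K h"
  using assms
proof (induction k arbitrary: M h)
  case 0
  note hom = word_homD[OF "0.prems"(2)]
  have M: "finite_monoid M" using "0.prems"(1) by (rule TW_R_finite)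
  interpret monoid M using M by (simp add: finite_monoid_def)
  have triv: "x = y" if "x \<in> carrier M" "y \<in> carrier M" "green_R M x y" for x y
    using "0.prems"(1) that by (simp add: TW_R.simps[of "Suc (Suc 0)"] R_trivial_def)
  have stab: "h (x @ u) = h x" if "h (x @ u @ p) = h x" for x u p
  proof (rule triv)
    have "h (x @ u) \<otimes>\<^bsub>M\<^esub> h p = h x" "h x \<otimes>\<^bsub>M\<^esub> h u = h (x @ u)"
      using that by (simp_all flip: hom(3))
    then show "green_R M (h (x @ u)) (h x)"
      using green_R_iff[OF monoid_axioms, of "h (x @ u)" "h x"] hom(1) by blast
  qed (rule hom)+
  obtain K' where K: "K = Suc K'" using "0.prems"(3) gr0_implies_Suc by blast
  note idem = "0.prems"(4)
  have "h (wpow (x @ y @ z) K @ y @ wpow (x @ y @ z) K) = h (wpow (x @ y @ z) K)" for x y z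
  proof -
    let ?X = "wpow (x @ y @ z) K"
    have 1: "h (?X @ x) = h ?X"
      by (rule stab[of _ _ "y @ z @ wpow (x @ y @ z) K'"]) (use idem[of "x @ y @ z"] in \<open>simp add: K\<close>)
    have 2: "h (?X @ x @ y) = h ?X"
      by (rule stab[of _ _ "z @ wpow (x @ y @ z) K'"]) (use idem[of "x @ y @ z"] in \<open>simp add: K\<close>)
    have "h (?X @ y @ ?X) = h ?X \<otimes>\<^bsub>M\<^esub> h (y @ ?X)" by (simp only: hom(3))
    also have "\<dots> = h (?X @ x) \<otimes>\<^bsub>M\<^esub> h (y @ ?X)" by (simp only: 1)
    also have "\<dots> = h (?X @ x @ y) \<otimes>\<^bsub>M\<^esub> h ?X" by (simp only: append_assoc flip: hom(3))
    also have "\<dots> = h (?X @ ?X)" unfolding 2 by (rule hom(3)[symmetric])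
    also have "\<dots> = h ?X" by (rule idem)
    finally show ?thesis .
  qed
  moreover have "h u = h v" if pair: "(u, v) \<in> tw_pairs K (Suc 0)" for u v
  proof -
    obtain z z' p q s t where st: "(s, t) \<in> tw_pairs K 0"
      "u = z @ wpow (s @ p) K @ s @ wpow (q @ s) K @ z'"
      "v = z @ wpow (s @ p) K @ t @ wpow (q @ s) K @ z'"
      using pair by (rule tw_pairs_SucE)
    have "h (wpow (s @ p) K @ s) = h (wpow (s @ p) K)"
      by (rule stab[of _ _ "p @ wpow (s @ p) K'"]) (use idem[of "s @ p"] in \<open>simp add: K\<close>)
    then have "h ((z @ wpow (s @ p) K @ s) @ wpow (q @ s) K @ z')
        = h ((z @ wpow (s @ p) K) @ wpow (q @ s) K @ z')"
      by (simp only: hom(3))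
    then show ?thesis using st by simp
  qed
  ultimately show ?case using "0.prems"(3,4) unfolding tw_sat_def by blast
next
  case (Suc k)
  note hom = word_homD[OF Suc.prems(2)]
  have M: "finite_monoid M" using Suc.prems(1) by (rule TW_R_finite)
  interpret monoid M using M by (simp add: finite_monoid_def)
  note cong = sim_K_congruence[OF M]
  have eq: "equiv (carrier M) (sim_K M)" using cong by (simp add: monoid_congruence_def)
  let ?Q = "quotient_monoid M (sim_K M)"
  have "M \<in> K_malcev (TW_L (Suc (Suc k)))"
    using Suc.prems(1) by (simp add: TW_R.simps[of "Suc (Suc (Suc k))"])
  then obtain N \<phi> where N: "N \<in> TW_L (Suc (Suc k))" "\<phi> \<in> iso ?Q N"
    by (auto simp: K_malcev_def is_iso_def)
  have "monoid N" using TW_L_finite[OF N(1)] by (simp add: finite_monoid_def)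
  then have "\<phi> \<in> monoid_hom ?Q N"
    using N(2) iso_one[OF quotient_monoid_is_monoid[OF monoid_axioms cong] _ N(2)]
    by (simp add: monoid_hom_def iso_def)
  then have h': "word_hom N (\<phi> \<circ> ((\<lambda>x. sim_K M `` {x}) \<circ> h))"
    by (intro word_hom_comp[OF word_hom_comp[OF Suc.prems(2) quotient_hom[OF monoid_axioms cong]]])
  let ?h = "\<lambda>u. \<phi> (sim_K M `` {h u})"
  have "word_hom (op_monoid N) (?h \<circ> rev)" using word_hom_rev[OF h'] by (simp add: comp_def)
  moreover have "op_monoid N \<in> TW_R (Suc (Suc k))" using N(1) TW_op by blast
  moreover have "(?h \<circ> rev) (wpow w K @ wpow w K) = (?h \<circ> rev) (wpow w K)" for w
    using Suc.prems(4)[of "rev w"] by (simp add: rev_wpow)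
  ultimately have "tw_sat k K (?h \<circ> rev)" using Suc.IH Suc.prems(3) by blast
  from tw_sat_rev[OF this] have sat: "tw_sat k K ?h" by (simp add: comp_def)
  have sim: "(h u, h v) \<in> sim_K M" if "?h u = ?h v" for u v
  proof -
    have "sim_K M `` {h u} \<in> carrier ?Q" "sim_K M `` {h v} \<in> carrier ?Q"
      using hom(1) by (auto simp: quotient_monoid_def intro: quotientI)
    moreover have "inj_on \<phi> (carrier ?Q)" using N(2) by (simp add: iso_def bij_betw_def)
    ultimately have "sim_K M `` {h u} = sim_K M `` {h v}" using that by (meson inj_onD)
    then show ?thesis using eq_equiv_class[OF _ eq] hom(1) by blast
  qed
  \<comment> \<open>This is the definition of \<open>sim_K\<close> in terms of words: it lifts an
    equality from the quotient behind an idempotent to which one can return.\<close>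
  have absorb: "h (e @ u) = h (e @ v)"
    if "h (e @ e) = h e" "h (e @ u @ p) = h e" "?h u = ?h v" for e u v p
  proof -
    have "h e \<in> idempotents M" using hom(1) that(1) by (simp add: idempotents_def flip: hom(3))
    moreover have "h e \<otimes>\<^bsub>M\<^esub> h u \<otimes>\<^bsub>M\<^esub> h p = h e" using that(2) by (simp flip: hom(3))
    moreover note sim[OF that(3)] hom(1)[of p]
    ultimately have "h e \<otimes>\<^bsub>M\<^esub> h u = h e \<otimes>\<^bsub>M\<^esub> h v"
      unfolding sim_K_iff[OF monoid_axioms] by blast
    then show ?thesis by (simp only: hom(3))
  qed
  obtain K' where K: "K = Suc K'" using Suc.prems(3) gr0_implies_Suc by blast
  note idem = Suc.prems(4)
  have "h (wpow (x @ y @ z) K @ y @ wpow (x @ y @ z) K) = h (wpow (x @ y @ z) K)" for x y z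
  proof -
    let ?X = "wpow (x @ y @ z) K"
    \<comment> \<open>The DA identity holds in the quotient by induction; the idempotent placed in
      front of both sides lifts it, and is then merged with the power next to it.\<close>
    have "h (?X @ ?X) = h (?X @ (?X @ y @ ?X))"
    proof (rule absorb)
      show "h (?X @ ?X @ []) = h ?X" using idem by simp
      show "?h ?X = ?h (?X @ y @ ?X)" using tw_satD(3)[OF sat, of x y z] by simp
    qed (rule idem)
    also have "\<dots> = h ((?X @ ?X) @ y @ ?X)" by simp
    also have "\<dots> = h (?X @ y @ ?X)" unfolding hom(3)[of "?X @ ?X"] idem by (simp only: hom(3))
    finally show ?thesis using idem by simp
  qed
  moreover have "h u = h v" if pair: "(u, v) \<in> tw_pairs K (Suc (Suc k))" for u v
  proof -
    obtain z z' p q s t where st: "(s, t) \<in> tw_pairs K (Suc k)"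
      "u = z @ wpow (s @ p) K @ s @ wpow (q @ s) K @ z'"
      "v = z @ wpow (s @ p) K @ t @ wpow (q @ s) K @ z'"
      using pair by (rule tw_pairs_SucE)
    have "h (wpow (s @ p) K @ s) = h (wpow (s @ p) K @ t)"
    proof (rule absorb[OF idem _ tw_satD(4)[OF sat st(1)]])
      show "h (wpow (s @ p) K @ s @ (p @ wpow (s @ p) K')) = h (wpow (s @ p) K)"
        using idem[of "s @ p"] by (simp add: K)
    qed
    then have "h (z @ (wpow (s @ p) K @ s) @ wpow (q @ s) K @ z')
        = h (z @ (wpow (s @ p) K @ t) @ wpow (q @ s) K @ z')"
      by (simp only: hom(3))
    then show ?thesis using st by simp
  qed
  ultimately show ?case using Suc.prems(3,4) unfolding tw_sat_def by blast
qed

lemma TW_L_sat: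
  assumes "M \<in> TW_L (Suc (Suc k))" "word_hom M h" "0 < K"
    and "\<And>w. h (wpow w K @ wpow w K) = h (wpow w K)"
  shows "tw_sat k K h"
proof -
  have "op_monoid M \<in> TW_R (Suc (Suc k))" using assms(1) TW_op by blast
  then have "tw_sat k K (h \<circ> rev)"
    using word_hom_rev[OF assms(2)] assms(3)
  proof (rule TW_R_sat)
    show "(h \<circ> rev) (wpow w K @ wpow w K) = (h \<circ> rev) (wpow w K)" for w
      using assms(4)[of "rev w"] by (simp add: rev_wpow)
  qed
  from tw_sat_rev[OF this] show ?thesis by (simp add: comp_def)
qed

definition sat_class :: "'a itself \<Rightarrow> nat \<Rightarrow> nat monoid set" where
  "sat_class TYPE('a) k = {M. finite_monoid M \<and>
     (\<exists>K>0. \<forall>j>0. \<forall>h :: 'a list \<Rightarrow> nat. word_hom M h \<longrightarrow> tw_sat k (K * j) h)}"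

lemma word_exponent:
  fixes M :: "('b, 'c) monoid_scheme" (structure)
  assumes "finite_monoid M"
  shows "\<exists>K>0. \<forall>h w j. word_hom M (h :: 'a list \<Rightarrow> 'b) \<longrightarrow>
    h (wpow w (K * j) @ wpow w (K * j)) = h (wpow w (K * j))"
proof -
  interpret monoid M using assms by (simp add: finite_monoid_def)
  obtain K :: nat where K: "0 < K"
    "\<And>x. x \<in> carrier M \<Longrightarrow> x [^] K \<otimes> x [^] K = x [^] K"
    using idempotent_power[OF assms] by metis
  have "h (wpow w (K * j) @ wpow w (K * j)) = h (wpow w (K * j))" if h: "word_hom M h"
    for h :: "'a list \<Rightarrow> 'b" and w j
  proof -
    note hom = word_homD[OF h]
    let ?e = "h w [^] K"
    have e: "?e \<in> carrier M" "?e \<otimes> ?e = ?e" using K(2) hom(1) by auto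
    have "h (wpow w (K * j)) = ?e [^] j"
      using word_hom_wpow[OF monoid_axioms h] hom(1) by (simp add: nat_pow_pow)
    moreover have "?e [^] j \<otimes> ?e [^] j = (?e \<otimes> ?e) [^] j"
      by (rule pow_mult_distrib[symmetric]) (use e in auto)
    ultimately show ?thesis using e(2) by (simp add: hom(3))
  qed
  with K(1) show ?thesis by blast
qed

lemma TW_subset_sat_class:
  "TW_R (Suc (Suc k)) \<subseteq> sat_class TYPE('a) k" "TW_L (Suc (Suc k)) \<subseteq> sat_class TYPE('a) k"
proof -
  show "TW_R (Suc (Suc k)) \<subseteq> sat_class TYPE('a) k"
  proof
    fix M assume M: "M \<in> TW_R (Suc (Suc k))"
    obtain K where K: "0 < K" "\<forall>h w j. word_hom M (h :: 'a list \<Rightarrow> nat) \<longrightarrow>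
      h (wpow w (K * j) @ wpow w (K * j)) = h (wpow w (K * j))"
      using word_exponent[OF TW_R_finite[OF M], where 'a = 'a] by blast
    have "tw_sat k (K * j) h" if "word_hom M h" "0 < j" for h :: "'a list \<Rightarrow> nat" and j
      by (rule TW_R_sat[OF M that(1)]) (use K that in auto)
    then show "M \<in> sat_class TYPE('a) k" using K(1) TW_R_finite[OF M] by (auto simp: sat_class_def)
  qed
  show "TW_L (Suc (Suc k)) \<subseteq> sat_class TYPE('a) k"
  proof
    fix M assume M: "M \<in> TW_L (Suc (Suc k))"
    obtain K where K: "0 < K" "\<forall>h w j. word_hom M (h :: 'a list \<Rightarrow> nat) \<longrightarrow>
      h (wpow w (K * j) @ wpow w (K * j)) = h (wpow w (K * j))"
      using word_exponent[OF TW_L_finite[OF M], where 'a = 'a] by blast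
    have "tw_sat k (K * j) h" if "word_hom M h" "0 < j" for h :: "'a list \<Rightarrow> nat" and j
      by (rule TW_L_sat[OF M that(1)]) (use K that in auto)
    then show "M \<in> sat_class TYPE('a) k" using K(1) TW_L_finite[OF M] by (auto simp: sat_class_def)
  qed
qed

text \<open>Freeness of the word monoid: choose preimages of the letters. Identities thereby pass to
  homomorphic images.\<close>

lemma word_hom_lift:
  fixes M (structure)
  assumes M: "monoid M" and f: "f \<in> monoid_hom M N" "f ` carrier M = carrier N" and h: "word_hom N h"
  obtains h' where "word_hom M h'" "\<And>u. f (h' u) = h u"
proof -
  interpret monoid M by fact
  note hom = word_homD[OF h]
  have "\<forall>a. \<exists>x. x \<in> carrier M \<and> f x = h [a]" using hom(1) f(2) by (metis imageE)
  then obtain g where g: "\<And>a. g a \<in> carrier M" "\<And>a. f (g a) = h [a]" by metis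
  define h' where "h' u = foldr (\<lambda>a x. g a \<otimes> x) u \<one>" for u
  have cons: "h' [] = \<one>" "h' (a # u) = g a \<otimes> h' u" for a u by (simp_all add: h'_def)
  have car: "h' u \<in> carrier M" for u by (induction u) (simp_all add: cons g)
  have "h' (u @ v) = h' u \<otimes> h' v" for u v
    by (induction u) (simp_all add: cons g car m_assoc)
  then have "word_hom M h'" using car cons by (simp add: word_hom_def)
  moreover have "f (h' u) = h u" for u
  proof (induction u)
    case Nil then show ?case using f(1) hom(2) by (simp add: cons monoid_hom_def)
  next
    case (Cons a u)
    have "f (g a \<otimes> h' u) = h [a] \<otimes>\<^bsub>N\<^esub> h u"
      using f(1) g car Cons by (simp add: monoid_hom_def hom_def)
    then show ?case using hom(3)[of "[a]" u] by (simp add: cons)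
  qed
  ultimately show ?thesis using that by blast
qed

lemma variety_sat_class: "variety (sat_class TYPE('a) k)"
  unfolding variety_def
proof (intro conjI ballI allI impI)
  fix M assume "M \<in> sat_class TYPE('a) k"
  then show "finite_monoid M" by (simp add: sat_class_def)
next
  fix M H assume M: "M \<in> sat_class TYPE('a) k" and H: "submonoid H M"
  interpret monoid M using M by (simp add: sat_class_def finite_monoid_def)
  have fin: "finite_monoid (M\<lparr>carrier := H\<rparr>)"
    using submonoid.submonoid_is_monoid[OF H monoid_axioms] M finite_subset[OF submonoid.subset[OF H]]
    by (simp add: finite_monoid_def sat_class_def)
  have "word_hom M h" if "word_hom (M\<lparr>carrier := H\<rparr>) h" for h :: "'a list \<Rightarrow> nat"
    using that submonoid.subset[OF H] by (auto simp: word_hom_def)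
  then show "M\<lparr>carrier := H\<rparr> \<in> sat_class TYPE('a) k"
    using M fin unfolding sat_class_def by blast
next
  fix M N :: "nat monoid" and f assume M: "M \<in> sat_class TYPE('a) k" and f: "f \<in> monoid_hom M N"
    and N: "finite_monoid N \<and> f ` carrier M = carrier N"
  have "monoid M" using M by (simp add: sat_class_def finite_monoid_def)
  obtain K where K: "0 < K" "\<And>j h. 0 < j \<Longrightarrow> word_hom M (h :: 'a list \<Rightarrow> nat) \<Longrightarrow> tw_sat k (K * j) h"
    using M unfolding sat_class_def by blast
  have "tw_sat k (K * j) h" if j: "0 < j" and h: "word_hom N h" for j and h :: "'a list \<Rightarrow> nat"
  proof -
    obtain h' where h': "word_hom M h'" "\<And>u. f (h' u) = h u"
      using word_hom_lift[OF \<open>monoid M\<close> f _ h] N by metis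
    from tw_sat_comp[OF K(2)[OF j h'(1)], of f] show ?thesis by (simp add: h'(2))
  qed
  then show "N \<in> sat_class TYPE('a) k" using K(1) N unfolding sat_class_def by blast
next
  fix I :: "nat set" and M and N :: "nat monoid"
  assume a: "finite I \<and> (\<forall>i\<in>I. M i \<in> sat_class TYPE('a) k) \<and> finite_monoid N \<and> N \<cong> product_group I M"
  then obtain \<phi> where \<phi>: "\<phi> \<in> iso N (product_group I M)" by (auto simp: is_iso_def)
  have "\<forall>i. \<exists>K. i \<in> I \<longrightarrow> 0 < K \<and> (\<forall>j>0. \<forall>h :: 'a list \<Rightarrow> nat. word_hom (M i) h \<longrightarrow> tw_sat k (K * j) h)"
    using a unfolding sat_class_def by blast
  then obtain Ks where Ks: "\<And>i. i \<in> I \<Longrightarrow> 0 < Ks i"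
    "\<And>i j h. i \<in> I \<Longrightarrow> 0 < j \<Longrightarrow> word_hom (M i) (h :: 'a list \<Rightarrow> nat) \<Longrightarrow> tw_sat k (Ks i * j) h"
    by metis
  \<comment> \<open>A common multiple of the exponents of the factors; here the quantification over
    multiples in \<open>sat_class\<close> is used.\<close>
  define K where "K = (\<Prod>i\<in>I. Ks i)"
  have K: "0 < K" unfolding K_def using Ks(1) by (simp add: prod_pos)
  have "tw_sat k (K * j) h" if j: "0 < j" and h: "word_hom N h" for j and h :: "'a list \<Rightarrow> nat"
  proof -
    note hom = word_homD[OF h]
    define g where "g i u = \<phi> (h u) i" for i u
    have P: "\<phi> (h u) \<in> (\<Pi>\<^sub>E i\<in>I. carrier (M i))" for u
      using \<phi> hom(1) by (auto simp: iso_def hom_def)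
    have mult: "\<phi> (h (u @ v)) = (\<lambda>i\<in>I. \<phi> (h u) i \<otimes>\<^bsub>M i\<^esub> \<phi> (h v) i)" for u v
      using \<phi> hom by (simp add: iso_def hom_def)
    have inj: "h u = h v" if "\<And>i. i \<in> I \<Longrightarrow> g i u = g i v" for u v
    proof -
      have "\<phi> (h u) = \<phi> (h v)" using that P by (intro PiE_ext[of _ I]) (auto simp: g_def)
      moreover have "inj_on \<phi> (carrier N)" using \<phi> by (simp add: iso_def bij_betw_def)
      ultimately show ?thesis using hom(1) by (meson inj_onD)
    qed
    have sat: "tw_sat k (K * j) (g i)" if i: "i \<in> I" for i
    proof -
      interpret Mi: monoid "M i" using a i by (simp add: sat_class_def finite_monoid_def)
      have gm: "g i (u @ v) = g i u \<otimes>\<^bsub>M i\<^esub> g i v" for u v using mult i by (simp add: g_def)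
      have gc: "g i u \<in> carrier (M i)" for u using P[of u] i by (auto simp: g_def)
      \<comment> \<open>The isomorphism is not assumed to preserve units, so a preimage of the unit
        of the product is taken.\<close>
      have "g i [] = \<one>\<^bsub>M i\<^esub>"
      proof -
        have m: "monoid N" using a by (simp add: finite_monoid_def)
        have "\<one>\<^bsub>N\<^esub> \<in> carrier N" using m by (rule monoid.one_closed)
        have "(\<lambda>i\<in>I. \<one>\<^bsub>M i\<^esub>) \<in> carrier (product_group I M)"
          using a by (auto simp: sat_class_def finite_monoid_def monoid.one_closed)
        then have "(\<lambda>i\<in>I. \<one>\<^bsub>M i\<^esub>) \<in> \<phi> ` carrier N"
          using \<phi> by (simp add: iso_def bij_betw_def)
        then obtain x where x: "x \<in> carrier N" "\<phi> x = (\<lambda>i\<in>I. \<one>\<^bsub>M i\<^esub>)" by (metis imageE)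
        have "\<phi> (\<one>\<^bsub>N\<^esub> \<otimes>\<^bsub>N\<^esub> x) = (\<lambda>i\<in>I. \<phi> \<one>\<^bsub>N\<^esub> i \<otimes>\<^bsub>M i\<^esub> \<phi> x i)"
          using \<phi> x(1) \<open>\<one>\<^bsub>N\<^esub> \<in> carrier N\<close> unfolding iso_def hom_def mult_product_group by blast
        from fun_cong[OF this, of i]
        have "\<phi> x i = \<phi> \<one>\<^bsub>N\<^esub> i \<otimes>\<^bsub>M i\<^esub> \<phi> x i"
          using monoid.l_one[OF m x(1)] i by simp
        then have "\<one>\<^bsub>M i\<^esub> = \<phi> \<one>\<^bsub>N\<^esub> i \<otimes>\<^bsub>M i\<^esub> \<one>\<^bsub>M i\<^esub>" using x(2) i by simp
        moreover have "\<phi> \<one>\<^bsub>N\<^esub> i \<in> carrier (M i)" using gc[of "[]"] hom(2) by (simp add: g_def)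
        ultimately show ?thesis using hom(2) by (simp add: g_def)
      qed
      with gm gc have "word_hom (M i) (g i)" by (simp add: word_hom_def)
      moreover obtain l where "K = Ks i * l" unfolding K_def using dvd_prodI[of I i Ks] a i by (metis dvdE)
      moreover have "0 < l" using calculation(2) K by (cases l) auto
      ultimately show ?thesis using Ks(2)[OF i, of "l * j" "g i"] j by (simp add: mult.assoc)
    qed
    show ?thesis unfolding tw_sat_def
    proof (intro conjI allI impI)
      show "0 < K * j" using K j by simp
      show "h (wpow w (K * j) @ wpow w (K * j)) = h (wpow w (K * j))" for w
        by (rule inj) (rule tw_satD(2)[OF sat])
      show "h (wpow (x @ y @ z) (K * j) @ y @ wpow (x @ y @ z) (K * j)) = h (wpow (x @ y @ z) (K * j))"
        for x y z by (rule inj) (rule tw_satD(3)[OF sat])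
      show "h u = h v" if "(u, v) \<in> tw_pairs (K * j) (Suc k)" for u v
        by (rule inj) (rule tw_satD(4)[OF sat that])
    qed
  qed
  then show "N \<in> sat_class TYPE('a) k" using K a unfolding sat_class_def by blast
qed

lemma join_sat:
  assumes "M \<in> variety_join (TW_R (Suc (Suc k))) (TW_L (Suc (Suc k)))"
  shows "M \<in> sat_class TYPE('a) k"
  using assms variety_sat_class[where 'a = 'a] TW_subset_sat_class[where 'a = 'a]
  unfolding variety_join_def by blast

text \<open>
  First-occurrence jumps that start to the left of a power of \<open>w\<close> consume at most one copy of
  \<open>w\<close> each, as long as everything to the right uses only letters of \<open>w\<close>.
\<close>

lemma rsim_pump:
  assumes "\<And>i j. j \<le> i \<Longrightarrow> j \<le> n \<Longrightarrow> rsim m j (rev (wpow w i @ u)) (rev (wpow w i @ v))"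
    and uv: "set u \<subseteq> set w" "set v \<subseteq> set w"
  shows "j \<le> i \<Longrightarrow> j \<le> n \<Longrightarrow> rsim (Suc m) j (x @ wpow w i @ u) (x @ wpow w i @ v)"
proof (induction j arbitrary: i x)
  case (Suc j)
  then obtain i' where i: "i = Suc i'" "j \<le> i'" by (cases i) auto
  show ?case
  proof (rule rsim_SucI)
    show "rsim m (Suc j) (rev (x @ wpow w i @ u)) (rev (x @ wpow w i @ v))"
      using rsim_append[OF assms(1)[of "Suc j" i], of "[]" "rev x"] Suc.prems by simp
    show "set (x @ wpow w i @ u) = set (x @ wpow w i @ v)"
      using uv i by (auto simp: set_wpow)
  next
    fix a u0 u1 v0 v1
    assume a: "x @ wpow w i @ u = u0 @ a # u1" "x @ wpow w i @ v = v0 @ a # v1" "a \<notin> set u0" "a \<notin> set v0"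
    show "rsim m j (rev u0) (rev v0) \<and> rsim (Suc m) j u1 v1"
    proof (cases "a \<in> set x")
      case True
      then obtain x0 x1 where x: "x = x0 @ a # x1" "a \<notin> set x0" by (meson split_list_first)
      have "u0 = x0" "u1 = x1 @ wpow w i @ u" "v0 = x0" "v1 = x1 @ wpow w i @ v"
        using a x first_split[of a u0 u1] first_split[of a x0 "x1 @ wpow w i @ u"]
          first_split[of a v0 v1] first_split[of a x0 "x1 @ wpow w i @ v"] by auto
      then show ?thesis using Suc by simp
    next
      case False
      have "a \<in> set (x @ wpow w i @ u)" unfolding a(1) by simp
      then have "a \<in> set w" using False uv(1) i by (auto simp: set_wpow split: if_splits)
      then obtain w0 w1 where w: "w = w0 @ a # w1" "a \<notin> set w0" by (meson split_list_first)
      have eq: "x @ wpow w i @ y = (x @ w0) @ a # (w1 @ wpow w i' @ y)" for y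
        unfolding i(1) wpow_simps(2) by (subst w(1)) simp
      have "a \<notin> set (x @ w0)" using w False by simp
      then have "u0 = x @ w0" "u1 = w1 @ wpow w i' @ u" "v0 = x @ w0" "v1 = w1 @ wpow w i' @ v"
        using a first_split[of a u0 u1] first_split[of a "x @ w0" "w1 @ wpow w i' @ u"]
          first_split[of a v0 v1] first_split[of a "x @ w0" "w1 @ wpow w i' @ v"]
        unfolding eq by auto
      then show ?thesis using Suc i by simp
    qed
  qed
qed simp

text \<open>At level 1 nothing is remembered about the part that a jump skips. A jump to a letter of
  \<open>w\<close> ends within the first copy of \<open>w\<close>, so \<open>i\<close> copies hide
  the difference between \<open>u\<close> and \<open>v\<close> from \<open>i\<close> jumps.\<close>

lemma rsim_1_absorb:
  assumes "set u \<subseteq> set w" "set v \<subseteq> set w" "j \<le> i"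
  shows "rsim (Suc 0) j (u @ wpow w i @ z) (v @ wpow w i @ z)"
  using assms
proof (induction j arbitrary: i u v z)
  case (Suc j)
  then obtain i' where i: "i = Suc i'" "j \<le> i'" by (cases i) auto
  show ?case
  proof (rule rsim_SucI)
    show "set (u @ wpow w i @ z) = set (v @ wpow w i @ z)"
      using Suc.prems(1,2) i by (auto simp: set_wpow)
  next
    fix a u0 u1 v0 v1
    assume a: "u @ wpow w i @ z = u0 @ a # u1" "v @ wpow w i @ z = v0 @ a # v1" "a \<notin> set u0" "a \<notin> set v0"
    have "rsim (Suc 0) j u1 v1"
    proof (cases "a \<in> set w")
      case True
      then have "a \<in> set (u @ w)" "a \<in> set (v @ w)" by auto
      then obtain p q p' q' where pq: "u @ w = p @ a # q" "a \<notin> set p" "v @ w = p' @ a # q'" "a \<notin> set p'"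
        by (metis split_list_first)
      have eq: "u @ wpow w i @ z = p @ a # (q @ wpow w i' @ z)" "v @ wpow w i @ z = p' @ a # (q' @ wpow w i' @ z)"
        using arg_cong[OF pq(1), of "\<lambda>y. y @ wpow w i' @ z"] arg_cong[OF pq(3), of "\<lambda>y. y @ wpow w i' @ z"]
        by (simp_all add: i(1))
      have "u1 = q @ wpow w i' @ z" "v1 = q' @ wpow w i' @ z"
        using first_split(2)[OF a(3), of u1] first_split(2)[OF pq(2)]
          first_split(2)[OF a(4), of v1] first_split(2)[OF pq(4)]
        unfolding a(1,2)[symmetric] eq by simp_all
      moreover have "set q \<subseteq> set (u @ w)" "set q' \<subseteq> set (v @ w)" unfolding pq by auto
      then have "set q \<subseteq> set w" "set q' \<subseteq> set w" using Suc.prems(1,2) by auto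
      ultimately show ?thesis using Suc.IH[of q q' i' z] i(2) by simp
    next
      case False
      then have n: "a \<notin> set (u @ wpow w i)" "a \<notin> set (v @ wpow w i)"
        using Suc.prems(1,2) by (auto simp: set_wpow split: if_splits)
      have "a \<in> set (u @ wpow w i @ z)" unfolding a(1) by simp
      then have "a \<in> set z" using n by auto
      then obtain z0 z1 where z: "z = z0 @ a # z1" "a \<notin> set z0" by (meson split_list_first)
      have "a \<notin> set (u @ wpow w i @ z0)" "a \<notin> set (v @ wpow w i @ z0)" using n z(2) by auto
      note this[THEN first_split(2), of z1]
      then have "u1 = z1" "v1 = z1"
        using first_split(2)[OF a(3), of u1] first_split(2)[OF a(4), of v1]
        unfolding a(1,2)[symmetric] z(1) by simp_all
      then show ?thesis by simp
    qed
    then show "rsim 0 j (rev u0) (rev v0) \<and> rsim (Suc 0) j u1 v1" by simp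
  qed simp
qed simp

lemma rsim_2_pump:
  assumes "set u \<subseteq> set w" "set v \<subseteq> set w"
  shows "rsim (Suc (Suc 0)) n (x @ wpow w n @ u) (x @ wpow w n @ v)"
proof (rule rsim_pump[where n = n, OF _ assms])
  show "rsim (Suc 0) j (rev (wpow w i @ u)) (rev (wpow w i @ v))" if "j \<le> i" for i j
    using rsim_1_absorb[of "rev u" "rev w" "rev v" j i "[]"] assms that by (simp add: rev_wpow)
qed simp_all

text \<open>The copies of \<open>w\<close> keep forward jumps away from \<open>u\<close> and
  \<open>v\<close>. Only the reversed comparison one level lower reaches them, and there they agree
  by assumption. This is the word form of the passage from \<open>L\<^sub>m\<close> to
  \<open>R\<^sub>m\<^sub>+\<^sub>1\<close>.\<close>

lemma rsim_Suc_pump: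
  assumes "rsim m n (rev u) (rev v)" "set u \<subseteq> set w" "set v \<subseteq> set w"
  shows "rsim (Suc m) n (x @ wpow w n @ u) (x @ wpow w n @ v)"
proof (rule rsim_pump[where n = n, OF _ assms(2,3)])
  show "rsim m j (rev (wpow w i @ u)) (rev (wpow w i @ v))" if "j \<le> n" for i j
    using rsim_append[OF rsim_depth_mono[OF that assms(1)], of "[]" "rev (wpow w i)"] by simp
qed simp_all

text \<open>Stated for every monoid on which the congruence is trivial, so that the induction can
  pass to the quotient by \<open>sim_K\<close>, read from the right. Positive depth ensures that
  related words have the same letters, as pumping requires.\<close>

lemma TW_R_of_rsim:
  fixes N :: "nat monoid" and h :: "'a list \<Rightarrow> nat"
  assumes "0 < n" "finite_monoid N" "word_hom N h" "carrier N \<subseteq> h ` lists A"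
    and "\<And>u v. u \<in> lists A \<Longrightarrow> v \<in> lists A \<Longrightarrow> rsim (Suc (Suc k)) n u v \<Longrightarrow> h u = h v"
  shows "N \<in> TW_R (Suc (Suc k))"
  using assms
proof (induction k arbitrary: N h)
  case 0
  note hom = word_homD[OF "0.prems"(3)]
  interpret monoid N using "0.prems"(2) by (simp add: finite_monoid_def)
  have "x = y" if x: "x \<in> carrier N" and y: "y \<in> carrier N" and R: "green_R N x y" for x y
  proof -
    obtain p q where pq: "p \<in> carrier N" "x \<otimes>\<^bsub>N\<^esub> p = y" "q \<in> carrier N" "y \<otimes>\<^bsub>N\<^esub> q = x"
      using R green_R_iff[OF monoid_axioms x y] by blast
    obtain u u' v' where u: "u \<in> lists A" "x = h u" and u': "u' \<in> lists A" "p = h u'"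
      and v': "v' \<in> lists A" "q = h v'"
      using "0.prems"(4) x pq by (meson imageE subsetD)
    \<comment> \<open>\<open>?w\<close> leads from \<open>x\<close> to \<open>y\<close> and back, so
      \<open>n\<close> copies of it can be inserted after \<open>u\<close>; behind them
      \<open>u'\<close> cannot be told from the empty word.\<close>
    let ?w = "u' @ v'"
    have 1: "h (u @ wpow ?w i) = h u" for i
    proof (induction i)
      case (Suc i)
      have "h (u @ wpow ?w (Suc i)) = (x \<otimes>\<^bsub>N\<^esub> p) \<otimes>\<^bsub>N\<^esub> q \<otimes>\<^bsub>N\<^esub> h (wpow ?w i)"
        using hom u u' v' by (simp add: m_assoc)
      also have "\<dots> = h (u @ wpow ?w i)" using pq u by (simp add: hom(3))
      finally show ?case using Suc by simp
    qed simp
    have "h (u @ wpow ?w n @ u') = h (u @ wpow ?w n @ [])"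
    proof (rule "0.prems"(5))
      show "rsim (Suc (Suc 0)) n (u @ wpow ?w n @ u') (u @ wpow ?w n @ [])"
        by (rule rsim_2_pump) auto
    qed (use u u' v' in \<open>auto simp: set_wpow in_lists_conv_set split: if_splits\<close>)
    then have "h (u @ wpow ?w n) \<otimes>\<^bsub>N\<^esub> h u' = h (u @ wpow ?w n)" by (simp add: hom(3) flip: append_assoc)
    then show ?thesis using 1 pq u u' by simp
  qed
  then show ?case using "0.prems"(2) by (simp add: TW_R.simps[of "Suc (Suc 0)"] R_trivial_def)
next
  case (Suc k)
  note hom = word_homD[OF Suc.prems(3)]
  note N = Suc.prems(2)
  interpret monoid N using N by (simp add: finite_monoid_def)
  note cong = sim_K_congruence[OF N]
  have eq: "equiv (carrier N) (sim_K N)" using cong by (simp add: monoid_congruence_def)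
  let ?Q = "quotient_monoid N (sim_K N)"
  obtain N' :: "nat monoid" and \<phi> where N': "finite_monoid N'" "\<phi> \<in> iso ?Q N'" "\<phi> \<one>\<^bsub>?Q\<^esub> = \<one>\<^bsub>N'\<^esub>"
    using nat_copy[OF quotient_finite_monoid[OF N cong]] by metis
  \<comment> \<open>As \<open>u q\<close> fixes \<open>w\<close>, copies of it can be inserted, and
    these make the exchange of \<open>u\<close> and \<open>v\<close> invisible at the next
    level.\<close>
  have pump: "h (w @ u) = h (w @ v)"
    if lists: "u \<in> lists A" "v \<in> lists A" "w \<in> lists A" "q \<in> lists A"
      and sim: "rsim (Suc (Suc k)) n (rev u) (rev v)" and stab: "h (w @ u @ q) = h w" for u v w q
  proof -
    let ?z = "u @ q"
    have 1: "h (w @ wpow ?z i) = h w" for i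
    proof (induction i)
      case (Suc i)
      have "h ((w @ u @ q) @ wpow ?z i) = h (w @ wpow ?z i)"
        unfolding hom(3)[of "w @ u @ q"] stab by (rule hom(3)[symmetric])
      then show ?case using Suc by simp
    qed simp
    have "set u = set v" using sim Suc.prems(1) rsim_set[of "Suc k" "n - 1" "rev u" "rev v"] by simp
    then have "rsim (Suc (Suc (Suc k))) n (w @ wpow ?z n @ u) (w @ wpow ?z n @ v)"
      by (intro rsim_Suc_pump[OF sim]) auto
    then have "h (w @ wpow ?z n @ u) = h (w @ wpow ?z n @ v)"
      by (rule Suc.prems(5)[rotated -1])
        (use lists in \<open>auto simp: set_wpow in_lists_conv_set split: if_splits\<close>)
    then have "h (w @ wpow ?z n) \<otimes>\<^bsub>N\<^esub> h u = h (w @ wpow ?z n) \<otimes>\<^bsub>N\<^esub> h v"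
      by (simp only: hom(3)[symmetric] append_assoc)
    then show ?thesis unfolding 1 by (simp add: hom(3))
  qed
  have sim: "(h u, h v) \<in> sim_K N"
    if uv: "u \<in> lists A" "v \<in> lists A" "rsim (Suc (Suc k)) n (rev u) (rev v)" for u v
    unfolding sim_K_iff[OF monoid_axioms]
  proof (intro conjI ballI impI hom(1))
    fix e assume e: "e \<in> idempotents N" and "(\<exists>p\<in>carrier N. e \<otimes>\<^bsub>N\<^esub> h u \<otimes>\<^bsub>N\<^esub> p = e) \<or>
      (\<exists>p\<in>carrier N. e \<otimes>\<^bsub>N\<^esub> h v \<otimes>\<^bsub>N\<^esub> p = e)"
    then obtain p where p: "p \<in> carrier N" "e \<otimes>\<^bsub>N\<^esub> h u \<otimes>\<^bsub>N\<^esub> p = e \<or> e \<otimes>\<^bsub>N\<^esub> h v \<otimes>\<^bsub>N\<^esub> p = e" by blast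
    have "e \<in> carrier N" using e by (simp add: idempotents_def)
    then obtain w q where w: "w \<in> lists A" "e = h w" and q: "q \<in> lists A" "p = h q"
      using Suc.prems(4) p(1) by (meson imageE subsetD)
    have "h (w @ u @ q) = h w \<or> h (w @ v @ q) = h w"
      using p(2) by (simp add: w q hom(3) hom(1) m_assoc)
    then have "h (w @ u) = h (w @ v)"
      using pump[of u v w q] pump[of v u w q] uv w q rsim_sym[OF uv(3)] by auto
    then show "e \<otimes>\<^bsub>N\<^esub> h u = e \<otimes>\<^bsub>N\<^esub> h v" by (simp add: w hom(3))
  qed
  have "\<phi> \<in> monoid_hom ?Q N'" using N' by (simp add: monoid_hom_def iso_def)
  then have h': "word_hom N' (\<phi> \<circ> ((\<lambda>x. sim_K N `` {x}) \<circ> h))"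
    by (intro word_hom_comp[OF word_hom_comp[OF Suc.prems(3) quotient_hom[OF monoid_axioms cong]]])
  \<comment> \<open>Words are read backwards into the opposite of the quotient, since the reversed
    words are the ones compared one level lower.\<close>
  let ?h = "\<lambda>u. \<phi> (sim_K N `` {h (rev u)})"
  have "op_monoid N' \<in> TW_R (Suc (Suc k))"
  proof (rule Suc.IH[OF Suc.prems(1)])
    show "finite_monoid (op_monoid N')" using N'(1) by simp
    show "word_hom (op_monoid N') ?h" using word_hom_rev[OF h'] by (simp add: comp_def)
    show "carrier (op_monoid N') \<subseteq> ?h ` lists A"
    proof
      fix y assume "y \<in> carrier (op_monoid N')"
      then have "y \<in> \<phi> ` carrier ?Q" using N'(2) by (simp add: iso_def bij_betw_def)
      then obtain x where x: "x \<in> carrier N" "y = \<phi> (sim_K N `` {x})"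
        by (auto simp: quotient_monoid_def quotient_def)
      then obtain u where "u \<in> lists A" "x = h u" using Suc.prems(4) by (meson imageE subsetD)
      then show "y \<in> ?h ` lists A" using x by (intro image_eqI[of _ _ "rev u"]) auto
    qed
    show "?h u = ?h v" if "u \<in> lists A" "v \<in> lists A" "rsim (Suc (Suc k)) n u v" for u v
      using sim[of "rev u" "rev v"] that equiv_class_eq[OF eq] by simp
  qed
  then have "N' \<in> TW_L (Suc (Suc k))" using TW_op by blast
  moreover have "?Q \<cong> N'" using N'(2) unfolding is_iso_def by blast
  ultimately show ?case using N
    by (auto simp: TW_R.simps[of "Suc (Suc (Suc k))"] K_malcev_def)
qed

section \<open>Recognizing monoids built from the word congruences\<close>

lemma finite_image_factor:
  assumes "finite (g ` S)" "\<And>u v. u \<in> S \<Longrightarrow> v \<in> S \<Longrightarrow> g u = g v \<Longrightarrow> f u = f v"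
  shows "finite (f ` S)"
proof -
  have "f ` S \<subseteq> (\<lambda>x. f (inv_into S g x)) ` g ` S"
  proof (rule image_subsetI)
    fix u assume u: "u \<in> S"
    have "f (inv_into S g (g u)) = f u"
      using u by (intro assms(2) inv_into_into f_inv_into_f) auto
    then show "f u \<in> (\<lambda>x. f (inv_into S g x)) ` g ` S" using u by (metis image_eqI)
  qed
  then show ?thesis using assms(1) finite_subset by blast
qed

lemma rsim_recognizer:
  fixes A :: "'a set"
  assumes A: "finite A" and n: "0 < n"
  obtains N :: "nat monoid" and h :: "'a list \<Rightarrow> nat" where
    "N \<in> TW_R (Suc (Suc k))" "word_hom N h"
    "\<And>u v. u \<in> lists A \<Longrightarrow> v \<in> lists A \<Longrightarrow> h u = h v \<Longrightarrow> rsim (Suc (Suc k)) n u v"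
proof -
  let ?T = "rsim (Suc (Suc k)) n"
  define r where "r = {(u, v). u \<in> lists A \<and> v \<in> lists A \<and> ?T u v}"
  let ?F = "free_monoid A"
  let ?Q = "quotient_monoid ?F r"
  have mF: "monoid ?F" by (rule monoidI) (auto simp: free_monoid_def)
  have eq: "equiv (lists A) r"
  proof (rule equivI)
    show "r \<subseteq> lists A \<times> lists A" by (auto simp: r_def)
    show "refl_on (lists A) r" by (rule refl_onI) (auto simp: r_def)
    show "sym r" by (rule symI) (auto simp: r_def intro: rsim_sym)
    show "Relation.trans r" by (rule transI) (auto simp: r_def intro: rsim_trans)
  qed
  have cong: "monoid_congruence ?F r"
    unfolding monoid_congruence_def using eq by (auto simp: free_monoid_def r_def intro: rsim_mult)
  obtain g :: "'a list \<Rightarrow> nat" where g: "finite (g ` lists A)"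
    "\<forall>u\<in>lists A. \<forall>v\<in>lists A. g u = g v \<longrightarrow> ?T u v"
    using rsim_finite_index[OF A] by metis
  have "finite ((\<lambda>u. r `` {u}) ` lists A)"
  proof (rule finite_image_factor[OF g(1)])
    fix u v assume "u \<in> lists A" "v \<in> lists A" "g u = g v"
    then have "(u, v) \<in> r" using g(2) by (simp add: r_def)
    then show "r `` {u} = r `` {v}" by (rule equiv_class_eq[OF eq])
  qed
  moreover have car: "carrier ?Q = (\<lambda>u. r `` {u}) ` lists A"
    by (auto simp: quotient_monoid_def quotient_def free_monoid_def)
  ultimately have "finite_monoid ?Q"
    using quotient_monoid_is_monoid[OF mF cong] by (simp add: finite_monoid_def)
  then obtain N :: "nat monoid" and \<phi> where N: "finite_monoid N" "\<phi> \<in> iso ?Q N" "\<phi> \<one>\<^bsub>?Q\<^esub> = \<one>\<^bsub>N\<^esub>"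
    using nat_copy by metis
  have "word_hom ?F (filter (\<lambda>a. a \<in> A))" by (auto simp: word_hom_def free_monoid_def)
  moreover have "\<phi> \<in> monoid_hom ?Q N" using N by (simp add: monoid_hom_def iso_def)
  ultimately have hom: "word_hom N (\<phi> \<circ> ((\<lambda>x. r `` {x}) \<circ> filter (\<lambda>a. a \<in> A)))"
    by (intro word_hom_comp[OF word_hom_comp[OF _ quotient_hom[OF mF cong]]])
  let ?h = "\<lambda>u. \<phi> (r `` {filter (\<lambda>a. a \<in> A) u})"
  have h: "word_hom N ?h" using hom by (simp add: comp_def)
  have fil: "filter (\<lambda>a. a \<in> A) u = u" if "u \<in> lists A" for u
    using that by (simp add: in_lists_conv_set)
  have "N \<in> TW_R (Suc (Suc k))"
  proof (rule TW_R_of_rsim[OF n N(1) h])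
    show "carrier N \<subseteq> ?h ` lists A"
    proof
      fix y assume "y \<in> carrier N"
      then have "y \<in> \<phi> ` carrier ?Q" using N(2) by (simp add: iso_def bij_betw_def)
      then obtain u where "u \<in> lists A" "y = \<phi> (r `` {u})" unfolding car by blast
      then show "y \<in> ?h ` lists A" using fil by (intro image_eqI[of _ _ u]) auto
    qed
    show "?h u = ?h v" if "u \<in> lists A" "v \<in> lists A" "?T u v" for u v
      using that fil equiv_class_eq[OF eq, of u v] by (simp add: r_def)
  qed
  moreover have "?T u v" if "u \<in> lists A" "v \<in> lists A" "?h u = ?h v" for u v
  proof -
    have "r `` {u} \<in> carrier ?Q" "r `` {v} \<in> carrier ?Q" using that(1,2) by (auto simp: car)
    moreover have "inj_on \<phi> (carrier ?Q)" using N(2) by (simp add: iso_def bij_betw_def)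
    moreover have "\<phi> (r `` {u}) = \<phi> (r `` {v})" using that fil by simp
    ultimately have "r `` {u} = r `` {v}" by (meson inj_onD)
    then show ?thesis using eq_equiv_class[OF _ eq that(2)] by (simp add: r_def)
  qed
  ultimately show ?thesis using h by (intro that[of N ?h])
qed

lemma monoid_product_group:
  assumes "\<And>i. i \<in> I \<Longrightarrow> monoid (G i)"
  shows "monoid (product_group I G)"
proof (rule monoidI)
  fix x y z
  assume "x \<in> carrier (product_group I G)" "y \<in> carrier (product_group I G)"
    "z \<in> carrier (product_group I G)"
  then show "(x \<otimes>\<^bsub>product_group I G\<^esub> y) \<otimes>\<^bsub>product_group I G\<^esub> z =
      x \<otimes>\<^bsub>product_group I G\<^esub> (y \<otimes>\<^bsub>product_group I G\<^esub> z)"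
    using assms by (auto simp: monoid.m_assoc PiE_iff intro!: restrict_ext)
next
  fix x assume "x \<in> carrier (product_group I G)"
  then show "\<one>\<^bsub>product_group I G\<^esub> \<otimes>\<^bsub>product_group I G\<^esub> x = x"
    "x \<otimes>\<^bsub>product_group I G\<^esub> \<one>\<^bsub>product_group I G\<^esub> = x"
    using assms by (auto simp: monoid.l_one monoid.r_one PiE_iff fun_eq_iff extensional_def)
qed (use assms in \<open>auto simp: PiE_iff monoid.m_closed monoid.one_closed\<close>)

text \<open>The quotient by \<open>rsim\<close> and its opposite, read backwards, record the two
  halves of \<open>lrsim\<close>; their product lies in the join. Depth \<open>Suc n\<close> is
  taken because \<open>rsim_recognizer\<close> needs a positive depth.\<close>

lemma lrsim_recognizer:
  fixes A :: "'a set"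
  assumes A: "finite A" and L: "L \<subseteq> lists A"
    and sat: "\<And>u v. u \<in> L \<Longrightarrow> v \<in> lists A \<Longrightarrow> lrsim (Suc (Suc k)) n u v \<Longrightarrow> v \<in> L"
  shows "\<exists>M\<in>variety_join (TW_R (Suc (Suc k))) (TW_L (Suc (Suc k))). recognizes M A L"
proof -
  let ?V = "TW_R (Suc (Suc k))" and ?W = "TW_L (Suc (Suc k))"
  obtain N1 :: "nat monoid" and h1 :: "'a list \<Rightarrow> nat" where N1: "N1 \<in> ?V" "word_hom N1 h1"
    "\<And>u v. u \<in> lists A \<Longrightarrow> v \<in> lists A \<Longrightarrow> h1 u = h1 v \<Longrightarrow> rsim (Suc (Suc k)) (Suc n) u v"
    using rsim_recognizer[OF A, of "Suc n" k] by (metis zero_less_Suc)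
  define N2 where "N2 = op_monoid N1"
  define h2 where "h2 = h1 \<circ> rev"
  have N2: "N2 \<in> ?W" "word_hom N2 h2" using N1 TW_op word_hom_rev by (auto simp: N2_def h2_def)
  define G where "G i = (if i = 0 then N1 else N2)" for i :: nat
  have fin: "finite_monoid (G i)" for i
    using TW_R_finite[OF N1(1)] TW_L_finite[OF N2(1)] by (simp add: G_def)
  let ?P = "product_group {0, 1 :: nat} G"
  have "finite_monoid ?P"
    using monoid_product_group[of "{0, 1}" G] fin by (simp add: finite_monoid_def finite_PiE)
  then obtain N :: "nat monoid" and \<phi> where N: "finite_monoid N" "\<phi> \<in> iso ?P N" "N \<cong> ?P" "\<phi> \<one>\<^bsub>?P\<^esub> = \<one>\<^bsub>N\<^esub>"
    using nat_copy by metis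
  have "N \<in> variety_join ?V ?W"
    unfolding variety_join_def
  proof (rule InterI)
    fix U assume "U \<in> {U. variety U \<and> ?V \<subseteq> U \<and> ?W \<subseteq> U}"
    then have U: "variety U" "?V \<subseteq> U" "?W \<subseteq> U" by auto
    have "G i \<in> U" for i using U N1(1) N2(1) by (auto simp: G_def)
    then show "N \<in> U" using U(1) N(1,3) unfolding variety_def by (metis finite.emptyI finite_insert)
  qed
  moreover have "recognizes N A L"
  proof -
    define f where "f u = (\<lambda>i\<in>{0, 1 :: nat}. if i = 0 then h1 u else h2 u)" for u
    have "word_hom ?P f"
      using word_homD[OF N1(2)] word_homD[OF N2(2)]
      by (auto simp: word_hom_def f_def G_def fun_eq_iff)
    moreover have "\<phi> \<in> monoid_hom ?P N" using N by (simp add: monoid_hom_def iso_def)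
    ultimately have h: "word_hom N (\<phi> \<circ> f)" by (rule word_hom_comp)
    then have "\<phi> \<circ> f \<in> monoid_hom (free_monoid A) N"
      by (auto simp: monoid_hom_def hom_def free_monoid_def word_hom_def)
    moreover have "v \<in> L" if "v \<in> lists A" "u \<in> L" "(\<phi> \<circ> f) v = (\<phi> \<circ> f) u" for u v
    proof -
      have "f u \<in> carrier ?P" "f v \<in> carrier ?P" using \<open>word_hom ?P f\<close> by (simp_all add: word_hom_def)
      moreover have "inj_on \<phi> (carrier ?P)" using N(2) by (simp add: iso_def bij_betw_def)
      ultimately have "f u = f v" using that(3) by (metis comp_apply inj_onD)
      then have "f u 0 = f v 0" "f u 1 = f v 1" by simp_all
      then have "h1 u = h1 v" "h1 (rev u) = h1 (rev v)" by (simp_all add: f_def h2_def)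
      then have "lrsim (Suc (Suc k)) (Suc n) u v"
        unfolding lrsim_def using N1(3) that L by (metis rev_lists subsetD)
      then show ?thesis using sat[OF that(2,1)] lrsim_depth_mono by (metis le_SucI order_refl)
    qed
    ultimately show ?thesis unfolding recognizes_def using L by blast
  qed
  ultimately show ?thesis by blast
qed

section \<open>The equivalence, and regular languages\<close>

lemma definable_of_congruence:
  assumes A: "finite A" and L: "L \<subseteq> lists A"
    and "da_congruence \<theta> K" "finite (range (\<lambda>w. Collect (\<theta> w)))"
    and "\<And>u v. (u, v) \<in> tw_pairs K (Suc k) \<Longrightarrow> \<theta> u v"
    and sat: "\<And>u v. u \<in> L \<Longrightarrow> v \<in> lists A \<Longrightarrow> \<theta> u v \<Longrightarrow> v \<in> L"
  shows "itl_definable A (Suc (Suc k)) L"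
proof -
  obtain n where n: "\<forall>u v. lrsim (Suc (Suc k)) n u v \<longrightarrow> \<theta> u v"
    using lrsim_refines[OF assms(3-5)] by blast
  show ?thesis
    by (rule definable_if_lrsim_saturated[OF A L, of _ n]) (use n sat in blast)
qed

lemma recognizes_word_hom:
  assumes "finite_monoid M" "recognizes M A L"
  obtains h where "word_hom M h" "\<And>u v. u \<in> L \<Longrightarrow> v \<in> lists A \<Longrightarrow> h u = h v \<Longrightarrow> v \<in> L"
proof -
  interpret monoid M using assms(1) by (simp add: finite_monoid_def)
  obtain h where h: "h \<in> monoid_hom (free_monoid A) M" "{u \<in> lists A. h u \<in> h ` L} = L"
    using assms(2) unfolding recognizes_def by blast
  define h' where "h' u = h (filter (\<lambda>a. a \<in> A) u)" for u
  have fil: "filter (\<lambda>a. a \<in> A) u \<in> lists A" for u by auto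
  have "word_hom M h'"
    using h(1) fil by (auto simp: word_hom_def h'_def monoid_hom_def hom_def free_monoid_def)
  moreover have "h' u = h u" if "u \<in> lists A" for u
    using that by (simp add: h'_def in_lists_conv_set)
  then have "v \<in> L" if "u \<in> L" "v \<in> lists A" "h' u = h' v" for u v
  proof -
    have "u \<in> lists A" using that(1) h(2) by blast
    then have "h v = h u" using that \<open>\<And>u. u \<in> lists A \<Longrightarrow> h' u = h u\<close> by metis
    then show ?thesis using that(1,2) h(2) by blast
  qed
  ultimately show ?thesis by (rule that)
qed

lemma recognized_sat:
  fixes L :: "'a list set"
  assumes "M \<in> variety_join (TW_R (Suc (Suc k))) (TW_L (Suc (Suc k)))" "recognizes M A L"
  obtains h :: "'a list \<Rightarrow> nat" and K where "word_hom M h" "finite (range h)" "0 < K"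
    "\<And>j. 0 < j \<Longrightarrow> tw_sat k (K * j) h"
    "\<And>u v. u \<in> L \<Longrightarrow> v \<in> lists A \<Longrightarrow> h u = h v \<Longrightarrow> v \<in> L"
proof -
  have M: "M \<in> sat_class TYPE('a) k" using assms(1) by (rule join_sat)
  then have fin: "finite_monoid M" by (simp add: sat_class_def)
  obtain K where K: "0 < K" "\<forall>j>0. \<forall>h :: 'a list \<Rightarrow> nat. word_hom M h \<longrightarrow> tw_sat k (K * j) h"
    using M unfolding sat_class_def by blast
  obtain h where h: "word_hom M h" "\<And>u v. u \<in> L \<Longrightarrow> v \<in> lists A \<Longrightarrow> h u = h v \<Longrightarrow> v \<in> L"
    using recognizes_word_hom[OF fin assms(2)] by metis
  have "finite (range h)"
    by (rule finite_subset[of _ "carrier M"]) (use fin word_homD(1)[OF h(1)] in \<open>auto simp: finite_monoid_def\<close>)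
  with K h that show ?thesis by blast
qed

theorem definable_iff_recognized:
  assumes A: "finite A" and L: "L \<subseteq> lists A"
  shows "itl_definable A (Suc (Suc k)) L \<longleftrightarrow>
    (\<exists>M\<in>variety_join (TW_R (Suc (Suc k))) (TW_L (Suc (Suc k))). recognizes M A L)"
proof
  assume "itl_definable A (Suc (Suc k)) L"
  then obtain \<phi> where \<phi>: "\<phi> \<in> ITL A (Suc (Suc k))" "L = {u \<in> lists A. models u \<phi>}"
    unfolding itl_definable_def by blast
  then obtain n where "\<forall>u v. lrsim (Suc (Suc k)) n u v \<longrightarrow> (models u \<phi> \<longleftrightarrow> models v \<phi>)"
    using models_lrsim_invariant[of \<phi> "Suc (Suc k)"] by (auto simp: ITL_def)
  then show "\<exists>M\<in>variety_join (TW_R (Suc (Suc k))) (TW_L (Suc (Suc k))). recognizes M A L"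
    by (intro lrsim_recognizer[OF A L, of k n]) (use \<phi>(2) in blast)
next
  assume "\<exists>M\<in>variety_join (TW_R (Suc (Suc k))) (TW_L (Suc (Suc k))). recognizes M A L"
  then obtain M where M: "M \<in> variety_join (TW_R (Suc (Suc k))) (TW_L (Suc (Suc k)))" "recognizes M A L"
    by blast
  obtain h :: "'a list \<Rightarrow> nat" and K where h: "word_hom M h" "finite (range h)" "0 < K"
    "\<And>j. 0 < j \<Longrightarrow> tw_sat k (K * j) h"
    "\<And>u v. u \<in> L \<Longrightarrow> v \<in> lists A \<Longrightarrow> h u = h v \<Longrightarrow> v \<in> L"
    using recognized_sat[OF M] by metis
  have sat: "tw_sat k K h" using h(4)[of 1] by simp
  show "itl_definable A (Suc (Suc k)) L"
  proof (rule definable_of_congruence[OF A L tw_sat_da_congruence[OF h(1) sat]])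
    show "finite (range (\<lambda>w. {v. h w = h v}))"
      by (rule finite_image_factor[OF h(2)]) simp
  qed (use tw_satD(4)[OF sat] h(5) in auto)
qed

text \<open>Changes the exponent: if a compatible invariant does not distinguish \<open>K\<close>-th
  from \<open>K'\<close>-th powers, it takes the same values on the instances for either
  exponent.\<close>

lemma tw_pairs_transfer:
  assumes app: "\<And>u u' v v'. \<tau> u = \<tau> u' \<Longrightarrow> \<tau> v = \<tau> v' \<Longrightarrow> \<tau> (u @ v) = \<tau> (u' @ v')"
    and pow: "\<And>w. \<tau> (wpow w K) = \<tau> (wpow w K')"
  shows "(u, v) \<in> tw_pairs K k \<Longrightarrow> \<exists>u' v'. (u', v') \<in> tw_pairs K' k \<and> \<tau> u = \<tau> u' \<and> \<tau> v = \<tau> v'"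
proof (induction k arbitrary: u v)
  case 0
  then show ?case by auto
next
  case (Suc k)
  obtain z z' p q s t where st: "(s, t) \<in> tw_pairs K k"
    "u = z @ wpow (s @ p) K @ s @ wpow (q @ s) K @ z'"
    "v = z @ wpow (s @ p) K @ t @ wpow (q @ s) K @ z'"
    using Suc.prems by (rule tw_pairs_SucE)
  obtain s' t' where st': "(s', t') \<in> tw_pairs K' k" "\<tau> s = \<tau> s'" "\<tau> t = \<tau> t'"
    using Suc.IH[OF st(1)] by blast
  have wp: "\<tau> (wpow x j) = \<tau> (wpow y j)" if "\<tau> x = \<tau> y" for x y j
    by (induction j) (auto intro: app that)
  have "\<tau> (wpow (s @ p) K) = \<tau> (wpow (s' @ p) K')" "\<tau> (wpow (q @ s) K) = \<tau> (wpow (q @ s') K')"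
    unfolding pow by (intro wp app st'(2) refl)+
  then have "\<tau> (z @ wpow (s @ p) K @ x @ wpow (q @ s) K @ z') =
      \<tau> (z @ wpow (s' @ p) K' @ x' @ wpow (q @ s') K' @ z')" if "\<tau> x = \<tau> x'" for x x'
    by (intro app refl that)
  then have "\<tau> u = \<tau> (z @ wpow (s' @ p) K' @ s' @ wpow (q @ s') K' @ z')"
    "\<tau> v = \<tau> (z @ wpow (s' @ p) K' @ t' @ wpow (q @ s') K' @ z')"
    unfolding st(2,3) using st'(2,3) by simp_all
  then show ?case using tw_pairs_SucI[OF st'(1)] by blast
qed

text \<open>The orbit of \<open>q\<close> among \<open>n\<close> points has preperiod and period at
  most \<open>n\<close>, and \<open>n!\<close> is at least the former and a multiple of the
  latter.\<close>

lemma funpow_fact_idem: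
  assumes f: "\<And>q. q < n \<Longrightarrow> f q < n" and q: "q < (n::nat)"
  shows "(f ^^ fact n) ((f ^^ fact n) q) = (f ^^ fact n) q"
proof -
  have bound: "(f ^^ i) q < n" for i using q by (induction i) (auto intro: f)
  have "\<not> inj_on (\<lambda>i. (f ^^ i) q) {..n}"
  proof
    assume "inj_on (\<lambda>i. (f ^^ i) q) {..n}"
    then have "card {..n} \<le> card {..<n}"
      by (rule card_inj_on_le) (use bound in auto)
    then show False by simp
  qed
  then obtain i0 j0 where ij0: "i0 \<le> n" "j0 \<le> n" "i0 \<noteq> j0" "(f ^^ i0) q = (f ^^ j0) q"
    by (auto simp: inj_on_def)
  define i j where "i = min i0 j0" and "j = max i0 j0"
  have ij: "i < j" "j \<le> n" "(f ^^ i) q = (f ^^ j) q"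
    using ij0 by (auto simp: i_def j_def min_def max_def)
  define d where "d = j - i"
  have d: "0 < d" "d \<le> n" "j = d + i" using ij by (auto simp: d_def)
  have step: "(f ^^ (t * d + N)) q = (f ^^ N) q" if "i \<le> N" for t N
  proof (induction t)
    case (Suc t)
    have e: "Suc t * d + N = (t * d + (N - i)) + j" "t * d + N = (t * d + (N - i)) + i"
      using that d by simp_all
    have "(f ^^ (Suc t * d + N)) q = (f ^^ (t * d + N)) q"
      unfolding e funpow_add[of _ j] funpow_add[of _ i] comp_apply ij(3) ..
    then show ?case using Suc by simp
  qed simp
  obtain t where t: "fact n = t * d" using dvd_fact[of d n] d by (metis Suc_leI One_nat_def dvd_def mult.commute)
  have "n \<le> fact n" by (rule fact_ge_self)
  then have "i \<le> fact n" using ij by simp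
  from step[OF this, of t] show ?thesis using t by (simp add: funpow_add)
qed

text \<open>Numbers that do not denote letters act as the identity, so that arbitrary words can be read.\<close>

definition dfa_step :: "nat \<Rightarrow> dfa \<Rightarrow> nat \<Rightarrow> nat \<Rightarrow> nat" where
  "dfa_step k D q i = (if i < k then trans D ! q ! i else q)"

definition dfa_run :: "nat \<Rightarrow> dfa \<Rightarrow> nat \<Rightarrow> nat list \<Rightarrow> nat" where
  "dfa_run k D q w = foldl (dfa_step k D) q w"

definition dfa_acc :: "nat \<Rightarrow> dfa \<Rightarrow> nat list \<Rightarrow> bool" where
  "dfa_acc k D w \<longleftrightarrow> dfa_run k D (start D) w \<in> set (final D)"

definition dfa_action :: "nat \<Rightarrow> dfa \<Rightarrow> nat list \<Rightarrow> nat list" where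
  "dfa_action k D w = map (\<lambda>q. dfa_run k D q w) [0..<length (trans D)]"

text \<open>The identities are tested in all contexts, that is, for the syntactic monoid. The outer
  \<open>z\<close> and \<open>z'\<close> supply the contexts for the DA identity; the pairs bring
  their own.\<close>

definition tw_condition :: "nat \<Rightarrow> nat \<Rightarrow> dfa \<Rightarrow> bool" where
  "tw_condition l k D \<longleftrightarrow> (let K = fact (length (trans D)) in
     (\<forall>(u, v)\<in>tw_pairs K (Suc l). dfa_acc k D u = dfa_acc k D v) \<and>
     (\<forall>z z' x y w. dfa_acc k D (z @ wpow (x @ y @ w) K @ y @ wpow (x @ y @ w) K @ z') =
        dfa_acc k D (z @ wpow (x @ y @ w) K @ z')))"

lemma dfa_run_append [simp]: "dfa_run k D q (u @ v) = dfa_run k D (dfa_run k D q u) v"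
  by (simp add: dfa_run_def)

lemma dfa_run_Nil [simp]: "dfa_run k D q [] = q"
  by (simp add: dfa_run_def)

lemma dfa_run_wpow: "dfa_run k D q (wpow w j) = ((\<lambda>q. dfa_run k D q w) ^^ j) q"
  by (induction j arbitrary: q) (simp_all add: funpow_Suc_right del: funpow.simps(2))

lemma dfa_run_bound:
  assumes "wf_dfa k D"
  shows "q < length (trans D) \<Longrightarrow> dfa_run k D q w < length (trans D)"
proof (induction w arbitrary: q)
  case (Cons i w)
  have "trans D ! q \<in> set (trans D)" using Cons.prems by simp
  then have row: "length (trans D ! q) = k" "set (trans D ! q) \<subseteq> {..<length (trans D)}"
    using assms by (auto simp: wf_dfa_def)
  then have "trans D ! q ! i < length (trans D)" if "i < k" using that nth_mem by blast
  then have "dfa_step k D q i < length (trans D)"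
    using Cons.prems by (simp add: dfa_step_def)
  then show ?case using Cons.IH by (simp add: dfa_run_def)
qed simp

lemma dfa_action_eq_iff:
  "dfa_action k D u = dfa_action k D v \<longleftrightarrow>
    (\<forall>q<length (trans D). dfa_run k D q u = dfa_run k D q v)"
  by (auto simp: dfa_action_def)

lemma dfa_action_append:
  assumes "wf_dfa k D" "dfa_action k D u = dfa_action k D u'" "dfa_action k D v = dfa_action k D v'"
  shows "dfa_action k D (u @ v) = dfa_action k D (u' @ v')"
  using assms(2,3) dfa_run_bound[OF assms(1)] by (auto simp: dfa_action_eq_iff)

lemma dfa_acc_action:
  "wf_dfa k D \<Longrightarrow> dfa_action k D u = dfa_action k D v \<Longrightarrow> dfa_acc k D u = dfa_acc k D v"
  by (auto simp: dfa_action_eq_iff dfa_acc_def wf_dfa_def)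

lemma dfa_action_fact:
  assumes wf: "wf_dfa k D" and j: "0 < j"
  shows "dfa_action k D (wpow w (fact (length (trans D)) * j)) = dfa_action k D (wpow w (fact (length (trans D))))"
proof -
  let ?K = "fact (length (trans D)) :: nat"
  have "dfa_run k D q (wpow w (?K * Suc i)) = dfa_run k D q (wpow w ?K)" if "q < length (trans D)" for q i
  proof (induction i)
    case (Suc i)
    have "dfa_run k D q (wpow w (?K * Suc (Suc i))) = dfa_run k D (dfa_run k D q (wpow w (?K * Suc i))) (wpow w ?K)"
      by (simp flip: dfa_run_append wpow_add add: ac_simps)
    also have "\<dots> = dfa_run k D (dfa_run k D q (wpow w ?K)) (wpow w ?K)" unfolding Suc ..
    also have "\<dots> = dfa_run k D q (wpow w ?K)"
      unfolding dfa_run_wpow by (rule funpow_fact_idem) (auto intro: dfa_run_bound[OF wf] that)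
    finally show ?case .
  qed simp
  moreover obtain i where "j = Suc i" using j gr0_implies_Suc by blast
  ultimately show ?thesis by (simp add: dfa_action_eq_iff del: mult_Suc_right)
qed

lemma map_nth_inject:
  assumes "distinct as" "w \<in> lists {..<length as}" "w' \<in> lists {..<length as}" "map ((!) as) w = map ((!) as) w'"
  shows "w = w'"
proof (rule map_inj_on[OF assms(4)])
  have "set w \<union> set w' \<subseteq> {..<length as}" using assms(2,3) by auto
  then show "inj_on ((!) as) (set w \<union> set w')"
    using assms(1) by (intro inj_onI) (auto simp: nth_eq_iff_index_eq subset_iff)
qed

lemma dfa_run_letters:
  "w \<in> lists {..<k} \<Longrightarrow> dfa_run k D q w = foldl (\<lambda>q i. trans D ! q ! i) q w"
  unfolding dfa_run_def by (induction w arbitrary: q) (auto simp: dfa_step_def)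

lemma map_nth_in_dfa_lang:
  assumes "distinct as" "w \<in> lists {..<length as}"
  shows "map ((!) as) w \<in> dfa_lang as D \<longleftrightarrow> dfa_acc (length as) D w"
  using map_nth_inject[OF assms(1,2)] assms(2)
  by (auto simp: dfa_lang_def dfa_acc_def dfa_run_letters)

text \<open>Forwards, the identities of a recognizing monoid hold for an unknown exponent, which is
  replaced by the factorial. Backwards, the condition says that the syntactic congruence is in DA
  and satisfies the pairs, and it has finite index because it contains equality of actions.\<close>

lemma definable_iff_tw_condition:
  fixes as :: "'a list"
  assumes as: "distinct as" and wf: "wf_dfa (length as) D"
  shows "itl_definable (set as) (Suc (Suc l)) (dfa_lang as D) \<longleftrightarrow> tw_condition l (length as) D"
proof -
  let ?k = "length as" and ?A = "set as" and ?L = "dfa_lang as D"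
  let ?K = "fact (length (trans D)) :: nat"
  let ?act = "dfa_action ?k D" and ?acc = "dfa_acc ?k D"
  have L: "?L \<subseteq> lists ?A" by (auto simp: dfa_lang_def in_lists_conv_set)
  note act_app = dfa_action_append[OF wf]
  show ?thesis
  proof
    assume "itl_definable ?A (Suc (Suc l)) ?L"
    then obtain M where M: "M \<in> variety_join (TW_R (Suc (Suc l))) (TW_L (Suc (Suc l)))" "recognizes M ?A ?L"
      using definable_iff_recognized[OF _ L, of l] by auto
    obtain h :: "'a list \<Rightarrow> nat" and K where h: "word_hom M h" "0 < K"
      "\<And>j. 0 < j \<Longrightarrow> tw_sat l (K * j) h"
      "\<And>u v. u \<in> ?L \<Longrightarrow> v \<in> lists ?A \<Longrightarrow> h u = h v \<Longrightarrow> v \<in> ?L"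
      using recognized_sat[OF M] by metis
    \<comment> \<open>Numbers that denote no letter are erased, matching their action as the
      identity.\<close>
    define g where "g w = map ((!) as) (filter (\<lambda>i. i < ?k) w)" for w
    have g_app: "g (u @ v) = g u @ g v" for u v by (simp add: g_def)
    have g_nil: "g [] = []" by (simp add: g_def)
    have g_pow: "g (wpow w j) = wpow (g w) j" for w j by (induction j) (simp_all add: g_app g_nil)
    have g_lists: "g w \<in> lists ?A" for w by (auto simp: g_def in_lists_conv_set)
    have run_filter: "dfa_run ?k D q (filter (\<lambda>i. i < ?k) w) = dfa_run ?k D q w" for q w
      unfolding dfa_run_def by (induction w arbitrary: q) (auto simp: dfa_step_def)
    have g_acc: "g w \<in> ?L \<longleftrightarrow> ?acc w" for w
    proof -
      have "filter (\<lambda>i. i < ?k) w \<in> lists {..<?k}" by auto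
      from map_nth_in_dfa_lang[OF as this] show ?thesis by (simp add: g_def dfa_acc_def run_filter)
    qed
    have acc: "?acc u = ?acc v" if "h (g u) = h (g v)" for u v
      using h(4)[of "g u" "g v"] h(4)[of "g v" "g u"] that g_lists g_acc by metis
    \<comment> \<open>A multiple of both exponents: the monoid admits it, and the automaton cannot
      tell it from \<open>?K\<close>.\<close>
    let ?K' = "K * ?K"
    have sat: "tw_sat l ?K' h" by (rule h(3)) simp
    have pow: "?act (wpow w ?K) = ?act (wpow w ?K')" for w
      using dfa_action_fact[OF wf h(2), of w] by (simp add: mult.commute)
    have "?acc u = ?acc v" if pair: "(u, v) \<in> tw_pairs ?K (Suc l)" for u v
    proof -
      obtain u' v' where uv: "(u', v') \<in> tw_pairs ?K' (Suc l)" "?act u = ?act u'" "?act v = ?act v'"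
        using tw_pairs_transfer[of ?act, OF act_app pow pair] by blast
      have "(g u', g v') \<in> tw_pairs ?K' (Suc l)" by (rule tw_pairs_hom[OF g_app g_nil uv(1)])
      then have "?acc u' = ?acc v'" by (intro acc tw_satD(4)[OF sat])
      then show ?thesis using uv(2,3) dfa_acc_action[OF wf] by metis
    qed
    moreover have "?acc (z @ wpow (x @ y @ w) ?K @ y @ wpow (x @ y @ w) ?K @ z') =
        ?acc (z @ wpow (x @ y @ w) ?K @ z')" for z z' x y w
    proof -
      let ?X = "wpow (x @ y @ w) ?K" and ?X' = "wpow (x @ y @ w) ?K'"
      have "h (g (?X' @ y @ ?X')) = h (g ?X')"
        using tw_satD(3)[OF sat, of "g x" "g y" "g w"] by (simp add: g_app g_pow)
      then have "h (g (z @ (?X' @ y @ ?X') @ z')) = h (g (z @ ?X' @ z'))"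
        by (simp only: g_app[of z] g_app[of _ z'] word_homD(3)[OF h(1)])
      then have 1: "?acc (z @ (?X' @ y @ ?X') @ z') = ?acc (z @ ?X' @ z')" by (rule acc)
      have "?act (z @ (?X @ y @ ?X) @ z') = ?act (z @ (?X' @ y @ ?X') @ z')"
        "?act (z @ ?X @ z') = ?act (z @ ?X' @ z')"
        by (intro act_app pow refl)+
      with 1 show ?thesis using dfa_acc_action[OF wf] by (metis append_assoc)
    qed
    ultimately show "tw_condition l ?k D" unfolding tw_condition_def Let_def by blast
  next
    assume cond: "tw_condition l ?k D"
    \<comment> \<open>The default \<open>?k\<close> is not an index, so letters outside the alphabet
      act as the identity on the states.\<close>
    define idx where "idx a = (if a \<in> ?A then SOME i. i < ?k \<and> as ! i = a else ?k)" for a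
    have idx: "idx a < ?k" "as ! idx a = a" if "a \<in> ?A" for a
      using someI_ex[of "\<lambda>i. i < ?k \<and> as ! i = a"] that by (auto simp: idx_def in_set_conv_nth)
    \<comment> \<open>The syntactic congruence of the accepted words, pulled back along
      \<open>idx\<close> to all words over the type.\<close>
    define \<theta> where "\<theta> u v \<longleftrightarrow> (\<forall>x y. ?acc (x @ map idx u @ y) = ?acc (x @ map idx v @ y))" for u v
    have map_pow: "map idx (wpow w j) = wpow (map idx w) j" for w j by (induction j) simp_all
    have \<theta>_act: "\<theta> u v" if "?act (map idx u) = ?act (map idx v)" for u v
      unfolding \<theta>_def by (intro allI dfa_acc_action[OF wf] act_app that refl)
    have cong: "da_congruence \<theta> ?K"
    proof
      fix u v x y assume "\<theta> u v"
      then have "?acc ((x' @ map idx x) @ map idx u @ (map idx y @ y')) =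
          ?acc ((x' @ map idx x) @ map idx v @ (map idx y @ y'))" for x' y'
        unfolding \<theta>_def by blast
      then show "\<theta> (x @ u @ y) (x @ v @ y)" unfolding \<theta>_def by simp
    next
      fix w
      have "?act (wpow (map idx w) (?K * 2)) = ?act (wpow (map idx w) ?K)"
        by (rule dfa_action_fact[OF wf]) simp
      moreover have "wpow (map idx w) (?K * 2) = map idx (wpow w ?K @ wpow w ?K)"
        by (simp add: map_pow mult_2_right wpow_add)
      ultimately show "\<theta> (wpow w ?K @ wpow w ?K) (wpow w ?K)" by (intro \<theta>_act) (simp add: map_pow)
    next
      fix x y z
      show "\<theta> (wpow (x @ y @ z) ?K @ y @ wpow (x @ y @ z) ?K) (wpow (x @ y @ z) ?K)"
        using cond unfolding \<theta>_def tw_condition_def Let_def by (simp add: map_pow)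
    qed (auto simp: \<theta>_def)
    have fin: "finite (range (\<lambda>w. Collect (\<theta> w)))"
    proof (rule finite_image_factor)
      have "range (\<lambda>w. ?act (map idx w)) \<subseteq> {xs. set xs \<subseteq> {..<length (trans D)} \<and> length xs = length (trans D)}"
        using dfa_run_bound[OF wf] by (auto simp: dfa_action_def)
      then show "finite (range (\<lambda>w. ?act (map idx w)))"
        by (rule finite_subset) (intro finite_lists_length_eq finite_lessThan)
      show "Collect (\<theta> u) = Collect (\<theta> v)" if "?act (map idx u) = ?act (map idx v)" for u v
        using \<theta>_act[OF that] unfolding \<theta>_def by simp
    qed
    show "itl_definable ?A (Suc (Suc l)) ?L"
    proof (rule definable_of_congruence[OF _ L cong fin])
      fix u v :: "'a list" assume pair: "(u, v) \<in> tw_pairs ?K (Suc l)"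
      have "(x @ map idx u @ y, x @ map idx v @ y) \<in> tw_pairs ?K (Suc l)" for x y
        by (intro tw_pairs_append tw_pairs_hom[OF _ _ pair]) simp_all
      then show "\<theta> u v" using cond unfolding \<theta>_def tw_condition_def Let_def by blast
    next
      fix u v assume u: "u \<in> ?L" and v: "v \<in> lists ?A" and \<theta>: "\<theta> u v"
      have in_L: "w \<in> ?L \<longleftrightarrow> ?acc (map idx w)" if "w \<in> lists ?A" for w
      proof -
        have "map idx w \<in> lists {..<?k}" using idx that by (auto simp: in_lists_conv_set)
        moreover have "map ((!) as) (map idx w) = w"
          using idx that by (auto simp: in_lists_conv_set intro!: map_idI)
        ultimately show ?thesis using map_nth_in_dfa_lang[OF as] by metis
      qed
      have "?acc ([] @ map idx u @ []) = ?acc ([] @ map idx v @ [])" using \<theta> unfolding \<theta>_def by blast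
      then show "v \<in> ?L" using in_L u v L by auto
    qed simp
  qed
qed

section \<open>Computable functions and decidability\<close>

definition rcomp :: "nat \<Rightarrow> (nat list \<Rightarrow> nat) \<Rightarrow> bool" where
  "rcomp k f \<longleftrightarrow> (\<exists>r. \<forall>xs. length xs = k \<longrightarrow> rec_computes r xs (f xs))"

lemma rcomp_nth: "i < k \<Longrightarrow> rcomp k (\<lambda>xs. xs ! i)"
  unfolding rcomp_def by (intro exI[of _ "Proj i"]) (auto intro: rec_computes.proj)

lemma rcomp_compose:
  assumes f: "rcomp (length gs) f" and gs: "\<And>g. g \<in> set gs \<Longrightarrow> rcomp k g"
  shows "rcomp k (\<lambda>xs. f (map (\<lambda>g. g xs) gs))"
proof -
  obtain r where r: "\<And>xs. length xs = length gs \<Longrightarrow> rec_computes r xs (f xs)"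
    using f unfolding rcomp_def by blast
  have "\<forall>g. \<exists>r. g \<in> set gs \<longrightarrow> (\<forall>xs. length xs = k \<longrightarrow> rec_computes r xs (g xs))"
    using gs unfolding rcomp_def by blast
  then obtain R where R: "\<And>g xs. g \<in> set gs \<Longrightarrow> length xs = k \<Longrightarrow> rec_computes (R g) xs (g xs)"
    by metis
  have "rec_computes (Comp r (map R gs)) xs (f (map (\<lambda>g. g xs) gs))" if "length xs = k" for xs
  proof (rule rec_computes.comp)
    show "list_all2 (\<lambda>g y. rec_computes g xs y) (map R gs) (map (\<lambda>g. g xs) gs)"
      using R that by (simp add: list_all2_conv_all_nth)
    show "rec_computes r (map (\<lambda>g. g xs) gs) (f (map (\<lambda>g. g xs) gs))" by (rule r) simp
  qed
  then show ?thesis unfolding rcomp_def by blast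
qed

lemma rcomp_Suc: "rcomp k f \<Longrightarrow> rcomp k (\<lambda>xs. Suc (f xs))"
proof -
  have "rcomp (length [f]) (\<lambda>xs. Suc (xs ! 0))"
    unfolding rcomp_def
    by (intro exI[of _ Succ]) (auto simp: length_Suc_conv intro: rec_computes.succ)
  from rcomp_compose[OF this, of k] show "rcomp k f \<Longrightarrow> ?thesis" by simp
qed

lemma rcomp_const: "rcomp k (\<lambda>xs. c)"
proof (induction c)
  case 0
  show ?case unfolding rcomp_def by (intro exI[of _ Zero]) (auto intro: rec_computes.zero)
qed (rule rcomp_Suc)

text \<open>\<open>PrimRec\<close> passes the counter and the previous value ahead of the
  parameters, which are therefore found at \<open>drop 2\<close>.\<close>

lemma rcomp_rec:
  assumes f: "rcomp k f" and g: "rcomp (Suc (Suc k)) (\<lambda>ys. g (ys ! 0) (ys ! 1) (drop 2 ys))"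
    and b: "rcomp k b"
  shows "rcomp k (\<lambda>xs. rec_nat (f xs) (\<lambda>n y. g n y xs) (b xs))"
proof -
  obtain rf where rf: "\<And>xs. length xs = k \<Longrightarrow> rec_computes rf xs (f xs)"
    using f unfolding rcomp_def by blast
  obtain rb where rb: "\<And>xs. length xs = k \<Longrightarrow> rec_computes rb xs (b xs)"
    using b unfolding rcomp_def by blast
  obtain rg where rg: "\<And>ys. length ys = Suc (Suc k) \<Longrightarrow> rec_computes rg ys (g (ys ! 0) (ys ! 1) (drop 2 ys))"
    using g unfolding rcomp_def by blast
  have prim: "rec_computes (PrimRec rf rg) (n # xs) (rec_nat (f xs) (\<lambda>n y. g n y xs) n)"
    if "length xs = k" for n xs
  proof (induction n)
    case 0 show ?case using rf[OF that] by (auto intro: rec_computes.prim_0)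
  next
    case (Suc n)
    have "rec_computes rg (n # rec_nat (f xs) (\<lambda>n y. g n y xs) n # xs)
        (g n (rec_nat (f xs) (\<lambda>n y. g n y xs) n) xs)"
      using rg[of "n # rec_nat (f xs) (\<lambda>n y. g n y xs) n # xs"] that by simp
    from rec_computes.prim_Suc[OF Suc this] show ?case by simp
  qed
  have "rec_computes (Comp (PrimRec rf rg) (rb # map Proj [0..<k])) xs
      (rec_nat (f xs) (\<lambda>n y. g n y xs) (b xs))" if "length xs = k" for xs
  proof (rule rec_computes.comp[OF _ prim[OF that]])
    show "list_all2 (\<lambda>g y. rec_computes g xs y) (rb # map Proj [0..<k]) (b xs # xs)"
      using rb that
      by (auto simp: list_all2_conv_all_nth nth_Cons split: nat.split intro: rec_computes.proj)
  qed
  then show ?thesis unfolding rcomp_def by blast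
qed

lemma rcomp_drop2:
  assumes "rcomp k f"
  shows "rcomp (Suc (Suc k)) (\<lambda>ys. f (drop 2 ys))"
proof -
  obtain r where r: "\<And>xs. length xs = k \<Longrightarrow> rec_computes r xs (f xs)"
    using assms unfolding rcomp_def by blast
  have "rec_computes (Comp r (map Proj [2..<Suc (Suc k)])) ys (f (drop 2 ys))"
    if "length ys = Suc (Suc k)" for ys
  proof (rule rec_computes.comp)
    have "rec_computes (Proj (2 + i)) ys (ys ! (2 + i))" if "i < k" for i
      using that \<open>length ys = Suc (Suc k)\<close> by (intro rec_computes.proj) simp
    then show "list_all2 (\<lambda>g y. rec_computes g ys y) (map Proj [2..<Suc (Suc k)]) (drop 2 ys)"
      using that by (auto simp: list_all2_conv_all_nth simp del: upt_Suc)
    show "rec_computes r (drop 2 ys) (f (drop 2 ys))" using that by (intro r) simp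
  qed
  then show ?thesis unfolding rcomp_def by blast
qed

lemma rcomp_add: "rcomp k f \<Longrightarrow> rcomp k g \<Longrightarrow> rcomp k (\<lambda>xs. f xs + g xs)"
proof -
  assume a: "rcomp k f" "rcomp k g"
  have "rec_nat a (\<lambda>n y. Suc y) b = a + b" for a b by (induction b) auto
  then show ?thesis using rcomp_rec[OF a(1) rcomp_Suc[OF rcomp_nth[of 1]] a(2)] by simp
qed

lemma rcomp_pred: "rcomp k g \<Longrightarrow> rcomp k (\<lambda>xs. g xs - 1)"
proof -
  assume a: "rcomp k g"
  have "rec_nat 0 (\<lambda>n y. n) b = b - 1" for b by (cases b) auto
  then show ?thesis using rcomp_rec[OF rcomp_const[of _ 0] rcomp_nth[of 0] a] by simp
qed

lemma rcomp_diff: "rcomp k f \<Longrightarrow> rcomp k g \<Longrightarrow> rcomp k (\<lambda>xs. f xs - g xs)"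
proof -
  assume a: "rcomp k f" "rcomp k g"
  have "rec_nat a (\<lambda>n y. y - 1) b = a - b" for a b by (induction b) auto
  then show ?thesis using rcomp_rec[OF a(1) rcomp_pred[OF rcomp_nth[of 1]] a(2)] by simp
qed

lemma rcomp_mult: "rcomp k f \<Longrightarrow> rcomp k g \<Longrightarrow> rcomp k (\<lambda>xs. f xs * g xs)"
proof -
  assume a: "rcomp k f" "rcomp k g"
  have "rec_nat 0 (\<lambda>n y. y + a) b = a * b" for a b by (induction b) auto
  then show ?thesis
    using rcomp_rec[OF rcomp_const[of _ 0] rcomp_add[OF rcomp_nth[of 1] rcomp_drop2[OF a(1)]] a(2)] by simp
qed

lemma rcomp_triangle: "rcomp k f \<Longrightarrow> rcomp k (\<lambda>xs. triangle (f xs))"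
proof -
  assume a: "rcomp k f"
  have "rec_nat 0 (\<lambda>n y. y + Suc n) b = triangle b" for b by (induction b) auto
  then show ?thesis
    using rcomp_rec[OF rcomp_const[of _ 0] rcomp_add[OF rcomp_nth[of 1] rcomp_Suc[OF rcomp_nth[of 0]]] a] by simp
qed

lemma rcomp_if0:
  assumes "rcomp k c" "rcomp k a" "rcomp k b"
  shows "rcomp k (\<lambda>xs. if c xs = 0 then a xs else b xs)"
proof -
  have "rec_nat x (\<lambda>n y. z) i = (if i = 0 then x else z)" for x z i :: nat by (cases i) auto
  then show ?thesis using rcomp_rec[OF assms(2) rcomp_drop2[OF assms(3)] assms(1)] by simp
qed

section \<open>Computability of pairing and its inverse\<close>

lemma rcomp_pair: "rcomp k f \<Longrightarrow> rcomp k g \<Longrightarrow> rcomp k (\<lambda>xs. prod_encode (f xs, g xs))"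
  unfolding prod_encode_def by (simp add: rcomp_add rcomp_triangle)

definition fst_code :: "nat \<Rightarrow> nat" where "fst_code n = fst (prod_decode n)"
definition snd_code :: "nat \<Rightarrow> nat" where "snd_code n = snd (prod_decode n)"

lemma code_pair [simp]:
  "fst_code (prod_encode (a, b)) = a" "snd_code (prod_encode (a, b)) = b"
  "prod_encode (fst_code n, snd_code n) = n"
  by (simp_all add: fst_code_def snd_code_def)

text \<open>The largest \<open>i\<close> with \<open>triangle i \<le> n\<close>, found by primitive
  recursion with truncated subtraction as comparison. On the code of a pair it is the sum of the
  components, from which both components follow.\<close>

definition triangle_root :: "nat \<Rightarrow> nat" where
  "triangle_root n = rec_nat 0 (\<lambda>i y. if triangle (Suc i) - n = 0 then Suc i else y) n"

lemma triangle_mono: "i \<le> j \<Longrightarrow> triangle i \<le> triangle j"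
  by (induction rule: dec_induct) auto

lemma triangle_root: "triangle_root (prod_encode (a, b)) = a + b"
proof -
  let ?n = "prod_encode (a, b)"
  have n: "?n = triangle (a + b) + a" by (simp add: prod_encode_def)
  have le: "triangle (Suc i) \<le> ?n \<longleftrightarrow> Suc i \<le> a + b" for i
  proof
    assume t: "triangle (Suc i) \<le> ?n"
    show "Suc i \<le> a + b"
    proof (rule ccontr)
      assume "\<not> Suc i \<le> a + b"
      then have "triangle (Suc (a + b)) \<le> triangle (Suc i)" by (intro triangle_mono) simp
      then show False using t n by simp
    qed
  next
    assume "Suc i \<le> a + b"
    from triangle_mono[OF this] show "triangle (Suc i) \<le> ?n" unfolding n by linarith
  qed
  have "rec_nat 0 (\<lambda>i y. if triangle (Suc i) - ?n = 0 then Suc i else y) j = min j (a + b)" for j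
    by (induction j) (use le in \<open>auto simp del: triangle_Suc simp: min_def\<close>)
  moreover have "i \<le> triangle i" for i by (induction i) auto
  then have "a + b \<le> ?n" using n by (metis le_add1 le_trans)
  ultimately show ?thesis by (simp add: triangle_root_def)
qed

lemma rcomp_triangle_root: "rcomp k f \<Longrightarrow> rcomp k (\<lambda>xs. triangle_root (f xs))"
proof -
  assume a: "rcomp k f"
  show ?thesis unfolding triangle_root_def
    by (rule rcomp_rec[OF rcomp_const _ a, where g = "\<lambda>i y xs. if triangle (Suc i) - f xs = 0 then Suc i else y"])
      (intro rcomp_if0 rcomp_diff rcomp_triangle rcomp_Suc rcomp_nth rcomp_drop2 a; simp)
qed

lemma fst_snd_code_triangle:
  "fst_code n = n - triangle (triangle_root n)" "snd_code n = triangle_root n - fst_code n"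
proof -
  obtain a b where "n = prod_encode (a, b)" by (metis code_pair(3))
  then show "fst_code n = n - triangle (triangle_root n)" "snd_code n = triangle_root n - fst_code n"
    by (simp_all add: triangle_root) (simp add: prod_encode_def)
qed

lemma rcomp_fst: "rcomp k f \<Longrightarrow> rcomp k (\<lambda>xs. fst_code (f xs))"
  unfolding fst_snd_code_triangle by (intro rcomp_diff rcomp_triangle rcomp_triangle_root)

lemma rcomp_snd: "rcomp k f \<Longrightarrow> rcomp k (\<lambda>xs. snd_code (f xs))"
  unfolding fst_snd_code_triangle(2) by (intro rcomp_diff rcomp_fst rcomp_triangle_root)

text \<open>Unary functions suffice, since further arguments are packed by
  \<open>prod_encode\<close>; step functions of recursions and bodies of quantifiers receive nested
  pairs.\<close>

definition computable :: "(nat \<Rightarrow> nat) \<Rightarrow> bool" where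
  "computable f \<longleftrightarrow> rcomp 1 (\<lambda>xs. f (xs ! 0))"

lemma rcomp_computable: "computable f \<Longrightarrow> rcomp k g \<Longrightarrow> rcomp k (\<lambda>xs. f (g xs))"
  using rcomp_compose[of "[g]" "\<lambda>xs. f (xs ! 0)" k] by (simp add: computable_def)

lemma computable_compose: "computable f \<Longrightarrow> computable g \<Longrightarrow> computable (\<lambda>x. f (g x))"
  using rcomp_computable[of f 1] by (simp add: computable_def)

lemma computable_id: "computable (\<lambda>x. x)"
  unfolding computable_def by (rule rcomp_nth) simp

lemma computable_const: "computable (\<lambda>x. c)"
  unfolding computable_def by (rule rcomp_const)

lemma computable_arith:
  assumes "computable f" "computable g"
  shows "computable (\<lambda>x. f x + g x)" "computable (\<lambda>x. f x - g x)" "computable (\<lambda>x. f x * g x)"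
    "computable (\<lambda>x. prod_encode (f x, g x))"
  using assms unfolding computable_def
  by (rule rcomp_add rcomp_diff rcomp_mult rcomp_pair)+

lemma computable_unary:
  assumes "computable f"
  shows "computable (\<lambda>x. Suc (f x))" "computable (\<lambda>x. fst_code (f x))" "computable (\<lambda>x. snd_code (f x))"
  using assms unfolding computable_def by (rule rcomp_Suc rcomp_fst rcomp_snd)+

lemma computable_rec:
  assumes "computable f"
    and g: "computable (\<lambda>p. g (fst_code p) (fst_code (snd_code p)) (snd_code (snd_code p)))"
    and "computable b"
  shows "computable (\<lambda>x. rec_nat (f x) (\<lambda>n y. g n y x) (b x))"
proof -
  have "rcomp (Suc (Suc 1)) (\<lambda>ys. prod_encode (ys ! 0, prod_encode (ys ! 1, ys ! 2)))"
    by (intro rcomp_pair rcomp_nth) simp_all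
  from rcomp_computable[OF g this]
  have "rcomp (Suc (Suc 1)) (\<lambda>ys. g (ys ! 0) (ys ! 1) (drop 2 ys ! 0))"
    by (simp add: rcomp_def)
  then show ?thesis unfolding computable_def
    by (intro rcomp_rec[where g = "\<lambda>n y xs. g n y (xs ! 0)"]) (use assms in \<open>simp_all add: computable_def\<close>)
qed

definition computable_pred :: "(nat \<Rightarrow> bool) \<Rightarrow> bool" where
  "computable_pred P \<longleftrightarrow> computable (\<lambda>x. if P x then 1 else 0)"

lemma computable_if0:
  assumes "computable c" "computable a" "computable b"
  shows "computable (\<lambda>x. if c x = 0 then a x else b x)"
  using assms unfolding computable_def by (rule rcomp_if0)

lemma computable_pred_eq0: "computable c \<Longrightarrow> computable_pred (\<lambda>x. c x = 0)"
  unfolding computable_pred_def by (intro computable_if0 computable_const)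

lemma computable_if:
  assumes "computable_pred P" "computable a" "computable b"
  shows "computable (\<lambda>x. if P x then a x else b x)"
proof -
  have "computable (\<lambda>x. if (if P x then 1 else 0 :: nat) = 0 then b x else a x)"
    using assms unfolding computable_pred_def by (intro computable_if0)
  moreover have "(\<lambda>x. if (if P x then 1 else 0 :: nat) = 0 then b x else a x) = (\<lambda>x. if P x then a x else b x)"
    by auto
  ultimately show ?thesis by simp
qed

lemma computable_pred_less: "computable f \<Longrightarrow> computable g \<Longrightarrow> computable_pred (\<lambda>x. f x < g x)"
  using computable_pred_eq0[OF computable_arith(2)[OF computable_unary(1)], of f g]
  by (simp add: Suc_le_eq)

lemma computable_pred_eq: "computable f \<Longrightarrow> computable g \<Longrightarrow> computable_pred (\<lambda>x. f x = g x)"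
proof -
  assume "computable f" "computable g"
  then have "computable_pred (\<lambda>x. (f x - g x) + (g x - f x) = 0)"
    by (intro computable_pred_eq0 computable_arith)
  moreover have "(\<lambda>x. (f x - g x) + (g x - f x) = 0) = (\<lambda>x. f x = g x)" by auto
  ultimately show ?thesis by simp
qed

lemma computable_pred_conj:
  assumes "computable_pred P" "computable_pred Q"
  shows "computable_pred (\<lambda>x. P x \<and> Q x)"
proof -
  have "computable (\<lambda>x. if P x then (if Q x then 1 else 0) else 0)"
    using assms(2) by (intro computable_if assms(1) computable_const) (simp add: computable_pred_def)
  moreover have "(\<lambda>x. if P x then (if Q x then 1 else 0) else 0) = (\<lambda>x. if P x \<and> Q x then 1 else 0 :: nat)"
    by auto
  ultimately show ?thesis by (simp add: computable_pred_def)
qed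

lemma computable_pred_iff:
  assumes "computable_pred P" "computable_pred Q"
  shows "computable_pred (\<lambda>x. P x = Q x)"
proof -
  have "computable_pred (\<lambda>x. (if P x then 1 else 0 :: nat) = (if Q x then 1 else 0))"
    using assms by (intro computable_pred_eq) (simp_all add: computable_pred_def)
  moreover have "(\<lambda>x. (if P x then 1 else 0 :: nat) = (if Q x then 1 else 0)) = (\<lambda>x. P x = Q x)" by auto
  ultimately show ?thesis by simp
qed

lemma computable_pred_ball_le:
  assumes P: "computable_pred (\<lambda>p. P (fst_code p) (snd_code p))" and b: "computable b"
  shows "computable_pred (\<lambda>x. \<forall>i\<le>b x. P i x)"
proof -
  have "computable (\<lambda>p. (\<lambda>i y x. if P i x then y else 0) (fst_code p) (fst_code (snd_code p)) (snd_code (snd_code p)))"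
    using computable_compose[OF P[unfolded computable_pred_def]
        computable_arith(4)[OF computable_unary(2)[OF computable_id]
          computable_unary(3)[OF computable_unary(3)[OF computable_id]]]]
    by (intro computable_if computable_unary computable_const computable_id) (simp add: computable_pred_def)
  from computable_rec[OF computable_const[of 1] this computable_unary(1)[OF b]]
  have "computable (\<lambda>x. rec_nat 1 (\<lambda>i y. if P i x then y else 0) (Suc (b x)))" .
  moreover have "rec_nat 1 (\<lambda>i y. if P i x then y else 0) n = (if \<forall>i<n. P i x then 1 else 0 :: nat)" for x n
    by (induction n) (auto simp: less_Suc_eq)
  ultimately have "computable (\<lambda>x. if \<forall>i<Suc (b x). P i x then 1 else 0)" by (simp only:)
  then show ?thesis by (simp add: computable_pred_def less_Suc_eq_le)
qed

section \<open>Computable operations on coded lists\<close>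

definition hd_code :: "nat \<Rightarrow> nat" where "hd_code c = fst_code (c - 1)"
definition tl_code :: "nat \<Rightarrow> nat" where "tl_code c = snd_code (c - 1)"

lemma list_decode_nonzero: "c \<noteq> 0 \<Longrightarrow> list_decode c = hd_code c # list_decode (tl_code c)"
  by (cases c) (auto simp: hd_code_def tl_code_def fst_code_def snd_code_def split: prod.split)

lemma length_list_decode: "length (list_decode c) \<le> c"
proof -
  have "length xs \<le> list_encode xs" for xs
    by (induction xs) (use le_prod_encode_2 order_trans in \<open>auto, blast\<close>)
  from this[of "list_decode c"] show ?thesis by simp
qed

lemma computable_list:
  assumes "computable c"
  shows "computable (\<lambda>x. hd_code (c x))" "computable (\<lambda>x. tl_code (c x))"
  unfolding hd_code_def tl_code_def
  by (intro computable_unary computable_arith(2) assms computable_const)+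

text \<open>The recursion carries the accumulator paired with the code of the unread rest. It is
  iterated as often as the code itself says, which is enough because no list is longer than its
  code; once the rest is 0, the empty list, the state stands still.\<close>

lemma computable_foldl:
  assumes a: "computable a" and c: "computable c"
    and F: "computable (\<lambda>p. F (fst_code p) (fst_code (snd_code p)) (snd_code (snd_code p)))"
  shows "computable (\<lambda>x. foldl (\<lambda>y e. F y e x) (a x) (list_decode (c x)))"
proof -
  define step where "step s x = (if snd_code s = 0 then s else
    prod_encode (F (fst_code s) (hd_code (snd_code s)) x, tl_code (snd_code s)))" for s x
  have "computable (\<lambda>p. F (fst_code (fst_code (snd_code p))) (hd_code (snd_code (fst_code (snd_code p)))) (snd_code (snd_code p)))"
    using computable_compose[OF F, of "\<lambda>p. prod_encode (fst_code (fst_code (snd_code p)),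
        prod_encode (hd_code (snd_code (fst_code (snd_code p))), snd_code (snd_code p)))"]
    by (simp add: computable_arith computable_unary computable_list computable_id)
  then have "computable (\<lambda>p. step (fst_code (snd_code p)) (snd_code (snd_code p)))"
    unfolding step_def
    by (intro computable_if computable_pred_eq computable_arith computable_unary computable_list computable_const computable_id)
  from computable_rec[OF computable_arith(4)[OF a c], of "\<lambda>n s x. step s x", OF this c]
  have "computable (\<lambda>x. fst_code (rec_nat (prod_encode (a x, c x)) (\<lambda>n s. step s x) (c x)))"
    by (rule computable_unary)
  moreover have "fst_code (rec_nat (prod_encode (y, d)) (\<lambda>n s. step s x) n) = foldl (\<lambda>y e. F y e x) y (list_decode d)"
    if "length (list_decode d) \<le> n" for x y d n
  proof -
    let ?xs = "list_decode d"
    have "rec_nat (prod_encode (y, d)) (\<lambda>n s. step s x) n =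
        prod_encode (foldl (\<lambda>y e. F y e x) y (take n ?xs), list_encode (drop n ?xs))"
    proof (induction n)
      case (Suc n)
      have eq: "rec_nat (prod_encode (y, d)) (\<lambda>n s. step s x) (Suc n) =
          step (prod_encode (foldl (\<lambda>y e. F y e x) y (take n ?xs), list_encode (drop n ?xs))) x"
        by (simp add: Suc)
      show ?case unfolding eq
      proof (cases "n < length ?xs")
        case True
        then have "drop n ?xs = ?xs ! n # drop (Suc n) ?xs" by (rule Cons_nth_drop_Suc[symmetric])
        then have "list_encode (drop n ?xs) \<noteq> 0" "hd_code (list_encode (drop n ?xs)) = ?xs ! n"
          "tl_code (list_encode (drop n ?xs)) = list_encode (drop (Suc n) ?xs)"
          by (simp_all add: hd_code_def tl_code_def)
        then show "step (prod_encode (foldl (\<lambda>y e. F y e x) y (take n ?xs), list_encode (drop n ?xs))) x =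
            prod_encode (foldl (\<lambda>y e. F y e x) y (take (Suc n) ?xs), list_encode (drop (Suc n) ?xs))"
          using True by (simp add: step_def take_Suc_conv_app_nth)
      qed (simp add: step_def)
    qed simp
    then show ?thesis using that by simp
  qed
  ultimately show ?thesis using length_list_decode by simp
qed

definition nth_code :: "nat \<Rightarrow> nat \<Rightarrow> nat" where
  "nth_code c i = hd_code (rec_nat c (\<lambda>n y. tl_code y) i)"

lemma nth_code: "i < length (list_decode c) \<Longrightarrow> nth_code c i = list_decode c ! i"
proof -
  assume i: "i < length (list_decode c)"
  have "i \<le> length (list_decode c) \<Longrightarrow> list_decode (rec_nat c (\<lambda>n y. tl_code y) i) = drop i (list_decode c)" for i
  proof (induction i)
    case (Suc i)
    let ?d = "rec_nat c (\<lambda>n y. tl_code y) i"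
    have "list_decode ?d = drop i (list_decode c)" using Suc by simp
    moreover have "list_decode ?d \<noteq> []" using calculation Suc.prems by simp
    then have "?d \<noteq> 0" by (metis list_decode.simps(1))
    then have "list_decode (tl_code ?d) = tl (list_decode ?d)" by (simp add: list_decode_nonzero)
    ultimately show ?case by (simp add: drop_Suc tl_drop)
  qed simp
  then have d: "list_decode (rec_nat c (\<lambda>n y. tl_code y) i) = drop i (list_decode c)" using i by simp
  then have "rec_nat c (\<lambda>n y. tl_code y) i \<noteq> 0" using i by (metis drop_eq_Nil list_decode.simps(1) not_le)
  from list_decode_nonzero[OF this] d i show ?thesis
    unfolding nth_code_def by (metis hd_drop_conv_nth list.sel(1))
qed

lemma computable_nth:
  assumes "computable c" "computable i"
  shows "computable (\<lambda>x. nth_code (c x) (i x))"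
  unfolding nth_code_def
  by (intro computable_list computable_rec[of c "\<lambda>n y x. tl_code y"] assms computable_unary computable_id)

lemma computable_length:
  assumes "computable c"
  shows "computable (\<lambda>x. length (list_decode (c x)))"
proof -
  have "foldl (\<lambda>y e. Suc y) a xs = a + length xs" for a and xs :: "nat list" by (induction xs arbitrary: a) auto
  moreover have "computable (\<lambda>x. foldl (\<lambda>y e. Suc y) 0 (list_decode (c x)))"
    by (intro computable_foldl[where F = "\<lambda>y e x. Suc y"] assms computable_const computable_unary computable_id)
  ultimately show ?thesis by simp
qed

lemma computable_pred_ball:
  assumes P: "computable_pred (\<lambda>p. P (fst_code p) (snd_code p))" and c: "computable c"
  shows "computable_pred (\<lambda>x. \<forall>e\<in>set (list_decode (c x)). P e x)"
proof -
  have "computable (\<lambda>p. (\<lambda>y e x. if P e x then y else 0) (fst_code p) (fst_code (snd_code p)) (snd_code (snd_code p)))"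
    using computable_compose[OF P[unfolded computable_pred_def] computable_unary(3)[OF computable_id]]
    by (intro computable_if computable_unary computable_const computable_id) (simp add: computable_pred_def)
  from computable_foldl[OF computable_const[of 1] c this]
  have "computable (\<lambda>x. foldl (\<lambda>y e. if P e x then y else 0) 1 (list_decode (c x)))" .
  moreover have "foldl (\<lambda>y e. if P e x then y else 0) a xs = (if \<forall>e\<in>set xs. P e x then a else 0)"
    for a :: nat and x xs
    by (induction xs arbitrary: a) auto
  ultimately show ?thesis unfolding computable_pred_def by (simp only:)
qed

lemma computable_pred_not:
  assumes "computable_pred P"
  shows "computable_pred (\<lambda>x. \<not> P x)"
  using computable_pred_eq0[OF assms[unfolded computable_pred_def]]
  by (rule back_subst[of computable_pred]) auto

lemma computable_pred_mem:
  assumes "computable e" "computable c"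
  shows "computable_pred (\<lambda>x. e x \<in> set (list_decode (c x)))"
proof -
  have "computable_pred (\<lambda>x. \<not> (\<forall>y\<in>set (list_decode (c x)). \<not> y = e x))"
    by (intro computable_pred_not computable_pred_ball computable_pred_eq assms(2)
        computable_compose[OF assms(1)] computable_unary computable_id)
  then show ?thesis by (rule back_subst[of computable_pred]) auto
qed

lemma decidable_if_computable_pred:
  assumes "computable_pred P"
  shows "decidable {n. P n}"
proof -
  obtain r where r: "\<And>xs. length xs = 1 \<Longrightarrow> rec_computes r xs (if P (xs ! 0) then 1 else 0)"
    using assms unfolding computable_pred_def computable_def rcomp_def by blast
  then have "rec_computes r [n] (if n \<in> {n. P n} then 1 else 0)" for n
    using r[of "[n]"] by simp
  then show ?thesis unfolding decidable_def by blast
qed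

section \<open>Runs of automata on coded input\<close>

definition code_step :: "nat \<Rightarrow> nat \<Rightarrow> nat \<Rightarrow> nat \<Rightarrow> nat" where
  "code_step k t q i = (if i < k then nth_code (nth_code t q) i else q)"

definition code_run :: "nat \<Rightarrow> nat \<Rightarrow> nat \<Rightarrow> nat list \<Rightarrow> nat" where
  "code_run k t q w = foldl (code_step k t) q w"

lemma code_run_append [simp]: "code_run k t q (u @ v) = code_run k t (code_run k t q u) v"
  by (simp add: code_run_def)

lemma code_run_wpow: "code_run k t q (wpow w K) = rec_nat q (\<lambda>n y. code_run k t y w) K"
  by (induction K) (simp_all add: code_run_def wpow_Suc_right del: wpow_simps(2))

text \<open>
  The words instantiating the variables of \<open>U\<^sub>l\<^sub>+\<^sub>1 = V\<^sub>l\<^sub>+\<^sub>1\<close> are read off from the nested pair \<open>c\<close>.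
\<close>

fun fst_word :: "nat \<Rightarrow> nat \<Rightarrow> nat \<Rightarrow> nat list" and snd_word :: "nat \<Rightarrow> nat \<Rightarrow> nat \<Rightarrow> nat list" where
  "fst_word K 0 c = list_decode c"
| "fst_word K (Suc l) c = (let z = list_decode (fst_code c); c1 = snd_code c;
     z' = list_decode (fst_code c1); c2 = snd_code c1; p = list_decode (fst_code c2); c3 = snd_code c2;
     q = list_decode (fst_code c3); s = fst_word K l (snd_code c3)
     in z @ wpow (s @ p) K @ s @ wpow (q @ s) K @ z')"
| "snd_word K 0 c = []"
| "snd_word K (Suc l) c = (let z = list_decode (fst_code c); c1 = snd_code c;
     z' = list_decode (fst_code c1); c2 = snd_code c1; p = list_decode (fst_code c2); c3 = snd_code c2;
     q = list_decode (fst_code c3); s = fst_word K l (snd_code c3); t = snd_word K l (snd_code c3)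
     in z @ wpow (s @ p) K @ t @ wpow (q @ s) K @ z')"

lemma tw_pairs_code: "(u, v) \<in> tw_pairs K l \<longleftrightarrow> (\<exists>c. u = fst_word K l c \<and> v = snd_word K l c)"
proof (induction l arbitrary: u v)
  case 0
  have "\<exists>c. u = list_decode c" by (rule exI[of _ "list_encode u"]) simp
  then show ?case by auto
next
  case (Suc l)
  show ?case
  proof
    assume "(u, v) \<in> tw_pairs K (Suc l)"
    then obtain z z' p q s t where st: "(s, t) \<in> tw_pairs K l"
      "u = z @ wpow (s @ p) K @ s @ wpow (q @ s) K @ z'"
      "v = z @ wpow (s @ p) K @ t @ wpow (q @ s) K @ z'"
      by (rule tw_pairs_SucE)
    then obtain c where c: "s = fst_word K l c" "t = snd_word K l c" using Suc by blast
    let ?c = "prod_encode (list_encode z, prod_encode (list_encode z', prod_encode (list_encode p,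
      prod_encode (list_encode q, c))))"
    have "u = fst_word K (Suc l) ?c" "v = snd_word K (Suc l) ?c"
      using st c by (simp_all add: Let_def)
    then show "\<exists>c. u = fst_word K (Suc l) c \<and> v = snd_word K (Suc l) c" by blast
  next
    assume "\<exists>c. u = fst_word K (Suc l) c \<and> v = snd_word K (Suc l) c"
    then obtain c where c: "u = fst_word K (Suc l) c" "v = snd_word K (Suc l) c" by blast
    let ?c = "snd_code (snd_code (snd_code (snd_code c)))"
    have "(fst_word K l ?c, snd_word K l ?c) \<in> tw_pairs K l" using Suc by blast
    from tw_pairs_SucI[OF this] show "(u, v) \<in> tw_pairs K (Suc l)" unfolding c by (simp add: Let_def)
  qed
qed

lemma computable_code_run:
  assumes "computable t" "computable q" "computable w"
  shows "computable (\<lambda>x. code_run k (t x) (q x) (list_decode (w x)))"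
  unfolding code_run_def code_step_def
  by (intro computable_foldl[where F = "\<lambda>y i x. if i < k then nth_code (nth_code (t x) y) i else y"] assms(2,3)
      computable_if computable_pred_less computable_nth computable_const computable_unary computable_id
      computable_compose[OF assms(1)])

text \<open>Asking for the step on arbitrary computable arguments lets closure rules be applied to
  it without mentioning projections.\<close>

lemma computable_rec_comp:
  assumes "computable f" "computable b"
    and g: "\<And>Y X. computable Y \<Longrightarrow> computable X \<Longrightarrow> computable (\<lambda>p. g (Y p) (X p))"
  shows "computable (\<lambda>x. rec_nat (f x) (\<lambda>n y. g y x) (b x))"
  by (rule computable_rec[OF assms(1) _ assms(2)]) (intro g computable_unary computable_id)

text \<open>Only runs are computed, not the words: a run over a power is an iterated run over its
  base, so the exponent may itself depend on the input. \<open>l\<close> is fixed, hence an ordinary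
  induction; arbitrary \<open>q\<close> is needed since each factor starts where the preceding one
  ended.\<close>

lemma computable_word_run:
  "(\<forall>t K c q. computable t \<longrightarrow> computable K \<longrightarrow> computable c \<longrightarrow> computable q \<longrightarrow>
      computable (\<lambda>x. code_run k (t x) (q x) (fst_word (K x) l (c x)))) \<and>
   (\<forall>t K c q. computable t \<longrightarrow> computable K \<longrightarrow> computable c \<longrightarrow> computable q \<longrightarrow>
      computable (\<lambda>x. code_run k (t x) (q x) (snd_word (K x) l (c x))))"
proof (induction l)
  case 0
  have "code_run k t q [] = q" for t q by (simp add: code_run_def)
  then show ?case by (simp add: computable_code_run)
next
  case (Suc l)
  let ?c = "\<lambda>c. snd_code (snd_code (snd_code (snd_code c)))"
  have IH: "computable (\<lambda>x. code_run k (t x) (q x) (fst_word (K x) l (c x)))"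
    "computable (\<lambda>x. code_run k (t x) (q x) (snd_word (K x) l (c x)))"
    if "computable t" "computable K" "computable c" "computable q" for t K c q
    using Suc that by blast+
  have pow: "computable (\<lambda>x. code_run k (t x) (q x)
      (wpow (fst_word (K x) l (?c (c x)) @ list_decode (fst_code (snd_code (snd_code (c x))))) (K x)))"
    "computable (\<lambda>x. code_run k (t x) (q x)
      (wpow (list_decode (fst_code (snd_code (snd_code (snd_code (c x))))) @ fst_word (K x) l (?c (c x))) (K x)))"
    if a: "computable t" "computable K" "computable c" "computable q" for t K c q
    unfolding code_run_wpow code_run_append
    by (rule computable_rec_comp[OF a(4,2)];
        intro IH computable_code_run computable_compose[OF a(1)] computable_compose[OF a(2)]
          computable_compose[OF a(3)] computable_unary; assumption)+
  have "computable (\<lambda>x. code_run k (t x) (q x) (fst_word (K x) (Suc l) (c x)))"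
    "computable (\<lambda>x. code_run k (t x) (q x) (snd_word (K x) (Suc l) (c x)))"
    if a: "computable t" "computable K" "computable c" "computable q" for t K c q
    unfolding fst_word.simps snd_word.simps Let_def code_run_append
    by (intro IH pow computable_code_run computable_unary a)+
  then show ?case by blast
qed

definition dfa_of_code :: "nat \<Rightarrow> dfa" where
  "dfa_of_code n = DFA (nth_code n 0) (list_decode (nth_code n 1)) (map list_decode (list_decode (nth_code n 2)))"

lemma dfa_code_inverse:
  "length (list_decode (dfa_code D)) = 3" "dfa_of_code (dfa_code D) = D"
proof -
  show "length (list_decode (dfa_code D)) = 3" by (simp add: dfa_code_def)
  then show "dfa_of_code (dfa_code D) = D"
    by (cases D) (simp add: dfa_of_code_def nth_code, simp add: dfa_code_def comp_def)
qed

lemma dfa_of_code_inverse: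
  assumes "length (list_decode n) = 3"
  shows "dfa_code (dfa_of_code n) = n"
proof -
  obtain a b c where abc: "list_decode n = [a, b, c]"
    using assms by (auto simp: eval_nat_numeral length_Suc_conv)
  then have "nth_code n 0 = a" "nth_code n 1 = b" "nth_code n 2 = c" by (simp_all add: nth_code)
  then have "dfa_code (dfa_of_code n) = list_encode [a, b, c]"
    by (simp add: dfa_code_def dfa_of_code_def comp_def)
  then show ?thesis using abc by (metis list_decode_inverse)
qed

text \<open>\<open>nth_code\<close> is meaningful only within the length of a list; well-formedness
  keeps every state and letter in that range.\<close>

lemma code_run_dfa:
  assumes wf: "wf_dfa k D" and t: "map list_decode (list_decode t) = trans D"
  shows "q < length (trans D) \<Longrightarrow> code_run k t q w = dfa_run k D q w"
proof (induction w arbitrary: q)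
  case (Cons i w)
  have len: "length (list_decode t) = length (trans D)" using t by (metis length_map)
  have step: "code_step k t q i = dfa_step k D q i"
  proof (cases "i < k")
    case True
    have row: "list_decode (nth_code t q) = trans D ! q"
      using Cons.prems len nth_map[of q "list_decode t" list_decode] t by (simp add: nth_code)
    have "trans D ! q \<in> set (trans D)" using Cons.prems by simp
    then have "length (trans D ! q) = k" using wf by (auto simp: wf_dfa_def)
    then show ?thesis using True row nth_code[of i "nth_code t q"] by (simp add: code_step_def dfa_step_def)
  qed (simp add: code_step_def dfa_step_def)
  have "dfa_step k D q i < length (trans D)"
    using dfa_run_bound[OF wf Cons.prems, of "[i]"] by (simp add: dfa_run_def)
  from Cons.IH[OF this] show ?case by (simp add: code_run_def dfa_run_def step)
qed (simp add: code_run_def)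

section \<open>Bounds for the instances to be tested\<close>

lemma prod_encode_mono: "a \<le> a' \<Longrightarrow> b \<le> b' \<Longrightarrow> prod_encode (a, b) \<le> prod_encode (a', b')"
  unfolding prod_encode_def using triangle_mono[of "a + b" "a' + b'"] by simp

text \<open>The code of the list of \<open>n\<close> copies of \<open>k\<close>. As pairing is
  monotone, it bounds the codes of all words of length at most \<open>n\<close> over smaller
  letters.\<close>

definition word_bound :: "nat \<Rightarrow> nat \<Rightarrow> nat" where
  "word_bound k n = rec_nat 0 (\<lambda>i y. Suc (prod_encode (k, y))) n"

lemma list_encode_bound:
  assumes "w \<in> lists {..<k}" "length w \<le> n"
  shows "list_encode w \<le> word_bound k n"
  using assms
proof (induction n arbitrary: w)
  case (Suc n)
  show ?case
  proof (cases w)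
    case (Cons a v)
    then have "a \<le> k" "list_encode v \<le> word_bound k n" using Suc by auto
    then show ?thesis using Cons by (simp add: word_bound_def prod_encode_mono)
  qed simp
qed (simp add: word_bound_def)

text \<open>A shortest word with the given action is taken. There are at most \<open>n ^ n\<close>
  actions on \<open>n\<close> states, so in a longer word two prefixes would act alike and the
  factor between them could be cut out.\<close>

lemma short_word:
  assumes wf: "wf_dfa k D"
  obtains w' where "list_encode w' \<le> word_bound k (length (trans D) ^ length (trans D))"
    "dfa_action k D w' = dfa_action k D w"
proof -
  let ?n = "length (trans D)" and ?act = "dfa_action k D"
  define P where "P w' \<longleftrightarrow> w' \<in> lists {..<k} \<and> ?act w' = ?act w" for w'
  have "P (filter (\<lambda>i. i < k) w)"
  proof -
    have "dfa_run k D q (filter (\<lambda>i. i < k) w) = dfa_run k D q w" for q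
      unfolding dfa_run_def by (induction w arbitrary: q) (auto simp: dfa_step_def)
    then show ?thesis by (auto simp: P_def dfa_action_def)
  qed
  then obtain w' where w': "P w'" "\<And>y. P y \<Longrightarrow> length w' \<le> length y"
    using exists_least_iff[of "\<lambda>m. \<exists>y. P y \<and> length y = m"] by (metis not_le)
  have "length w' \<le> ?n ^ ?n"
  proof (rule ccontr)
    assume long: "\<not> length w' \<le> ?n ^ ?n"
    let ?S = "{xs. set xs \<subseteq> {..<?n} \<and> length xs = ?n}"
    have S: "card ?S = ?n ^ ?n" "finite ?S"
      using card_lists_length_eq[of "{..<?n}" ?n] finite_lists_length_eq[of "{..<?n}" ?n] by simp_all
    have "\<not> inj_on (\<lambda>i. ?act (take i w')) {..length w'}"
    proof
      assume "inj_on (\<lambda>i. ?act (take i w')) {..length w'}"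
      then have "card {..length w'} \<le> card ?S"
        by (rule card_inj_on_le[OF _ _ S(2)]) (use dfa_run_bound[OF wf] in \<open>auto simp: dfa_action_def\<close>)
      then show False using S(1) long by simp
    qed
    then obtain i0 j0 where ij0: "i0 \<le> length w'" "j0 \<le> length w'" "i0 \<noteq> j0"
      "?act (take i0 w') = ?act (take j0 w')" by (auto simp: inj_on_def)
    define i j where "i = min i0 j0" and "j = max i0 j0"
    have ij: "i < j" "j \<le> length w'" "?act (take i w') = ?act (take j w')"
      using ij0 by (auto simp: i_def j_def min_def max_def)
    have "?act (take i w' @ drop j w') = ?act (take j w' @ drop j w')"
      by (intro dfa_action_append[OF wf] ij refl)
    then have "P (take i w' @ drop j w')"
      using w'(1) by (auto simp: P_def in_lists_conv_set dest: in_set_takeD in_set_dropD)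
    from w'(2)[OF this] ij show False by simp
  qed
  then show ?thesis using that w'(1) list_encode_bound by (auto simp: P_def)
qed

text \<open>The largest nested tuple of the shape read by \<open>fst_word\<close> whose entries are
  at most \<open>W\<close>. For \<open>l = 1\<close> it has five entries, as many as the DA identity
  with its context has variables.\<close>

definition tuple_bound :: "nat \<Rightarrow> nat \<Rightarrow> nat" where
  "tuple_bound W l = rec_nat W (\<lambda>i y. prod_encode (W, prod_encode (W, prod_encode (W, prod_encode (W, y))))) l"

lemma dfa_action_wpow:
  assumes "wf_dfa k D" "dfa_action k D u = dfa_action k D v"
  shows "dfa_action k D (wpow u j) = dfa_action k D (wpow v j)"
  by (induction j) (auto intro: dfa_action_append[OF assms(1)] assms(2))

text \<open>The action of an instance depends only on the actions of the words put for its
  variables, and each of these can be replaced by a short word.\<close>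

lemma short_tuple:
  assumes wf: "wf_dfa k D"
  shows "\<exists>c'\<le>tuple_bound (word_bound k (length (trans D) ^ length (trans D))) l.
    dfa_action k D (fst_word K l c') = dfa_action k D (fst_word K l c) \<and>
    dfa_action k D (snd_word K l c') = dfa_action k D (snd_word K l c)"
proof (induction l arbitrary: c)
  case 0
  obtain w' where "list_encode w' \<le> word_bound k (length (trans D) ^ length (trans D))"
    "dfa_action k D w' = dfa_action k D (list_decode c)" by (rule short_word[OF wf])
  then show ?case by (intro exI[of _ "list_encode w'"]) (simp add: tuple_bound_def)
next
  case (Suc l)
  let ?W = "word_bound k (length (trans D) ^ length (trans D))" and ?act = "dfa_action k D"
  have short: "\<exists>d\<le>?W. ?act (list_decode d) = ?act (list_decode d')" for d'
    using short_word[OF wf, of "list_decode d'"] by (metis list_encode_inverse)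
  obtain d0 d1 d2 d3 where d: "d0 \<le> ?W" "d1 \<le> ?W" "d2 \<le> ?W" "d3 \<le> ?W"
    "?act (list_decode d0) = ?act (list_decode (fst_code c))"
    "?act (list_decode d1) = ?act (list_decode (fst_code (snd_code c)))"
    "?act (list_decode d2) = ?act (list_decode (fst_code (snd_code (snd_code c))))"
    "?act (list_decode d3) = ?act (list_decode (fst_code (snd_code (snd_code (snd_code c)))))"
    using short by meson
  obtain e where e: "e \<le> tuple_bound ?W l"
    "?act (fst_word K l e) = ?act (fst_word K l (snd_code (snd_code (snd_code (snd_code c)))))"
    "?act (snd_word K l e) = ?act (snd_word K l (snd_code (snd_code (snd_code (snd_code c)))))"
    using Suc.IH by meson
  let ?c = "prod_encode (d0, prod_encode (d1, prod_encode (d2, prod_encode (d3, e))))"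
  have "?c \<le> tuple_bound ?W (Suc l)"
    using d(1-4) e(1) by (simp add: tuple_bound_def prod_encode_mono)
  moreover have "?act (fst_word K (Suc l) ?c) = ?act (fst_word K (Suc l) c)"
    "?act (snd_word K (Suc l) ?c) = ?act (snd_word K (Suc l) c)"
    unfolding fst_word.simps snd_word.simps Let_def code_pair
    by (intro dfa_action_append[OF wf] dfa_action_wpow[OF wf] d(5-8) e(2,3))+
  ultimately show ?case by blast
qed

definition da_left :: "nat \<Rightarrow> nat \<Rightarrow> nat list" where
  "da_left K c = (let z = list_decode (fst_code c); c1 = snd_code c;
     z' = list_decode (fst_code c1); c2 = snd_code c1; x = list_decode (fst_code c2); c3 = snd_code c2;
     y = list_decode (fst_code c3); w = list_decode (snd_code c3)
     in z @ wpow (x @ y @ w) K @ y @ wpow (x @ y @ w) K @ z')"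

definition da_right :: "nat \<Rightarrow> nat \<Rightarrow> nat list" where
  "da_right K c = (let z = list_decode (fst_code c); c1 = snd_code c;
     z' = list_decode (fst_code c1); c2 = snd_code c1; x = list_decode (fst_code c2); c3 = snd_code c2;
     y = list_decode (fst_code c3); w = list_decode (snd_code c3)
     in z @ wpow (x @ y @ w) K @ z')"

lemma short_da_tuple:
  assumes wf: "wf_dfa k D"
  shows "\<exists>c'\<le>tuple_bound (word_bound k (length (trans D) ^ length (trans D))) (Suc 0).
    dfa_action k D (da_left K c') = dfa_action k D (da_left K c) \<and>
    dfa_action k D (da_right K c') = dfa_action k D (da_right K c)"
proof -
  let ?W = "word_bound k (length (trans D) ^ length (trans D))" and ?act = "dfa_action k D"
  have short: "\<exists>d\<le>?W. ?act (list_decode d) = ?act (list_decode d')" for d'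
    using short_word[OF wf, of "list_decode d'"] by (metis list_encode_inverse)
  obtain d0 d1 d2 d3 e where d: "d0 \<le> ?W" "d1 \<le> ?W" "d2 \<le> ?W" "d3 \<le> ?W" "e \<le> ?W"
    "?act (list_decode d0) = ?act (list_decode (fst_code c))"
    "?act (list_decode d1) = ?act (list_decode (fst_code (snd_code c)))"
    "?act (list_decode d2) = ?act (list_decode (fst_code (snd_code (snd_code c))))"
    "?act (list_decode d3) = ?act (list_decode (fst_code (snd_code (snd_code (snd_code c)))))"
    "?act (list_decode e) = ?act (list_decode (snd_code (snd_code (snd_code (snd_code c)))))"
    using short by meson
  let ?c = "prod_encode (d0, prod_encode (d1, prod_encode (d2, prod_encode (d3, e))))"
  have "?c \<le> tuple_bound ?W (Suc 0)"
    using d(1-5) by (simp add: tuple_bound_def prod_encode_mono)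
  moreover have "?act (da_left K ?c) = ?act (da_left K c)" "?act (da_right K ?c) = ?act (da_right K c)"
    unfolding da_left_def da_right_def Let_def code_pair
    by (intro dfa_action_append[OF wf] dfa_action_wpow[OF wf] d)+
  ultimately show ?thesis by blast
qed

lemma da_code: "(\<exists>z z' x y w. u = z @ wpow (x @ y @ w) K @ y @ wpow (x @ y @ w) K @ z' \<and>
    v = z @ wpow (x @ y @ w) K @ z') \<longleftrightarrow> (\<exists>c. u = da_left K c \<and> v = da_right K c)"
proof
  assume "\<exists>z z' x y w. u = z @ wpow (x @ y @ w) K @ y @ wpow (x @ y @ w) K @ z' \<and>
    v = z @ wpow (x @ y @ w) K @ z'"
  then obtain z z' x y w where "u = z @ wpow (x @ y @ w) K @ y @ wpow (x @ y @ w) K @ z'"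
    "v = z @ wpow (x @ y @ w) K @ z'" by blast
  then show "\<exists>c. u = da_left K c \<and> v = da_right K c"
    by (intro exI[of _ "prod_encode (list_encode z, prod_encode (list_encode z', prod_encode (list_encode x,
      prod_encode (list_encode y, list_encode w))))"]) (simp add: da_left_def da_right_def Let_def)
next
  assume "\<exists>c. u = da_left K c \<and> v = da_right K c"
  then show "\<exists>z z' x y w. u = z @ wpow (x @ y @ w) K @ y @ wpow (x @ y @ w) K @ z' \<and>
    v = z @ wpow (x @ y @ w) K @ z'"
    unfolding da_left_def da_right_def Let_def by blast
qed

definition code_states :: "nat \<Rightarrow> nat" where
  "code_states n = length (list_decode (nth_code n 2))"

definition code_acc :: "nat \<Rightarrow> nat \<Rightarrow> nat list \<Rightarrow> bool" where
  "code_acc k n w \<longleftrightarrow> code_run k (nth_code n 2) (nth_code n 0) w \<in> set (list_decode (nth_code n 1))"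

lemma code_acc_dfa:
  assumes "wf_dfa k (dfa_of_code n)"
  shows "code_acc k n w = dfa_acc k (dfa_of_code n) w"
proof -
  have "nth_code n 0 < length (trans (dfa_of_code n))"
    using assms by (simp add: wf_dfa_def dfa_of_code_def)
  then have "code_run k (nth_code n 2) (nth_code n 0) w = dfa_run k (dfa_of_code n) (nth_code n 0) w"
    by (intro code_run_dfa[OF assms]) (simp_all add: dfa_of_code_def)
  then show ?thesis by (simp add: code_acc_def dfa_acc_def dfa_of_code_def)
qed

definition tw_test :: "nat \<Rightarrow> nat \<Rightarrow> nat \<Rightarrow> bool" where
  "tw_test l k n \<longleftrightarrow>
    (\<forall>c\<le>tuple_bound (word_bound k (code_states n ^ code_states n)) (Suc l).
       code_acc k n (fst_word (fact (code_states n)) (Suc l) c) =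
       code_acc k n (snd_word (fact (code_states n)) (Suc l) c)) \<and>
    (\<forall>c\<le>tuple_bound (word_bound k (code_states n ^ code_states n)) (Suc 0).
       code_acc k n (da_left (fact (code_states n)) c) =
       code_acc k n (da_right (fact (code_states n)) c))"

lemma tw_test_iff:
  assumes wf: "wf_dfa k (dfa_of_code n)"
  shows "tw_test l k n \<longleftrightarrow> tw_condition l k (dfa_of_code n)"
proof -
  let ?D = "dfa_of_code n"
  let ?W = "word_bound k (length (trans ?D) ^ length (trans ?D))" and ?K = "fact (length (trans ?D)) :: nat"
  have N: "code_states n = length (trans ?D)" by (simp add: code_states_def dfa_of_code_def)
  have bound: "(\<forall>c\<le>b. dfa_acc k ?D (f c) = dfa_acc k ?D (g c)) \<longleftrightarrow> (\<forall>c. dfa_acc k ?D (f c) = dfa_acc k ?D (g c))"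
    if "\<And>c. \<exists>c'\<le>b. dfa_action k ?D (f c') = dfa_action k ?D (f c) \<and> dfa_action k ?D (g c') = dfa_action k ?D (g c)"
    for f g and b :: nat
    using that dfa_acc_action[OF wf] by metis
  have "tw_test l k n \<longleftrightarrow>
      (\<forall>c. dfa_acc k ?D (fst_word ?K (Suc l) c) = dfa_acc k ?D (snd_word ?K (Suc l) c)) \<and>
      (\<forall>c. dfa_acc k ?D (da_left ?K c) = dfa_acc k ?D (da_right ?K c))"
    unfolding tw_test_def N code_acc_dfa[OF wf]
    by (intro arg_cong2[where f = "(\<and>)"] bound short_tuple[OF wf] short_da_tuple[OF wf])
  also have "(\<forall>c. dfa_acc k ?D (fst_word ?K (Suc l) c) = dfa_acc k ?D (snd_word ?K (Suc l) c)) \<longleftrightarrow>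
      (\<forall>(u, v)\<in>tw_pairs ?K (Suc l). dfa_acc k ?D u = dfa_acc k ?D v)"
    unfolding Ball_def split_paired_All prod.case tw_pairs_code by blast
  also have "(\<forall>c. dfa_acc k ?D (da_left ?K c) = dfa_acc k ?D (da_right ?K c)) \<longleftrightarrow>
      (\<forall>u v. (\<exists>c. u = da_left ?K c \<and> v = da_right ?K c) \<longrightarrow> dfa_acc k ?D u = dfa_acc k ?D v)" by blast
  also have "\<dots> \<longleftrightarrow> (\<forall>z z' x y w. dfa_acc k ?D (z @ wpow (x @ y @ w) ?K @ y @ wpow (x @ y @ w) ?K @ z') =
        dfa_acc k ?D (z @ wpow (x @ y @ w) ?K @ z'))"
    unfolding da_code[symmetric] by blast
  finally show ?thesis by (simp add: tw_condition_def Let_def)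
qed

section \<open>Computability of the test\<close>

lemma computable_nth_const: "computable f \<Longrightarrow> computable (\<lambda>x. nth_code (f x) i)"
  by (rule computable_nth[OF _ computable_const])

lemma computable_code_states: "computable f \<Longrightarrow> computable (\<lambda>x. code_states (f x))"
  unfolding code_states_def by (intro computable_length computable_nth_const)

lemma computable_fact:
  assumes "computable f"
  shows "computable (\<lambda>x. fact (f x))"
proof -
  have "rec_nat 1 (\<lambda>i y. Suc i * y) n = fact n" for n :: nat by (induction n) auto
  moreover have "computable (\<lambda>x. rec_nat 1 (\<lambda>i y. Suc i * y) (f x))"
    by (intro computable_rec[where g = "\<lambda>i y x. Suc i * y"] assms computable_const computable_arith
        computable_unary computable_id)
  ultimately show ?thesis by simp
qed

lemma computable_power_self:
  assumes "computable f"
  shows "computable (\<lambda>x. f x ^ f x)"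
proof -
  have "rec_nat 1 (\<lambda>i y. b * y) n = b ^ n" for b n :: nat by (induction n) auto
  moreover have "computable (\<lambda>x. rec_nat 1 (\<lambda>i y. f x * y) (f x))"
    by (intro computable_rec[where g = "\<lambda>i y x. f x * y"] assms computable_const computable_arith
        computable_unary computable_id computable_compose[OF assms])
  ultimately show ?thesis by simp
qed

lemma computable_tuple_bound:
  assumes "computable f"
  shows "computable (\<lambda>x. tuple_bound (word_bound k (f x)) l)"
proof -
  have W: "computable (\<lambda>x. word_bound k (f x))"
    unfolding word_bound_def
    by (intro computable_rec[where g = "\<lambda>i y x. Suc (prod_encode (k, y))"] assms computable_const
        computable_arith computable_unary computable_id)
  show ?thesis
    by (induction l) (simp_all add: tuple_bound_def W computable_arith)
qed

lemma computable_da_run: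
  assumes a: "computable t" "computable q" "computable K" "computable c"
  shows "computable (\<lambda>x. code_run k (t x) (q x) (da_left (K x) (c x)))"
    "computable (\<lambda>x. code_run k (t x) (q x) (da_right (K x) (c x)))"
proof -
  have pow: "computable (\<lambda>x. code_run k (t x) (q x) (wpow (list_decode (fst_code (snd_code (snd_code (c x)))) @
      list_decode (fst_code (snd_code (snd_code (snd_code (c x))))) @
      list_decode (snd_code (snd_code (snd_code (snd_code (c x)))))) (K x)))" if "computable q" for q
    unfolding code_run_wpow code_run_append
    by (rule computable_rec_comp[OF that a(3)])
      (intro computable_code_run computable_compose[OF a(1)] computable_compose[OF a(4)] computable_unary; assumption)
  show "computable (\<lambda>x. code_run k (t x) (q x) (da_left (K x) (c x)))"
    "computable (\<lambda>x. code_run k (t x) (q x) (da_right (K x) (c x)))"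
    unfolding da_left_def da_right_def Let_def code_run_append
    by (intro pow computable_code_run computable_unary a)+
qed

lemma computable_tw_test: "computable_pred (tw_test l k)"
proof -
  note rules = computable_pred_mem computable_nth_const computable_unary computable_id
    computable_fact computable_code_states
  have "computable_pred (\<lambda>p. code_acc k (snd_code p) (fst_word (fact (code_states (snd_code p))) (Suc l) (fst_code p)))"
    "computable_pred (\<lambda>p. code_acc k (snd_code p) (snd_word (fact (code_states (snd_code p))) (Suc l) (fst_code p)))"
    unfolding code_acc_def
    by (intro rules computable_word_run[THEN conjunct1, rule_format] computable_word_run[THEN conjunct2, rule_format])+
  moreover have "computable_pred (\<lambda>p. code_acc k (snd_code p) (da_left (fact (code_states (snd_code p))) (fst_code p)))"
    "computable_pred (\<lambda>p. code_acc k (snd_code p) (da_right (fact (code_states (snd_code p))) (fst_code p)))"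
    unfolding code_acc_def by (intro rules computable_da_run)+
  ultimately have "computable_pred (\<lambda>n. tw_test l k n)"
    unfolding tw_test_def
    by (intro computable_pred_conj computable_pred_ball_le computable_pred_iff computable_tuple_bound
        computable_power_self computable_code_states computable_id)
  then show ?thesis by simp
qed

lemma computable_wf_dfa: "computable_pred (\<lambda>n. wf_dfa k (dfa_of_code n))"
proof -
  have "computable_pred (\<lambda>n. nth_code n 0 < code_states n \<and>
      (\<forall>e\<in>set (list_decode (nth_code n 1)). e < code_states n) \<and>
      (\<forall>row\<in>set (list_decode (nth_code n 2)). length (list_decode row) = k \<and>
        (\<forall>e\<in>set (list_decode row). e < code_states n)))"
    by (intro computable_pred_conj computable_pred_ball computable_pred_less computable_pred_eq
        computable_length computable_nth_const computable_code_states computable_unary computable_const computable_id)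
  then show ?thesis
    by (rule back_subst[of computable_pred])
      (auto simp: wf_dfa_def dfa_of_code_def code_states_def fun_eq_iff subset_iff)
qed

lemma decidable_definable:
  assumes "distinct as"
  shows "decidable {dfa_code D | D. wf_dfa (length as) D \<and>
    itl_definable (set as) (Suc (Suc l)) (dfa_lang as D)}"
proof -
  let ?k = "length as"
  \<comment> \<open>\<open>dfa_of_code\<close> yields an automaton for every number; decoding to
    three entries singles out the numbers that are codes.\<close>
  have "computable_pred (\<lambda>n. length (list_decode n) = 3 \<and> wf_dfa ?k (dfa_of_code n) \<and> tw_test l ?k n)"
    by (intro computable_pred_conj computable_pred_eq computable_length computable_const computable_id
        computable_wf_dfa computable_tw_test)
  then have "decidable {n. length (list_decode n) = 3 \<and> wf_dfa ?k (dfa_of_code n) \<and> tw_test l ?k n}"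
    by (rule decidable_if_computable_pred)
  moreover have "{n. length (list_decode n) = 3 \<and> wf_dfa ?k (dfa_of_code n) \<and> tw_test l ?k n} =
      {dfa_code D | D. wf_dfa ?k D \<and> itl_definable (set as) (Suc (Suc l)) (dfa_lang as D)}"
  proof (intro equalityI subsetI)
    fix n assume "n \<in> {n. length (list_decode n) = 3 \<and> wf_dfa ?k (dfa_of_code n) \<and> tw_test l ?k n}"
    then have n: "length (list_decode n) = 3" "wf_dfa ?k (dfa_of_code n)" "tw_test l ?k n" by auto
    then have "itl_definable (set as) (Suc (Suc l)) (dfa_lang as (dfa_of_code n))"
      using tw_test_iff[OF n(2)] definable_iff_tw_condition[OF assms n(2)] by simp
    with n(2) dfa_of_code_inverse[OF n(1)]
    show "n \<in> {dfa_code D | D. wf_dfa ?k D \<and> itl_definable (set as) (Suc (Suc l)) (dfa_lang as D)}"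
      by (metis (mono_tags, lifting) mem_Collect_eq)
  next
    fix n assume "n \<in> {dfa_code D | D. wf_dfa ?k D \<and> itl_definable (set as) (Suc (Suc l)) (dfa_lang as D)}"
    then obtain D where D: "n = dfa_code D" "wf_dfa ?k D" "itl_definable (set as) (Suc (Suc l)) (dfa_lang as D)"
      by auto
    have "dfa_of_code n = D" "length (list_decode n) = 3" using D(1) dfa_code_inverse[of D] by simp_all
    then show "n \<in> {n. length (list_decode n) = 3 \<and> wf_dfa ?k (dfa_of_code n) \<and> tw_test l ?k n}"
      using D(2,3) tw_test_iff[of ?k n l] definable_iff_tw_condition[OF assms D(2)] by simp
  qed
  ultimately show ?thesis by simp
qed

theorem corollary3:
  fixes A :: "'a set" and m :: nat
  assumes "finite A" and "m \<ge> 2"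
  shows "(\<forall>L \<subseteq> lists A.
            itl_definable A m L \<longleftrightarrow> (\<exists>M \<in> variety_join (TW_R m) (TW_L m). recognizes M A L))
       \<and> (\<forall>as. distinct as \<and> set as = A \<longrightarrow>
            decidable {dfa_code D | D. wf_dfa (length as) D \<and> itl_definable A m (dfa_lang as D)})"
proof -
  obtain k where m: "m = Suc (Suc k)" using assms(2) by (metis add_2_eq_Suc le_Suc_ex)
  show ?thesis unfolding m
    using definable_iff_recognized[OF assms(1), of _ k] decidable_definable by blast
qed

end
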